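(* Let $\nu>0$ and $\alpha\ge0$, and consider the complex KdV-Burgers problem $u_t-6uu_x+\alpha u_{xxx}-\nu u_{xx}=0$ for $x\in\mathbf{T}=\mathbf{R}/(2\pi\mathbf{Z})$, $t>0$, with $u(x,0)=u_0(x)$. Assume $u_0\in H^{s_0}(\mathbf{T})$ for some $s_0>\frac12$ can be represented as $u_0(x)=\sum_{k=1}^\infty a_{0k}e^{ikx}$ with $$|a_{0k}|\le1,\qquad k=1,2,\dots$$ Suppose there is a constant $C_0(\alpha,\nu)$ such that the coefficients $C(\alpha,\nu,k,h,l,j_1,\dots,j_k)$ defined in the context satisfy $$|C(\alpha,\nu,k,h,l,j_1,\dots,j_k)|\le C_0(\alpha,\nu)$$ for all $k\ge1$, $k\le h<k^2$, $k\le l<k^3$ and all nonnegative integers $(j_1,\dots,j_k)$ with $j_1+2j_2+\cdots+kj_k=k$. Then the problem has a unique global solution $u$, given by $u(x,t)=\sum_{k=1}^\infty a_k(t)e^{ikx}$. In addition, for any $s\ge0$, there are $T_0>0$ and $\delta>0$ such that for any $t\ge T_0$, $$\|u(\cdot,t)\|_{H^s}<\frac{C(\alpha,\nu,s)}{1-e^{-\nu t}}\,e^{-\delta\nu t},$$ where $C(\alpha,\nu,s)$ is a constant depending on $\alpha$, $\nu$ and $s$ only.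
   Context: $u$ is complex-valued and $2\pi$-periodic in $x$; for $u=\sum_{k\ge1}a_ke^{ikx}$, $\|u\|_{H^s}^2=\sum_{k\ge1}(1+k^2)^s|a_k|^2$. For data $u_0=\sum_{k\ge1}a_{0k}e^{ikx}$, the Fourier coefficients of the solution $u=\sum_{k\ge1}a_k(t)e^{ikx}$ satisfy $$a_k(t)=e^{-(\nu k^2-i\alpha k^3)t}\Big[a_{0k}+3ik\int_0^te^{(\nu k^2-i\alpha k^3)\tau}\sum_{k_1+k_2=k,\ k_1,k_2\ge1}a_{k_1}(\tau)a_{k_2}(\tau)\,d\tau\Big].$$ Computing $a_1,a_2,\dots$ successively from this formula gives $$a_k(t)=\sum_{k\le h\le k^2,\ k\le l\le k^3}a_{k,h,l}\,e^{-(\nu h-i\alpha l)t},$$ where the product of the exponentials with indices $(h_1,l_1)$ and $(h_2,l_2)$ is recorded with index $(h_1+h_2,l_1+l_2)$, the exponential $e^{-(\nu k^2-i\alpha k^3)t}$ in $a_k$ is recorded with index $(k^2,k^3)$, and $a_{k,h,l}=0$ for indices that do not arise (when $\nu,\alpha>0$ these coefficients are uniquely determined by the function $a_k(t)$). Each $a_{k,h,l}$ is a polynomial in $a_{01},\dots,a_{0k}$ which is a finite sum of terms $$C(\alpha,\nu,k,h,l,j_1,\dots,j_k)\,a_{01}^{j_1}a_{02}^{j_2}\cdots a_{0k}^{j_k}$$ with nonnegative integers $j_1,\dots,j_k$ satisfying $j_1+2j_2+\cdots+kj_k=k$; $C(\alpha,\nu,k,h,l,j_1,\dots,j_k)$ denotes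 the coefficient of this monomial, and does not depend on $u_0$. *)

theory Defs
  imports "HOL-Analysis.Analysis" "HOL-Library.Poly_Mapping"
begin

section \<open>Sobolev spaces on the torus\<close>

definition periodic_2pi :: "(real \<Rightarrow> complex) \<Rightarrow> bool" where
  "periodic_2pi f \<longleftrightarrow> (\<forall>x. f (x + 2 * pi) = f x)"

definition fourier_coeff :: "(real \<Rightarrow> complex) \<Rightarrow> int \<Rightarrow> complex" where
  "fourier_coeff f k =
     (LINT x:{0..2*pi}|lebesgue. f x * cis (- (of_int k * x))) / complex_of_real (2 * pi)"

text \<open>
  All integer frequencies are admitted, so that a competing solution is not assumed to have
  positive frequencies only. If \<open>f = (\<Sum>k\<ge>1. a k * cis (k * x))\<close>, the norm is
  \<open>sqrt (\<Sum>k\<ge>1. (1 + k\<^sup>2) powr s * (cmod (a k))\<^sup>2)\<close>. It is meaningful only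
  for \<open>f \<in> sobolev s\<close>: elsewhere \<open>infsum\<close> may return a default value.
\<close>

definition sobolev :: "real \<Rightarrow> (real \<Rightarrow> complex) set" where
  "sobolev s = {f. periodic_2pi f
     \<and> f \<in> borel_measurable lebesgue
     \<and> set_integrable lebesgue {0..2*pi} (\<lambda>x. (cmod (f x))\<^sup>2)
     \<and> (\<lambda>k::int. (1 + (of_int k)\<^sup>2) powr s * (cmod (fourier_coeff f k))\<^sup>2) summable_on UNIV}"

definition sobolev_norm :: "real \<Rightarrow> (real \<Rightarrow> complex) \<Rightarrow> real" where
  "sobolev_norm s f =
     sqrt (\<Sum>\<^sub>\<infinity>k::int. (1 + (of_int k)\<^sup>2) powr s * (cmod (fourier_coeff f k))\<^sup>2)"


section \<open>Solutions of the initial value problem\<close>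

text \<open>
  The argument order is \<open>u x t\<close>. A global solution with data in \<open>H\<^sup>s\<close> is continuous
  from \<open>[0,\<infinity>)\<close> into \<open>H\<^sup>s\<close>, takes the initial value at \<open>t = 0\<close>, and satisfies
  the equation classically for \<open>t > 0\<close>. Values \<open>u x t\<close> with \<open>t < 0\<close> are irrelevant.
\<close>

definition kdvb_classical :: "real \<Rightarrow> real \<Rightarrow> (real \<Rightarrow> real \<Rightarrow> complex) \<Rightarrow> bool" where
  "kdvb_classical \<nu> \<alpha> u \<longleftrightarrow>
     (\<exists>ut ux uxx uxxx :: real \<Rightarrow> real \<Rightarrow> complex.
        (\<forall>x. \<forall>t>0.
            ((\<lambda>\<tau>. u x \<tau>) has_vector_derivative ut x t) (at t)
          \<and> ((\<lambda>y. u y t) has_vector_derivative ux x t) (at x)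
          \<and> ((\<lambda>y. ux y t) has_vector_derivative uxx x t) (at x)
          \<and> ((\<lambda>y. uxx y t) has_vector_derivative uxxx x t) (at x)
          \<and> ut x t - 6 * u x t * ux x t + complex_of_real \<alpha> * uxxx x t
              - complex_of_real \<nu> * uxx x t = 0)
      \<and> (\<forall>w\<in>{ut, ux, uxx, uxxx}. continuous_on (UNIV \<times> {0<..}) (\<lambda>(x, t). w x t)))"

definition kdvb_global_solution ::
    "real \<Rightarrow> real \<Rightarrow> real \<Rightarrow> (real \<Rightarrow> complex) \<Rightarrow> (real \<Rightarrow> real \<Rightarrow> complex) \<Rightarrow> bool" where
  "kdvb_global_solution \<nu> \<alpha> s u0 u \<longleftrightarrow>
     (\<forall>t\<ge>0. (\<lambda>x. u x t) \<in> sobolev s)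
   \<and> (\<forall>t\<ge>0. ((\<lambda>\<tau>. sobolev_norm s (\<lambda>x. u x \<tau> - u x t)) \<longlongrightarrow> 0) (at t within {0..}))
   \<and> (\<forall>x. u x 0 = u0 x)
   \<and> kdvb_classical \<nu> \<alpha> u"


section \<open>The Fourier coefficients of the solution\<close>

text \<open>
  \<open>rate \<nu> \<alpha> (h, l)\<close> is the exponent \<open>\<nu>h - i\<alpha>l\<close>; it is additive in \<open>(h, l)\<close>.
\<close>

definition rate :: "real \<Rightarrow> real \<Rightarrow> nat \<times> nat \<Rightarrow> complex" where
  "rate \<nu> \<alpha> p =
     complex_of_real \<nu> * of_nat (fst p) - \<i> * complex_of_real \<alpha> * of_nat (snd p)"

declare sum.cong [fundef_cong]

text \<open>
  The variation of constants formula, read as a recursion on \<open>k\<close>: the sum over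
  \<open>k\<^sub>1 + k\<^sub>2 = k\<close> with \<open>k\<^sub>1, k\<^sub>2 \<ge> 1\<close> is indexed by \<open>m = k\<^sub>1\<close>. Only \<open>k \<ge> 1\<close> is meaningful.
\<close>

function sol_coeff :: "real \<Rightarrow> real \<Rightarrow> (nat \<Rightarrow> complex) \<Rightarrow> nat \<Rightarrow> real \<Rightarrow> complex" where
  "sol_coeff \<nu> \<alpha> a0 k t =
     exp (- rate \<nu> \<alpha> (k^2, k^3) * of_real t) *
       (a0 k + 3 * \<i> * of_nat k *
          integral {0..t} (\<lambda>\<tau>. exp (rate \<nu> \<alpha> (k^2, k^3) * of_real \<tau>) *
            (\<Sum>m\<in>{1..<k}. sol_coeff \<nu> \<alpha> a0 m \<tau> * sol_coeff \<nu> \<alpha> a0 (k - m) \<tau>)))"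
  by pat_completeness auto
termination
  by (relation "Wellfounded.measure (\<lambda>(\<nu>, \<alpha>, a0, k, t). k)") auto

declare sol_coeff.simps [simp del]


section \<open>The expansion into exponentials\<close>

text \<open>
  \<open>data_poly\<close> is the ring of complex polynomials in the unknowns \<open>a\<^sub>0\<^sub>1, a\<^sub>0\<^sub>2, \<dots>\<close>
  (a monomial \<open>j\<close> has the exponent \<open>lookup j i\<close> in the unknown \<open>a\<^sub>0\<^sub>i\<close>). In an
  \<open>exp_poly\<close>, the coefficient at \<open>(h, l)\<close> is that of the exponential recorded with
  index \<open>(h, l)\<close>; multiplication of polynomial mappings adds these indices.
\<close>

type_synonym data_poly = "(nat \<Rightarrow>\<^sub>0 nat) \<Rightarrow>\<^sub>0 complex"
type_synonym exp_poly = "(nat \<times> nat) \<Rightarrow>\<^sub>0 data_poly"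

definition data_var :: "nat \<Rightarrow> data_poly" where
  "data_var k = Poly_Mapping.single (Poly_Mapping.single k 1) 1"

definition data_const :: "complex \<Rightarrow> data_poly" where
  "data_const c = Poly_Mapping.single 0 c"

text \<open>
  With \<open>\<lambda>\<close> the rate of \<open>(k\<^sup>2, k\<^sup>3)\<close> and \<open>\<mu>\<close> that of \<open>p\<close>, the operator
  \<open>g \<mapsto> 3ik e\<^sup>-\<^sup>\<lambda>\<^sup>t \<integral>\<^sub>0\<^sup>t e\<^sup>\<lambda>\<^sup>\<tau> g(\<tau>) d\<tau>\<close> sends the exponential of rate \<open>\<mu>\<close> to
  \<open>3ik / (\<lambda> - \<mu>)\<close> times the difference of the exponentials of rates \<open>\<mu>\<close> and \<open>\<lambda>\<close>.
  The denominator is nonzero for \<open>\<nu> > 0\<close> and \<open>fst p < k\<^sup>2\<close>, the only case that occurs.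
\<close>

definition duhamel :: "real \<Rightarrow> real \<Rightarrow> nat \<Rightarrow> exp_poly \<Rightarrow> exp_poly" where
  "duhamel \<nu> \<alpha> k P =
     (\<Sum>p\<in>Poly_Mapping.keys P.
        let c = data_const (3 * \<i> * of_nat k / (rate \<nu> \<alpha> (k^2, k^3) - rate \<nu> \<alpha> p))
                  * Poly_Mapping.lookup P p
        in Poly_Mapping.single p c - Poly_Mapping.single (k^2, k^3) c)"

function sol_expansion :: "real \<Rightarrow> real \<Rightarrow> nat \<Rightarrow> exp_poly" where
  "sol_expansion \<nu> \<alpha> k =
     Poly_Mapping.single (k^2, k^3) (data_var k)
     + duhamel \<nu> \<alpha> k (\<Sum>m\<in>{1..<k}. sol_expansion \<nu> \<alpha> m * sol_expansion \<nu> \<alpha> (k - m))"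
  by pat_completeness auto
termination
  by (relation "Wellfounded.measure (\<lambda>(\<nu>, \<alpha>, k). k)") auto

declare sol_expansion.simps [simp del]

text \<open>The coefficient \<open>C(\<alpha>, \<nu>, k, h, l, j\<^sub>1, \<dots>, j\<^sub>k)\<close>.\<close>

definition C_coeff :: "real \<Rightarrow> real \<Rightarrow> nat \<Rightarrow> nat \<Rightarrow> nat \<Rightarrow> (nat \<Rightarrow>\<^sub>0 nat) \<Rightarrow> complex" where
  "C_coeff \<alpha> \<nu> k h l j =
     Poly_Mapping.lookup (Poly_Mapping.lookup (sol_expansion \<nu> \<alpha> k) (h, l)) j"


section \<open>The formal expansion represents the Fourier coefficients\<close>

definition eval_mapping ::
    "('b \<Rightarrow> complex) \<Rightarrow> ('a \<Rightarrow> complex) \<Rightarrow> ('a \<Rightarrow>\<^sub>0 'b::zero) \<Rightarrow> complex" where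
  "eval_mapping g \<phi> P =
     (\<Sum>p\<in>Poly_Mapping.keys P. g (Poly_Mapping.lookup P p) * \<phi> p)"

definition eval_data :: "(nat \<Rightarrow> complex) \<Rightarrow> data_poly \<Rightarrow> complex" where
  "eval_data a0 = eval_mapping id
     (\<lambda>j. \<Prod>i\<in>Poly_Mapping.keys j. a0 i ^ Poly_Mapping.lookup j i)"

lemma eval_mapping_superset:
  assumes "finite A" "Poly_Mapping.keys P \<subseteq> A" "g 0 = 0"
  shows "eval_mapping g \<phi> P = (\<Sum>p\<in>A. g (Poly_Mapping.lookup P p) * \<phi> p)"
  unfolding eval_mapping_def
  by (rule sum.mono_neutral_left) (use assms in \<open>auto simp: in_keys_iff\<close>)

lemma eval_mapping_zero [simp]: "eval_mapping g \<phi> 0 = 0"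
  by (simp add: eval_mapping_def)

lemma eval_mapping_single [simp]:
  "g 0 = 0 \<Longrightarrow> eval_mapping g \<phi> (Poly_Mapping.single p c) = g c * \<phi> p"
  by (simp add: eval_mapping_def)

lemma eval_mapping_add:
  fixes P Q :: "'a \<Rightarrow>\<^sub>0 'b::comm_monoid_add"
  assumes "g 0 = 0" "\<And>x y. g (x + y) = g x + g y"
  shows "eval_mapping g \<phi> (P + Q) = eval_mapping g \<phi> P + eval_mapping g \<phi> Q"
proof -
  let ?A = "Poly_Mapping.keys P \<union> Poly_Mapping.keys Q"
  show ?thesis
    by (subst (1 2 3) eval_mapping_superset[of ?A])
       (use keys_add[of P Q] in \<open>auto simp: assms lookup_add algebra_simps sum.distrib\<close>)
qed

lemma eval_mapping_sum:
  fixes P :: "'c \<Rightarrow> 'a \<Rightarrow>\<^sub>0 'b::comm_monoid_add"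
  assumes "g 0 = 0" "\<And>x y. g (x + y) = g x + g y"
  shows "eval_mapping g \<phi> (\<Sum>i\<in>I. P i) = (\<Sum>i\<in>I. eval_mapping g \<phi> (P i))"
  by (induction I rule: infinite_finite_induct) (auto simp: eval_mapping_add assms)

lemma poly_mapping_eq_sum_single:
  fixes P :: "'a \<Rightarrow>\<^sub>0 'b::comm_monoid_add"
  shows "P = (\<Sum>p\<in>Poly_Mapping.keys P. Poly_Mapping.single p (Poly_Mapping.lookup P p))"
proof (rule poly_mapping_eqI)
  fix q
  show "Poly_Mapping.lookup P q = Poly_Mapping.lookup
      (\<Sum>p\<in>Poly_Mapping.keys P. Poly_Mapping.single p (Poly_Mapping.lookup P p)) q"
    by (auto simp: lookup_sum lookup_single when_def in_keys_iff)
qed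

lemma eval_mapping_mult:
  fixes P Q :: "'a::comm_monoid_add \<Rightarrow>\<^sub>0 'b::comm_semiring_1"
  assumes g: "g 0 = 0" "\<And>x y. g (x + y) = g x + g y" "\<And>x y. g (x * y) = g x * g y"
    and \<phi>: "\<And>p q. \<phi> (p + q) = \<phi> p * \<phi> q"
  shows "eval_mapping g \<phi> (P * Q) = eval_mapping g \<phi> P * eval_mapping g \<phi> Q"
proof -
  have "P * Q = (\<Sum>p\<in>Poly_Mapping.keys P. Poly_Mapping.single p (Poly_Mapping.lookup P p)) *
                (\<Sum>q\<in>Poly_Mapping.keys Q. Poly_Mapping.single q (Poly_Mapping.lookup Q q))"
    by (simp flip: poly_mapping_eq_sum_single)
  then show ?thesis
    by (simp add: sum_product mult_single eval_mapping_sum g \<phi>)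
       (simp add: eval_mapping_def sum_product mult_ac)
qed

lemma eval_data_monom_add:
  fixes a0 :: "nat \<Rightarrow> complex"
  shows "(\<Prod>i\<in>Poly_Mapping.keys (p + q). a0 i ^ Poly_Mapping.lookup (p + q) i) =
    (\<Prod>i\<in>Poly_Mapping.keys p. a0 i ^ Poly_Mapping.lookup p i) *
    (\<Prod>i\<in>Poly_Mapping.keys q. a0 i ^ Poly_Mapping.lookup q i)"
proof -
  let ?A = "Poly_Mapping.keys p \<union> Poly_Mapping.keys q"
  have *: "(\<Prod>i\<in>Poly_Mapping.keys r. a0 i ^ Poly_Mapping.lookup r i) =
      (\<Prod>i\<in>?A. a0 i ^ Poly_Mapping.lookup r i)" if "Poly_Mapping.keys r \<subseteq> ?A" for r
    by (rule prod.mono_neutral_left) (use that in \<open>auto simp: in_keys_iff\<close>)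
  show ?thesis
    unfolding *[OF keys_add] *[OF Un_upper1] *[OF Un_upper2]
    by (simp add: lookup_add power_add prod.distrib)
qed

lemma eval_data_simps [simp]:
  "eval_data a0 0 = 0"
  "eval_data a0 (P + Q) = eval_data a0 P + eval_data a0 Q"
  "eval_data a0 (P * Q) = eval_data a0 P * eval_data a0 Q"
  "eval_data a0 (data_var k) = a0 k"
  "eval_data a0 (data_const c) = c"
  unfolding eval_data_def data_var_def data_const_def
  by (simp, rule eval_mapping_add, simp, simp, rule eval_mapping_mult)
     (auto simp: eval_data_monom_add)

lemma eval_data_minus [simp]: "eval_data a0 (- P) = - eval_data a0 P"
  using eval_data_simps(2)[of a0 P "- P"] by (simp add: eq_neg_iff_add_eq_0 add.commute)

lemma sol_expansion_keys_step:
  fixes \<nu> \<alpha> k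
  defines "P \<equiv> \<Sum>m\<in>{1..<k}. sol_expansion \<nu> \<alpha> m * sol_expansion \<nu> \<alpha> (k - m)"
  assumes IH: "\<And>m q. m < k \<Longrightarrow> q \<in> Poly_Mapping.keys (sol_expansion \<nu> \<alpha> m) \<Longrightarrow> fst q \<le> m\<^sup>2"
    and p: "p \<in> Poly_Mapping.keys P"
  shows "fst p < k\<^sup>2"
proof -
  obtain m where m: "m \<in> {1..<k}"
    "p \<in> Poly_Mapping.keys (sol_expansion \<nu> \<alpha> m * sol_expansion \<nu> \<alpha> (k - m))"
    using subsetD[OF keys_sum, OF p[unfolded P_def]] by blast
  obtain q r where pqr: "p = q + r" and qr: "q \<in> Poly_Mapping.keys (sol_expansion \<nu> \<alpha> m)"
    "r \<in> Poly_Mapping.keys (sol_expansion \<nu> \<alpha> (k - m))"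
    using subsetD[OF keys_mult m(2)] by blast
  have "fst p \<le> m\<^sup>2 + (k - m)\<^sup>2"
    using IH[OF _ qr(1)] IH[OF _ qr(2)] m(1) unfolding pqr by (simp add: add_mono)
  also have "\<dots> < (m + (k - m))\<^sup>2"
    using m(1) unfolding power2_sum by auto
  finally show ?thesis
    using m(1) by simp
qed

lemma sol_expansion_keys:
  "p \<in> Poly_Mapping.keys (sol_expansion \<nu> \<alpha> k) \<Longrightarrow> fst p \<le> k\<^sup>2"
proof (induction k arbitrary: p rule: less_induct)
  case (less k)
  define P where "P = (\<Sum>m\<in>{1..<k}. sol_expansion \<nu> \<alpha> m * sol_expansion \<nu> \<alpha> (k - m))"
  have "p = (k\<^sup>2, k^3) \<or> p \<in> Poly_Mapping.keys (duhamel \<nu> \<alpha> k P)"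
    using subsetD[OF keys_add, OF less.prems[unfolded sol_expansion.simps[of \<nu> \<alpha> k]]]
    by (auto simp: P_def split: if_splits)
  moreover have "p = (k\<^sup>2, k^3) \<or> p \<in> Poly_Mapping.keys P"
    if p: "p \<in> Poly_Mapping.keys (duhamel \<nu> \<alpha> k P)"
  proof -
    have "\<exists>q\<in>Poly_Mapping.keys P. \<exists>c::data_poly.
        p \<in> Poly_Mapping.keys (Poly_Mapping.single q c - Poly_Mapping.single (k^2, k^3) c)"
      using subsetD[OF keys_sum, OF p[unfolded duhamel_def Let_def]]
      by (elim UN_E) (intro bexI exI)
    then obtain q and c :: data_poly where q: "q \<in> Poly_Mapping.keys P"
      and pqc: "p \<in> Poly_Mapping.keys (Poly_Mapping.single q c - Poly_Mapping.single (k^2, k^3) c)"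
      by blast
    have "p \<in> Poly_Mapping.keys (Poly_Mapping.single q c)
        \<union> Poly_Mapping.keys (Poly_Mapping.single (k^2, k^3) c)"
      using pqc by (rule subsetD[OF keys_diff])
    with q show ?thesis
      by (auto split: if_splits)
  qed
  moreover have "fst p < k\<^sup>2" if "p \<in> Poly_Mapping.keys P"
    using sol_expansion_keys_step[OF less.IH that[unfolded P_def]] .
  ultimately show ?case
    by (auto intro: less_imp_le)
qed

theorem sol_coeff_expansion:
  assumes "\<nu> > 0" "t \<ge> 0"
  shows "sol_coeff \<nu> \<alpha> a0 k t =
    (\<Sum>p\<in>Poly_Mapping.keys (sol_expansion \<nu> \<alpha> k).
       eval_data a0 (Poly_Mapping.lookup (sol_expansion \<nu> \<alpha> k) p) *
       exp (- rate \<nu> \<alpha> p * of_real t))"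
proof -
  define ev where "ev = (\<lambda>t. eval_mapping (eval_data a0) (\<lambda>p. exp (- rate \<nu> \<alpha> p * of_real t)))"
  have rate_add: "rate \<nu> \<alpha> (p + q) = rate \<nu> \<alpha> p + rate \<nu> \<alpha> q" for p q
    by (simp add: rate_def algebra_simps)
  have ev_add: "ev t (P + Q) = ev t P + ev t Q" for t P Q
    unfolding ev_def by (rule eval_mapping_add) auto
  have ev_mult: "ev t (P * Q) = ev t P * ev t Q" for t P Q
    unfolding ev_def by (rule eval_mapping_mult) (auto simp: rate_add algebra_simps simp flip: exp_add)
  have ev_sum: "ev t (\<Sum>i\<in>I. P i) = (\<Sum>i\<in>I. ev t (P i))" for t I and P :: "'b \<Rightarrow> exp_poly"
    unfolding ev_def by (rule eval_mapping_sum) auto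
  have ev_single: "ev t (Poly_Mapping.single p c) = eval_data a0 c * exp (- rate \<nu> \<alpha> p * of_real t)"
    for t p c unfolding ev_def by simp
  have ev_diff: "ev t (P - Q) = ev t P - ev t Q" for t P Q
    using ev_add[of t "P - Q" Q] by simp
  have "sol_coeff \<nu> \<alpha> a0 k t = ev t (sol_expansion \<nu> \<alpha> k)"
    using \<open>t \<ge> 0\<close>
  proof (induction k arbitrary: t rule: less_induct)
    case (less k)
    define P where "P = (\<Sum>m\<in>{1..<k}. sol_expansion \<nu> \<alpha> m * sol_expansion \<nu> \<alpha> (k - m))"
    define L where "L = rate \<nu> \<alpha> (k^2, k^3)"
    define c where "c = (\<lambda>p. eval_data a0 (Poly_Mapping.lookup P p))"
    have ne: "L - rate \<nu> \<alpha> p \<noteq> 0" if "p \<in> Poly_Mapping.keys P" for p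
    proof -
      have "fst p < k\<^sup>2"
        using sol_expansion_keys_step[OF sol_expansion_keys that[unfolded P_def]] .
      then have "\<nu> * real (fst p) < \<nu> * real (k\<^sup>2)"
        using \<open>\<nu> > 0\<close> by (simp only: mult_less_cancel_left_pos of_nat_less_iff)
      then have "Re (L - rate \<nu> \<alpha> p) \<noteq> 0"
        by (auto simp: L_def rate_def simp del: of_nat_power)
      then show ?thesis by auto
    qed
    have 1: "((\<lambda>\<tau>. exp ((L - rate \<nu> \<alpha> p) * of_real \<tau>)) has_integral
        (exp ((L - rate \<nu> \<alpha> p) * of_real t) - 1) / (L - rate \<nu> \<alpha> p)) {0..t}"
      if "p \<in> Poly_Mapping.keys P" for p
    proof -
      let ?d = "L - rate \<nu> \<alpha> p"
      have "((\<lambda>\<tau>. exp (?d * of_real \<tau>)) has_integral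
          exp (?d * of_real t) / ?d - exp (?d * of_real 0) / ?d) {0..t}"
      proof (rule fundamental_theorem_of_calculus[OF \<open>0 \<le> t\<close>])
        fix x :: real
        have "((\<lambda>z. exp (?d * z) / ?d) has_field_derivative exp (?d * of_real x)) (at (of_real x))"
          using ne[OF that] by (auto intro!: derivative_eq_intros)
        then show "((\<lambda>\<tau>. exp (?d * of_real \<tau>) / ?d) has_vector_derivative exp (?d * of_real x))
            (at x within {0..t})"
          by (rule has_vector_derivative_real_field)
      qed
      then show ?thesis by (simp add: diff_divide_distrib)
    qed
    have 2: "((\<lambda>\<tau>. \<Sum>p\<in>Poly_Mapping.keys P. c p * exp ((L - rate \<nu> \<alpha> p) * of_real \<tau>)) has_integral
        (\<Sum>p\<in>Poly_Mapping.keys P. c p * ((exp ((L - rate \<nu> \<alpha> p) * of_real t) - 1) / (L - rate \<nu> \<alpha> p))))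
        {0..t}"
      by (intro has_integral_sum has_integral_mult_right 1) auto
    have "integral {0..t} (\<lambda>\<tau>. exp (L * of_real \<tau>) *
            (\<Sum>m\<in>{1..<k}. sol_coeff \<nu> \<alpha> a0 m \<tau> * sol_coeff \<nu> \<alpha> a0 (k - m) \<tau>)) =
          integral {0..t} (\<lambda>\<tau>. \<Sum>p\<in>Poly_Mapping.keys P. c p * exp ((L - rate \<nu> \<alpha> p) * of_real \<tau>))"
    proof (rule Henstock_Kurzweil_Integration.integral_cong)
      fix \<tau> assume \<tau>: "\<tau> \<in> {0..t}"
      have "(\<Sum>m\<in>{1..<k}. sol_coeff \<nu> \<alpha> a0 m \<tau> * sol_coeff \<nu> \<alpha> a0 (k - m) \<tau>) = ev \<tau> P"
        unfolding P_def ev_sum ev_mult using \<tau> by (intro sum.cong refl) (simp add: less.IH)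
      then show "exp (L * of_real \<tau>) *
            (\<Sum>m\<in>{1..<k}. sol_coeff \<nu> \<alpha> a0 m \<tau> * sol_coeff \<nu> \<alpha> a0 (k - m) \<tau>) =
          (\<Sum>p\<in>Poly_Mapping.keys P. c p * exp ((L - rate \<nu> \<alpha> p) * of_real \<tau>))"
        by (simp add: ev_def eval_mapping_def c_def sum_distrib_left left_diff_distrib exp_diff
            exp_minus field_simps)
    qed
    also have "\<dots> = (\<Sum>p\<in>Poly_Mapping.keys P.
        c p * ((exp ((L - rate \<nu> \<alpha> p) * of_real t) - 1) / (L - rate \<nu> \<alpha> p)))"
      using 2 by (rule integral_unique)
    finally have 3: "sol_coeff \<nu> \<alpha> a0 k t = exp (- L * of_real t) * (a0 k + 3 * \<i> * of_nat k *
        (\<Sum>p\<in>Poly_Mapping.keys P.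
          c p * ((exp ((L - rate \<nu> \<alpha> p) * of_real t) - 1) / (L - rate \<nu> \<alpha> p))))"
      by (subst sol_coeff.simps) (simp add: L_def)
    have 4: "x / d * y * (exp (- r * of_real t) - exp (- L * of_real t)) =
        exp (- L * of_real t) * (x * (y * ((exp ((L - r) * of_real t) - 1) / d)))" for x y d r
    proof -
      have "exp (- r * of_real t) = exp (- L * of_real t) * exp ((L - r) * of_real t)"
        by (simp add: algebra_simps flip: exp_add)
      then show ?thesis
        by (simp only:) (simp add: divide_inverse algebra_simps)
    qed
    have "ev t (sol_expansion \<nu> \<alpha> k) = a0 k * exp (- L * of_real t) +
        (\<Sum>p\<in>Poly_Mapping.keys P. 3 * \<i> * of_nat k / (L - rate \<nu> \<alpha> p) * c p *
          (exp (- rate \<nu> \<alpha> p * of_real t) - exp (- L * of_real t)))"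
      unfolding sol_expansion.simps[of \<nu> \<alpha> k] duhamel_def P_def[symmetric]
      by (simp add: ev_add ev_sum ev_diff ev_single Let_def c_def right_diff_distrib L_def)
    also have "\<dots> = a0 k * exp (- L * of_real t) +
        (\<Sum>p\<in>Poly_Mapping.keys P. exp (- L * of_real t) * (3 * \<i> * of_nat k *
          (c p * ((exp ((L - rate \<nu> \<alpha> p) * of_real t) - 1) / (L - rate \<nu> \<alpha> p)))))"
      by (simp only: 4)
    also have "\<dots> = sol_coeff \<nu> \<alpha> a0 k t"
      unfolding 3 by (simp only: sum_distrib_left distrib_left mult.commute[of "a0 k"])
    finally show ?case by simp
  qed
  then show ?thesis
    by (simp add: ev_def eval_mapping_def)
qed

end

theory Submission
  imports Defs
begin

text \<open>
  The hypothesis bounds all coefficients of \<open>a\<^sub>k\<close> except that of the exponential with index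
  \<open>(k\<^sup>2, k\<^sup>3)\<close>, which the initial value determines. Each of these polynomials has at most as many
  monomials as \<open>k\<close> has partitions, a subexponential number, so \<open>|a\<^sub>k(t)| \<le> M\<^sub>k exp (-\<nu>kt)\<close> with
  \<open>M\<^sub>k\<close> subexponential. This gives smoothness for positive times and the decay of all Sobolev norms,
  but nothing uniform near \<open>t = 0\<close>. There the Duhamel recursion has a triangular majorant with the
  small parameter \<open>sqrt (t/\<nu>)\<close>, which is summable and inherits the Sobolev regularity of the data.
  Uniqueness among all solutions, not only those with positive frequencies, is an \<open>L\<^sup>2\<close> energy
  estimate for the difference of two solutions; the bounds it requires up to \<open>t = 0\<close> come from the
  Sobolev embedding, hence from the uniqueness theorem for Fourier coefficients.
\<close>

section \<open>Bounds for the exponential expansion\<close>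

text \<open>At t = 0 all exponentials equal 1, so the coefficient that the hypothesis leaves out is
  \<open>a0 k\<close> minus the sum of the others. The number p(k) of partitions makes p(k) x^k
  bounded for every x < 1; half of exp (-\<nu>kt) therefore absorbs p(k) and the number of exponents
  once t \<ge> \<eta>, with a constant that depends on \<eta> but not on the data. Taken at \<eta> =
  1 it yields the final constant, which can thus be chosen before the data. Continuity in
  \<open>H^s\<close> at t = 0 asks for one summable majorant for all times. It is glued from that
  bound for t \<ge> T and from the solution of b = a + \<epsilon> b * b on [0, T], where T depends
  on the data; as the recursion is triangular, the comparison is an induction on k and no fixed
  point is sought. The difference w of two solutions satisfies
  \<open>w_t = -\<alpha> w_xxx + \<nu> w_xx + 3 (z w)_x\<close>, with z their sum. Derivatives of
  solutions are not controlled as t tends to 0, so the nonlinear term is integrated by parts: its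
  derivative falls on w, the dissipation absorbs it, and only a sup bound for z remains to be
  found.\<close>

lemma keys_duhamel: "Poly_Mapping.keys (duhamel \<nu> \<alpha> k P) \<subseteq> insert (k\<^sup>2, k^3) (Poly_Mapping.keys P)"
proof
  fix p assume p: "p \<in> Poly_Mapping.keys (duhamel \<nu> \<alpha> k P)"
  have "\<exists>q\<in>Poly_Mapping.keys P. \<exists>c::data_poly.
      p \<in> Poly_Mapping.keys (Poly_Mapping.single q c - Poly_Mapping.single (k^2, k^3) c)"
    using subsetD[OF keys_sum, OF p[unfolded duhamel_def Let_def]]
    by (elim UN_E) (intro bexI exI)
  then obtain q and c :: data_poly where q: "q \<in> Poly_Mapping.keys P"
    and pqc: "p \<in> Poly_Mapping.keys (Poly_Mapping.single q c - Poly_Mapping.single (k^2, k^3) c)"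
    by blast
  have "p \<in> Poly_Mapping.keys (Poly_Mapping.single q c)
      \<union> Poly_Mapping.keys (Poly_Mapping.single (k^2, k^3) c)"
    using pqc by (rule subsetD[OF keys_diff])
  with q show "p \<in> insert (k\<^sup>2, k^3) (Poly_Mapping.keys P)"
    by (auto split: if_splits)
qed

text \<open>Serves as the induction principle for exponents: the only exponent born at level
  \<open>k\<close> is that of the linear flow, and all others are sums of exponents from two lower
  levels.\<close>

lemma keys_sol_expansion_cases:
  assumes "p \<in> Poly_Mapping.keys (sol_expansion \<nu> \<alpha> k)"
  obtains "p = (k\<^sup>2, k^3)"
  | m q r where "1 \<le> m" "m < k" "q \<in> Poly_Mapping.keys (sol_expansion \<nu> \<alpha> m)"
      "r \<in> Poly_Mapping.keys (sol_expansion \<nu> \<alpha> (k - m))" "p = q + r"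
proof -
  let ?P = "\<Sum>m\<in>{1..<k}. sol_expansion \<nu> \<alpha> m * sol_expansion \<nu> \<alpha> (k - m)"
  note prod_case = that(2)
  have "p = (k\<^sup>2, k^3) \<or> p \<in> Poly_Mapping.keys (duhamel \<nu> \<alpha> k ?P)"
    using subsetD[OF keys_add, OF assms[unfolded sol_expansion.simps[of \<nu> \<alpha> k]]]
    by (auto split: if_splits)
  then have "p = (k\<^sup>2, k^3) \<or> p \<in> Poly_Mapping.keys ?P"
    using keys_duhamel by blast
  moreover have thesis if p: "p \<in> Poly_Mapping.keys ?P"
  proof -
    obtain m where m: "m \<in> {1..<k}"
      "p \<in> Poly_Mapping.keys (sol_expansion \<nu> \<alpha> m * sol_expansion \<nu> \<alpha> (k - m))"
      using subsetD[OF keys_sum p] by blast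
    from subsetD[OF keys_mult m(2)] m(1) show thesis
      by (auto intro: prod_case)
  qed
  ultimately show thesis
    using that(1) by blast
qed

lemma sum_powers_less:
  fixes m n :: nat
  assumes "m \<ge> 1" "n \<ge> 1"
  shows "m\<^sup>2 + n\<^sup>2 < (m + n)\<^sup>2" "m^3 + n^3 < (m + n)^3"
proof -
  have "m * n > 0" "m\<^sup>2 * n > 0" using assms by auto
  then show "m\<^sup>2 + n\<^sup>2 < (m + n)\<^sup>2" "m^3 + n^3 < (m + n)^3"
    by (simp_all add: power2_eq_square power3_eq_cube algebra_simps)
qed

text \<open>Squares and cubes are strictly superadditive, so an exponent inherited from two lower
  levels lies strictly below \<open>(k^2, k^3)\<close> in both coordinates. Hence no exponent agrees
  with it in just one coordinate, and every exponent but the top one falls in the index range of the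
  hypothesis.\<close>

lemma keys_sol_expansion_range:
  assumes "k \<ge> 1" "p \<in> Poly_Mapping.keys (sol_expansion \<nu> \<alpha> k)"
  shows "k \<le> fst p \<and> k \<le> snd p \<and> (p = (k\<^sup>2, k^3) \<or> fst p < k\<^sup>2 \<and> snd p < k^3)"
  using assms
proof (induction k arbitrary: p rule: less_induct)
  case (less k)
  from less.prems(2) show ?case
  proof (cases rule: keys_sol_expansion_cases)
    case 1
    then show ?thesis using less.prems(1) by (simp add: self_le_power)
  next
    case (2 m q r)
    have km: "k - m < k" "1 \<le> k - m" using 2(1,2) by auto
    have q: "m \<le> fst q" "m \<le> snd q" "fst q \<le> m\<^sup>2" "snd q \<le> m^3"
      using less.IH[OF 2(2,1,3)] by auto
    have r: "k - m \<le> fst r" "k - m \<le> snd r" "fst r \<le> (k - m)\<^sup>2" "snd r \<le> (k - m)^3"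
      using less.IH[OF km 2(4)] by auto
    have "m\<^sup>2 + (k - m)\<^sup>2 < k\<^sup>2" "m^3 + (k - m)^3 < k^3"
      using sum_powers_less[of m "k - m"] 2(1,2) by auto
    with q r 2 show ?thesis by auto
  qed
qed

section \<open>Weighted homogeneity of the coefficients and partitions\<close>

definition monom_weight :: "(nat \<Rightarrow>\<^sub>0 nat) \<Rightarrow> nat" where
  "monom_weight j = (\<Sum>i\<in>Poly_Mapping.keys j. i * Poly_Mapping.lookup j i)"

text \<open>The partitions of \<open>k\<close>: the exponent of the unknown with index
  \<open>i\<close> is the multiplicity of the part \<open>i\<close>. The index 0 has weight 0;
  excluding it keeps the set finite.\<close>

definition monoms_of_weight :: "nat \<Rightarrow> (nat \<Rightarrow>\<^sub>0 nat) set" where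
  "monoms_of_weight k = {j. 0 \<notin> Poly_Mapping.keys j \<and> monom_weight j = k}"

lemma monom_weight_superset:
  "finite A \<Longrightarrow> Poly_Mapping.keys j \<subseteq> A \<Longrightarrow> monom_weight j = (\<Sum>i\<in>A. i * Poly_Mapping.lookup j i)"
  unfolding monom_weight_def
  by (rule sum.mono_neutral_left) (auto simp: in_keys_iff)

lemma monom_weight_add: "monom_weight (i + j) = monom_weight i + monom_weight j"
proof -
  let ?A = "Poly_Mapping.keys i \<union> Poly_Mapping.keys j"
  show ?thesis
    by (subst (1 2 3) monom_weight_superset[of ?A])
       (use keys_add[of i j] in \<open>auto simp: lookup_add algebra_simps sum.distrib\<close>)
qed

lemma monoms_of_weight_keys:
  assumes "j \<in> monoms_of_weight k"
  shows "Poly_Mapping.keys j \<subseteq> {1..k}"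
proof
  fix i assume i: "i \<in> Poly_Mapping.keys j"
  have "i * Poly_Mapping.lookup j i \<le> k"
    using assms member_le_sum[OF i, of "\<lambda>i. i * Poly_Mapping.lookup j i"]
    by (simp add: monoms_of_weight_def monom_weight_def)
  moreover have "Poly_Mapping.lookup j i > 0" "i \<noteq> 0"
    using i assms by (auto simp: in_keys_iff monoms_of_weight_def intro!: Nat.gr0I)
  moreover have "i * 1 \<le> i * Poly_Mapping.lookup j i"
    using \<open>Poly_Mapping.lookup j i > 0\<close> by (intro mult_le_mono) auto
  ultimately show "i \<in> {1..k}"
    unfolding atLeastAtMost_iff by linarith
qed

lemma monoms_of_weight_lookup_le:
  assumes "j \<in> monoms_of_weight k"
  shows "Poly_Mapping.lookup j i \<le> k"
proof (cases "i \<in> Poly_Mapping.keys j")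
  case True
  have "i * Poly_Mapping.lookup j i \<le> k"
    using assms member_le_sum[OF True, of "\<lambda>i. i * Poly_Mapping.lookup j i"]
    by (simp add: monoms_of_weight_def monom_weight_def)
  moreover have "1 * Poly_Mapping.lookup j i \<le> i * Poly_Mapping.lookup j i"
    using subsetD[OF monoms_of_weight_keys[OF assms] True] by (intro mult_le_mono) auto
  ultimately show ?thesis by linarith
qed (simp add: in_keys_iff)

lemma monoms_of_weight_sum:
  assumes "j \<in> monoms_of_weight k"
  shows "(\<Sum>i=1..k. i * Poly_Mapping.lookup j i) = k"
  using monom_weight_superset[OF _ monoms_of_weight_keys[OF assms]] assms
  by (simp add: monoms_of_weight_def)

text \<open>The grading that gives the unknown with index \<open>i\<close> weight \<open>i\<close>.
  As a condition on the support it holds for the zero polynomial in every weight, so coefficients at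
  absent exponents need no separate treatment.\<close>

definition homogeneous :: "nat \<Rightarrow> data_poly \<Rightarrow> bool" where
  "homogeneous k D \<longleftrightarrow> Poly_Mapping.keys D \<subseteq> monoms_of_weight k"

lemma homogeneous_0 [simp]: "homogeneous k 0"
  by (simp add: homogeneous_def)

lemma homogeneous_add: "homogeneous k D \<Longrightarrow> homogeneous k E \<Longrightarrow> homogeneous k (D + E)"
  unfolding homogeneous_def using keys_add[of D E] by blast

lemma homogeneous_diff: "homogeneous k D \<Longrightarrow> homogeneous k E \<Longrightarrow> homogeneous k (D - E)"
  unfolding homogeneous_def using keys_diff[of D E] by blast

lemma homogeneous_sum: "(\<And>i. i \<in> I \<Longrightarrow> homogeneous k (D i)) \<Longrightarrow> homogeneous k (\<Sum>i\<in>I. D i)"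
  by (induction I rule: infinite_finite_induct) (auto intro: homogeneous_add)

lemma homogeneous_mult:
  assumes "homogeneous m D" "homogeneous n E"
  shows "homogeneous (m + n) (D * E)"
  unfolding homogeneous_def
proof
  fix j assume "j \<in> Poly_Mapping.keys (D * E)"
  then obtain a b where j: "j = a + b" and a: "a \<in> Poly_Mapping.keys D" and b: "b \<in> Poly_Mapping.keys E"
    using subsetD[OF keys_mult] by blast
  have "a \<in> monoms_of_weight m" "b \<in> monoms_of_weight n"
    using assms a b unfolding homogeneous_def by blast+
  then show "j \<in> monoms_of_weight (m + n)"
    using keys_add[of a b] by (auto simp: monoms_of_weight_def monom_weight_add j)
qed

lemma homogeneous_data_const: "homogeneous 0 (data_const c)"
  by (auto simp: homogeneous_def data_const_def monoms_of_weight_def monom_weight_def split: if_splits)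

lemma homogeneous_data_var: "k \<ge> 1 \<Longrightarrow> homogeneous k (data_var k)"
  by (auto simp: homogeneous_def data_var_def monoms_of_weight_def monom_weight_def split: if_splits)

lemma lookup_mult_homogeneous:
  fixes P Q :: exp_poly
  assumes "\<And>p. homogeneous m (Poly_Mapping.lookup P p)" "\<And>p. homogeneous n (Poly_Mapping.lookup Q p)"
  shows "homogeneous (m + n) (Poly_Mapping.lookup (P * Q) p)"
proof -
  have "P * Q = (\<Sum>p\<in>Poly_Mapping.keys P. Poly_Mapping.single p (Poly_Mapping.lookup P p)) *
                (\<Sum>q\<in>Poly_Mapping.keys Q. Poly_Mapping.single q (Poly_Mapping.lookup Q q))"
    by (simp flip: poly_mapping_eq_sum_single)
  also have "\<dots> = (\<Sum>p\<in>Poly_Mapping.keys P. \<Sum>q\<in>Poly_Mapping.keys Q.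
      Poly_Mapping.single (p + q) (Poly_Mapping.lookup P p * Poly_Mapping.lookup Q q))"
    by (simp add: sum_product mult_single)
  finally show ?thesis
    by (simp add: lookup_sum lookup_single when_def)
       (auto intro!: homogeneous_sum homogeneous_mult assms)
qed

lemma lookup_duhamel_homogeneous:
  assumes "\<And>p. homogeneous k (Poly_Mapping.lookup P p)"
  shows "homogeneous k (Poly_Mapping.lookup (duhamel \<nu> \<alpha> n P) p)"
  using homogeneous_mult[OF homogeneous_data_const assms]
  by (auto simp: duhamel_def Let_def lookup_sum lookup_minus lookup_single when_def
      intro!: homogeneous_sum homogeneous_diff)

text \<open>The products in the recursion pair the weights \<open>m\<close> and
  \<open>k - m\<close>, and the Duhamel operator multiplies by constants, of weight 0. The result
  matches the side condition on \<open>j\<close> in the hypothesis and reduces counting monomials to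
  counting partitions.\<close>

lemma lookup_sol_expansion_homogeneous:
  "k \<ge> 1 \<Longrightarrow> homogeneous k (Poly_Mapping.lookup (sol_expansion \<nu> \<alpha> k) p)"
proof (induction k arbitrary: p rule: less_induct)
  case (less k)
  have "homogeneous k (Poly_Mapping.lookup (sol_expansion \<nu> \<alpha> m * sol_expansion \<nu> \<alpha> (k - m)) q)"
    if "m \<in> {1..<k}" for m q
    using lookup_mult_homogeneous[of m "sol_expansion \<nu> \<alpha> m" "k - m" "sol_expansion \<nu> \<alpha> (k - m)" q]
      less.IH[of m] less.IH[of "k - m"] that
    by (simp add: Suc_le_eq)
  then show ?case
    unfolding sol_expansion.simps[of \<nu> \<alpha> k] lookup_add
    using less.prems
    by (intro homogeneous_add lookup_duhamel_homogeneous)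
       (auto simp: lookup_single when_def lookup_sum homogeneous_data_var intro!: homogeneous_sum)
qed

text \<open>Euler's generating function bounds the number of partitions by \<open>x\<^sup>-\<^sup>k \<Prod>\<^sub>i (1 - x\<^sup>i)\<^sup>-\<^sup>1\<close>.\<close>

lemma card_monoms_of_weight:
  fixes x :: real
  assumes x: "0 < x" "x < 1"
  shows "finite (monoms_of_weight k)"
    and "card (monoms_of_weight k) * x ^ k \<le> exp (1 / (1 - x)\<^sup>2)"
proof -
  define \<phi> where "\<phi> j = restrict (Poly_Mapping.lookup j) {1..k}" for j :: "nat \<Rightarrow>\<^sub>0 nat"
  let ?F = "PiE {1..k} (\<lambda>_. {0..k})"
  have sub: "\<phi> ` monoms_of_weight k \<subseteq> ?F"
    by (auto simp: \<phi>_def monoms_of_weight_lookup_le)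
  have fin: "finite ?F"
    by (intro finite_PiE) auto
  have inj: "inj_on \<phi> (monoms_of_weight k)"
  proof (rule inj_onI, rule poly_mapping_eqI)
    fix a b i assume a: "a \<in> monoms_of_weight k" and b: "b \<in> monoms_of_weight k" and eq: "\<phi> a = \<phi> b"
    show "Poly_Mapping.lookup a i = Poly_Mapping.lookup b i"
    proof (cases "i \<in> {1..k}")
      case True
      then show ?thesis using fun_cong[OF eq, of i] by (simp add: \<phi>_def)
    next
      case False
      then have "i \<notin> Poly_Mapping.keys a" "i \<notin> Poly_Mapping.keys b"
        using monoms_of_weight_keys[OF a] monoms_of_weight_keys[OF b] by blast+
      then show ?thesis by (simp add: in_keys_iff)
    qed
  qed
  show "finite (monoms_of_weight k)"
    using finite_imageD[OF finite_subset[OF sub fin] inj] .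
  have "card (monoms_of_weight k) * x ^ k = (\<Sum>j\<in>monoms_of_weight k. x ^ k)"
    by simp
  \<comment> \<open>\<open>x^k\<close> is spread over the parts of the partition, one factor
    \<open>x^i\<close> for each part \<open>i\<close>.\<close>
  also have "\<dots> = (\<Sum>j\<in>monoms_of_weight k. \<Prod>i\<in>{1..k}. (x ^ i) ^ \<phi> j i)"
  proof (rule sum.cong[OF refl])
    fix j assume j: "j \<in> monoms_of_weight k"
    have "(\<Prod>i\<in>{1..k}. (x ^ i) ^ \<phi> j i) = x ^ (\<Sum>i=1..k. i * Poly_Mapping.lookup j i)"
      by (simp add: \<phi>_def power_sum power_mult)
    then show "x ^ k = (\<Prod>i\<in>{1..k}. (x ^ i) ^ \<phi> j i)"
      using monoms_of_weight_sum[OF j] by simp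
  qed
  also have "\<dots> = (\<Sum>f\<in>\<phi> ` monoms_of_weight k. \<Prod>i\<in>{1..k}. (x ^ i) ^ f i)"
    by (simp add: sum.reindex[OF inj])
  \<comment> \<open>Enlarging the range to all functions from \<open>{1..k}\<close> to
    \<open>{0..k}\<close> makes the sum a product of truncated geometric series.\<close>
  also have "\<dots> \<le> (\<Sum>f\<in>?F. \<Prod>i\<in>{1..k}. (x ^ i) ^ f i)"
    using x by (intro sum_mono2[OF fin sub] prod_nonneg) auto
  also have "\<dots> = (\<Prod>i\<in>{1..k}. \<Sum>n\<in>{0..k}. (x ^ i) ^ n)"
    by (subst prod_sum_PiE) auto
  also have "\<dots> \<le> (\<Prod>i\<in>{1..k}. exp (x ^ i / (1 - x)))"
  proof (rule prod_mono, intro conjI sum_nonneg)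
    fix i assume i: "i \<in> {1..k}"
    have y: "0 < x ^ i" "x ^ i \<le> x" "x ^ i < 1"
      using x i power_decreasing[of 1 i x] by (auto simp: power_less_one_iff)
    have "(\<Sum>n\<in>{0..k}. (x ^ i) ^ n) = (1 - (x ^ i) ^ Suc k) / (1 - x ^ i)"
      using y by (subst atLeast0AtMost, subst lessThan_Suc_atMost[symmetric], subst sum_gp_strict) auto
    also have "\<dots> \<le> 1 / (1 - x ^ i)"
      using y by (intro divide_right_mono) auto
    \<comment> \<open>In the form \<open>1 + y\<close> the factor is at most \<open>exp y\<close>,
      which turns the product over \<open>i\<close> into a sum of exponents.\<close>
    also have "\<dots> = 1 + x ^ i / (1 - x ^ i)"
      using y by (simp add: field_simps)
    also have "\<dots> \<le> exp (x ^ i / (1 - x ^ i))"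
      by (rule exp_ge_add_one_self)
    also have "\<dots> \<le> exp (x ^ i / (1 - x))"
      using x y by (subst exp_le_cancel_iff, intro divide_left_mono) auto
    finally show "(\<Sum>n\<in>{0..k}. (x ^ i) ^ n) \<le> exp (x ^ i / (1 - x))" .
  qed (use x in auto)
  also have "\<dots> = exp (\<Sum>i\<in>{1..k}. x ^ i / (1 - x))"
    by (simp add: exp_sum)
  also have "\<dots> \<le> exp (1 / (1 - x)\<^sup>2)"
  proof -
    have "(\<Sum>i\<in>{1..k}. x ^ i) \<le> (\<Sum>i<Suc k. x ^ i)"
      using x by (intro sum_mono2) auto
    also have "\<dots> = (1 - x ^ Suc k) / (1 - x)"
      using x by (subst sum_gp_strict) auto
    also have "\<dots> \<le> 1 / (1 - x)"
      using x by (intro divide_right_mono) auto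
    finally have "(\<Sum>i\<in>{1..k}. x ^ i) / (1 - x) \<le> 1 / (1 - x) / (1 - x)"
      using x by (intro divide_right_mono) auto
    then show ?thesis
      by (simp add: sum_divide_distrib power2_eq_square)
  qed
  finally show "card (monoms_of_weight k) * x ^ k \<le> exp (1 / (1 - x)\<^sup>2)" .
qed

section \<open>From coefficient bounds to bounds for the Fourier modes\<close>

lemma norm_eval_data_le:
  assumes D: "homogeneous k D" and a0: "\<And>i. i \<ge> 1 \<Longrightarrow> cmod (a0 i) \<le> 1"
    and B: "\<And>j. j \<in> monoms_of_weight k \<Longrightarrow> cmod (Poly_Mapping.lookup D j) \<le> B"
  shows "cmod (eval_data a0 D) \<le> B * card (monoms_of_weight k)"
proof -
  have fin: "finite (monoms_of_weight k)"
    using card_monoms_of_weight(1)[of "1/2"] by simp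
  have "eval_data a0 D = (\<Sum>j\<in>monoms_of_weight k. Poly_Mapping.lookup D j *
      (\<Prod>i\<in>Poly_Mapping.keys j. a0 i ^ Poly_Mapping.lookup j i))"
    unfolding eval_data_def
    by (subst eval_mapping_superset[OF fin]) (use D in \<open>auto simp: homogeneous_def\<close>)
  also have "cmod \<dots> \<le> (\<Sum>j\<in>monoms_of_weight k. B)"
  proof (rule sum_norm_le)
    fix j assume j: "j \<in> monoms_of_weight k"
    have "cmod (\<Prod>i\<in>Poly_Mapping.keys j. a0 i ^ Poly_Mapping.lookup j i) \<le> 1"
      unfolding prod_norm[symmetric] norm_power
      using monoms_of_weight_keys[OF j] a0 by (intro prod_le_1) (auto intro!: power_le_one)
    then show "cmod (Poly_Mapping.lookup D j * (\<Prod>i\<in>Poly_Mapping.keys j. a0 i ^ Poly_Mapping.lookup j i)) \<le> B"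
      using mult_mono[OF B[OF j]] norm_ge_zero B[OF j] order_trans[OF norm_ge_zero B[OF j]]
      by (fastforce simp: norm_mult)
  qed
  finally show ?thesis by (simp add: mult.commute)
qed

lemma norm_exp_rate:
  assumes "\<nu> > 0" "t \<ge> 0"
  shows "cmod (exp (- rate \<nu> \<alpha> p * of_real t)) = exp (- (\<nu> * fst p * t))"
  by (simp add: norm_exp_eq_Re rate_def)

text \<open>With \<open>B = C0 * p(k)\<close> bounding one coefficient and \<open>N\<close> the
  number of index pairs in the box, this is \<open>1 + 2BN\<close>: \<open>BN\<close> for the
  coefficients under the hypothesis and \<open>1 + BN\<close> for the remaining one.\<close>

definition coeff_majorant :: "real \<Rightarrow> nat \<Rightarrow> real" where
  "coeff_majorant C0 k = 1 + 2 * (C0 * card (monoms_of_weight k)) * (real (Suc (k\<^sup>2)) * real (Suc (k^3)))"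

lemma norm_sol_coeff_le:
  assumes "\<nu> > 0" "k \<ge> 1" "t \<ge> 0" "C0 \<ge> 0"
    and C: "\<And>h l j. k \<le> h \<Longrightarrow> h < k\<^sup>2 \<Longrightarrow> k \<le> l \<Longrightarrow> l < k^3 \<Longrightarrow> Poly_Mapping.keys j \<subseteq> {1..k} \<Longrightarrow>
       (\<Sum>i=1..k. i * Poly_Mapping.lookup j i) = k \<Longrightarrow> cmod (C_coeff \<alpha> \<nu> k h l j) \<le> C0"
    and a0: "\<And>i. i \<ge> 1 \<Longrightarrow> cmod (a0 i) \<le> 1"
  shows "cmod (sol_coeff \<nu> \<alpha> a0 k t) \<le> coeff_majorant C0 k * exp (- (\<nu> * k * t))"
proof -
  define S where "S = sol_expansion \<nu> \<alpha> k"
  \<comment> \<open>The top index is inserted even if its coefficient is the zero polynomial, so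
    that it can be split off from every sum.\<close>
  define K where "K = insert (k\<^sup>2, k^3) (Poly_Mapping.keys S)"
  define c where "c p = eval_data a0 (Poly_Mapping.lookup S p)" for p
  define B where "B = C0 * card (monoms_of_weight k)"
  define N where "N = real (Suc (k\<^sup>2)) * real (Suc (k^3))"
  have finK: "finite K" by (simp add: K_def)
  have "B \<ge> 0" using \<open>C0 \<ge> 0\<close> by (simp add: B_def)
  have cB: "cmod (c p) \<le> B" if "p \<in> K - {(k\<^sup>2, k^3)}" for p
    unfolding c_def B_def S_def
  proof (rule norm_eval_data_le[OF lookup_sol_expansion_homogeneous[OF \<open>k \<ge> 1\<close>] a0])
    fix j assume j: "j \<in> monoms_of_weight k"
    have "k \<le> fst p" "k \<le> snd p" "fst p < k\<^sup>2" "snd p < k^3"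
      using keys_sol_expansion_range[OF \<open>k \<ge> 1\<close>, of p \<nu> \<alpha>] that by (auto simp: K_def S_def)
    then show "cmod (Poly_Mapping.lookup (Poly_Mapping.lookup (sol_expansion \<nu> \<alpha> k) p) j) \<le> C0"
      using C[of "fst p" "snd p" j] monoms_of_weight_keys[OF j] monoms_of_weight_sum[OF j]
      by (simp add: C_coeff_def)
  qed
  have K_sub: "K \<subseteq> {..k\<^sup>2} \<times> {..k^3}"
    using keys_sol_expansion_range[OF \<open>k \<ge> 1\<close>, of _ \<nu> \<alpha>] by (fastforce simp: K_def S_def)
  have "card (K - {(k\<^sup>2, k^3)}) \<le> card ({..k\<^sup>2} \<times> {..k^3})"
    using K_sub by (intro card_mono) auto
  also have "\<dots> = Suc (k\<^sup>2) * Suc (k^3)"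
    unfolding card_cartesian_product by simp
  finally have cardN: "real (card (K - {(k\<^sup>2, k^3)})) \<le> N"
    unfolding N_def of_nat_mult[symmetric] of_nat_le_iff .
  have rest: "(\<Sum>p\<in>K - {(k\<^sup>2, k^3)}. cmod (c p)) \<le> B * N"
  proof -
    have "(\<Sum>p\<in>K - {(k\<^sup>2, k^3)}. cmod (c p)) \<le> of_nat (card (K - {(k\<^sup>2, k^3)})) * B"
      by (rule sum_bounded_above[OF cB])
    also have "\<dots> \<le> N * B"
      using cardN \<open>B \<ge> 0\<close> by (intro mult_right_mono)
    finally show ?thesis by (simp add: mult.commute)
  qed
  have expand: "sol_coeff \<nu> \<alpha> a0 k t = (\<Sum>p\<in>K. c p * exp (- rate \<nu> \<alpha> p * of_real t))" if "t \<ge> 0" for t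
    unfolding sol_coeff_expansion[OF \<open>\<nu> > 0\<close> that] c_def S_def
    by (rule sum.mono_neutral_left) (use finK in \<open>auto simp: K_def S_def in_keys_iff\<close>)
  \<comment> \<open>At time 0 the Duhamel integral vanishes and all exponentials are 1; this
    expresses the coefficient at the top index by those already bounded.\<close>
  have "a0 k = sol_coeff \<nu> \<alpha> a0 k 0"
    by (subst sol_coeff.simps) simp
  also have "\<dots> = c (k\<^sup>2, k^3) + (\<Sum>p\<in>K - {(k\<^sup>2, k^3)}. c p)"
    by (subst expand, simp, subst sum.remove[OF finK, of "(k\<^sup>2, k^3)"]) (auto simp: K_def)
  finally have "c (k\<^sup>2, k^3) = a0 k - (\<Sum>p\<in>K - {(k\<^sup>2, k^3)}. c p)"
    by simp
  then have "cmod (c (k\<^sup>2, k^3)) \<le> cmod (a0 k) + cmod (\<Sum>p\<in>K - {(k\<^sup>2, k^3)}. c p)"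
    by (metis norm_triangle_ineq4)
  also have "\<dots> \<le> 1 + B * N"
    using a0[OF \<open>k \<ge> 1\<close>] rest norm_sum[of c "K - {(k\<^sup>2, k^3)}"] by linarith
  finally have top: "cmod (c (k\<^sup>2, k^3)) \<le> 1 + B * N" .
  have "cmod (sol_coeff \<nu> \<alpha> a0 k t) \<le> (\<Sum>p\<in>K. cmod (c p) * exp (- (\<nu> * k * t)))"
    unfolding expand[OF \<open>t \<ge> 0\<close>]
  proof (rule sum_norm_le)
    fix p assume p: "p \<in> K"
    \<comment> \<open>Every exponent is at least \<open>k\<close>, so each exponential decays at
      least like \<open>exp (- \<nu> k t)\<close>; it is this factor \<open>k\<close> that beats the
      partition numbers.\<close>
    have "k \<le> fst p"
      using p keys_sol_expansion_range[OF \<open>k \<ge> 1\<close>, of p \<nu> \<alpha>] \<open>k \<ge> 1\<close>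
      by (auto simp: K_def S_def self_le_power)
    then have "\<nu> * k * t \<le> \<nu> * fst p * t"
      using assms by (intro mult_right_mono mult_left_mono) auto
    then show "cmod (c p * exp (- rate \<nu> \<alpha> p * of_real t)) \<le> cmod (c p) * exp (- (\<nu> * k * t))"
      unfolding norm_mult norm_exp_rate[OF \<open>\<nu> > 0\<close> \<open>t \<ge> 0\<close>] by (intro mult_left_mono) auto
  qed
  also have "\<dots> = (cmod (c (k\<^sup>2, k^3)) + (\<Sum>p\<in>K - {(k\<^sup>2, k^3)}. cmod (c p))) * exp (- (\<nu> * k * t))"
    unfolding sum_distrib_right[symmetric]
    by (subst sum.remove[OF finK, of "(k\<^sup>2, k^3)"]) (auto simp: K_def)
  also have "\<dots> \<le> (1 + B * N + B * N) * exp (- (\<nu> * k * t))"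
    using top rest by (intro mult_right_mono add_mono) auto
  finally show ?thesis
    by (simp add: coeff_majorant_def B_def N_def algebra_simps)
qed

section \<open>Polynomial and subexponential factors against geometric decay\<close>

lemma power_times_geometric_bounded:
  fixes x :: real
  assumes x: "0 < x" "x < 1"
  obtains K where "K > 0" "\<And>n. real (Suc n) ^ j * x ^ n \<le> K"
proof -
  have "\<exists>K>0. \<forall>n. real n ^ j * x ^ n \<le> K"
  proof (cases "j = 0")
    case True
    then show ?thesis using x by (intro exI[of _ 1]) (auto intro: power_le_one)
  next
    case False
    \<comment> \<open>With this \<open>y\<close> the expression is \<open>(n y^n)^j\<close>, which
      reduces the claim to the limit of \<open>n y^n\<close>.\<close>
    define y where "y = root j x"
    have y: "0 < y" "y < 1" "y ^ j = x"
      using x False by (auto simp: y_def)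
    have "(\<lambda>n. real n * y ^ n) \<longlonglongrightarrow> 0"
      using y by (intro powser_times_n_limit_0) auto
    then have "Bseq (\<lambda>n. real n * y ^ n)"
      by (intro convergent_imp_Bseq convergentI)
    then obtain L where L: "L > 0" "\<And>n. norm (real n * y ^ n) \<le> L"
      by (auto elim: BseqE)
    have "real n ^ j * x ^ n \<le> L ^ j" for n
    proof -
      have "real n ^ j * x ^ n = (real n * y ^ n) ^ j"
        by (simp add: power_mult_distrib y(3)[symmetric] mult.commute flip: power_mult)
      also have "\<dots> \<le> L ^ j"
        using L(2)[of n] y by (intro power_mono) auto
      finally show ?thesis .
    qed
    then show ?thesis using L(1) by (intro exI[of _ "L ^ j"]) auto
  qed
  then obtain K where K: "K > 0" "\<And>n. real n ^ j * x ^ n \<le> K" by blast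
  show thesis
  proof (rule that[of "K / x"])
    show "real (Suc n) ^ j * x ^ n \<le> K / x" for n
      using K(2)[of "Suc n"] x by (simp add: field_simps)
  qed (use K x in auto)
qed

text \<open>\<open>x^n\<close> is split into two powers of \<open>sqrt x\<close>: one keeps the
  polynomial factor bounded, the other is summed.\<close>

lemma summable_power_times_geometric:
  fixes x :: real
  assumes x: "0 < x" "x < 1"
  shows "summable (\<lambda>n. real (Suc n) ^ j * x ^ n)"
proof -
  define y where "y = sqrt x"
  have y: "0 < y" "y < 1" "y * y = x" using x by (auto simp: y_def)
  obtain K where K: "\<And>n. real (Suc n) ^ j * y ^ n \<le> K"
    using power_times_geometric_bounded[OF y(1,2)] by metis
  show ?thesis
  proof (rule summable_comparison_test')
    show "summable (\<lambda>n. K * y ^ n)"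
      using y by (intro summable_mult summable_geometric) auto
    show "norm (real (Suc n) ^ j * x ^ n) \<le> K * y ^ n" if "n \<ge> 0" for n
    proof -
      have "real (Suc n) ^ j * x ^ n = (real (Suc n) ^ j * y ^ n) * y ^ n"
        by (simp add: y(3)[symmetric] power_mult_distrib)
      also have "\<dots> \<le> K * y ^ n"
        using K[of n] y by (intro mult_right_mono) auto
      finally show ?thesis using x by simp
    qed
  qed
qed

lemma sobolev_weight_le_power:
  assumes "s \<le> real j"
  shows "(1 + (real n)\<^sup>2) powr s \<le> real (Suc n) ^ (2 * j)"
proof -
  have "(1 + (real n)\<^sup>2) powr s \<le> (1 + (real n)\<^sup>2) powr (real j)"
    using assms by (intro powr_mono) auto
  also have "\<dots> = (1 + (real n)\<^sup>2) ^ j"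
    by (rule powr_realpow) (simp add: add_pos_nonneg)
  also have "\<dots> \<le> ((real (Suc n))\<^sup>2) ^ j"
    by (intro power_mono) (auto simp: power2_eq_square algebra_simps)
  finally show ?thesis by (simp add: power_mult)
qed

lemma summable_sobolev_weight_geometric:
  fixes x :: real
  assumes "0 < x" "x < 1"
  shows "summable (\<lambda>n. (1 + (real n)\<^sup>2) powr s * x ^ n)"
proof -
  obtain j :: nat where j: "s \<le> real j" using real_arch_simple by blast
  show ?thesis
  proof (rule summable_comparison_test')
    show "summable (\<lambda>n. real (Suc n) ^ (2 * j) * x ^ n)"
      using assms by (rule summable_power_times_geometric)
    show "norm ((1 + (real n)\<^sup>2) powr s * x ^ n) \<le> real (Suc n) ^ (2 * j) * x ^ n" if "n \<ge> 0" for n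
      using sobolev_weight_le_power[OF j, of n] assms by (auto intro!: mult_right_mono)
  qed
qed

text \<open>The subexponential growth in precise form: one factor \<open>(sqrt x)^k\<close> is spent
  on the partition number, the other on the number of index pairs, which is polynomial of degree
  5.\<close>

lemma coeff_majorant_times_geometric_bounded:
  assumes x: "0 < x" "x < 1" and "C0 \<ge> 0"
  obtains K where "K > 0" "\<And>k. coeff_majorant C0 k * x ^ k \<le> K"
proof -
  define y where "y = sqrt x"
  have y: "0 < y" "y < 1" "y * y = x" using x by (auto simp: y_def)
  obtain K where K: "K > 0" "\<And>n. real (Suc n) ^ 5 * y ^ n \<le> K"
    using power_times_geometric_bounded[OF y(1,2)] by metis
  define E where "E = exp (1 / (1 - y)\<^sup>2)"
  show thesis
  proof (rule that)
    show "1 + 2 * C0 * E * K > 0"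
      using K assms by (intro add_pos_nonneg) (auto simp: E_def)
    fix k
    have "real (Suc (k\<^sup>2)) * real (Suc (k^3)) \<le> real (Suc k) ^ 2 * real (Suc k) ^ 3"
      by (intro mult_mono) (auto simp: power2_eq_square power3_eq_cube algebra_simps)
    then have N: "real (Suc (k\<^sup>2)) * real (Suc (k^3)) \<le> real (Suc k) ^ 5"
      by (simp flip: power_add)
    have "coeff_majorant C0 k * x ^ k = x ^ k + 2 * C0 * (card (monoms_of_weight k) * y ^ k) *
        (real (Suc (k\<^sup>2)) * real (Suc (k^3)) * y ^ k)"
      unfolding coeff_majorant_def y(3)[symmetric] power_mult_distrib
      by (simp only: algebra_simps)
    also have "\<dots> \<le> 1 + 2 * C0 * E * K"
    proof (intro add_mono mult_mono)
      show "x ^ k \<le> 1" using x by (intro power_le_one) auto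
      show "card (monoms_of_weight k) * y ^ k \<le> E"
        unfolding E_def by (rule card_monoms_of_weight[OF y(1,2)])
      have "real (Suc (k\<^sup>2)) * real (Suc (k^3)) * y ^ k \<le> real (Suc k) ^ 5 * y ^ k"
        using N y by (intro mult_right_mono) auto
      then show "real (Suc (k\<^sup>2)) * real (Suc (k^3)) * y ^ k \<le> K"
        using K(2)[of k] by linarith
    qed (use assms y E_def in auto)
    finally show "coeff_majorant C0 k * x ^ k \<le> 1 + 2 * C0 * E * K" .
  qed
qed

text \<open>The value of \<^const>\<open>sol_coeff\<close> at \<open>k = 0\<close> is junk; it is replaced by \<open>0\<close> so that series run over \<open>nat\<close>.\<close>

definition mode :: "real \<Rightarrow> real \<Rightarrow> (nat \<Rightarrow> complex) \<Rightarrow> nat \<Rightarrow> real \<Rightarrow> complex" where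
  "mode \<nu> \<alpha> a0 k t = (if k = 0 then 0 else sol_coeff \<nu> \<alpha> a0 k t)"

text \<open>\<open>K\<close> is chosen before \<open>a0\<close>, so it depends on
  \<open>\<nu>\<close>, \<open>\<alpha>\<close> and \<open>\<eta>\<close> only. Half of the exponent
  is spent, at time \<open>\<eta>\<close>, on the subexponential majorant; the other half is kept as
  decay.\<close>

lemma mode_decay:
  assumes "\<nu> > 0"
    and hyp: "\<exists>C0::real. \<forall>(k::nat) (h::nat) (l::nat) (j :: nat \<Rightarrow>\<^sub>0 nat).
           k \<ge> 1 \<and> k \<le> h \<and> h < k^2 \<and> k \<le> l \<and> l < k^3 \<and>
           Poly_Mapping.keys j \<subseteq> {1..k} \<and> (\<Sum>i=1..k. i * Poly_Mapping.lookup j i) = k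
           \<longrightarrow> cmod (C_coeff \<alpha> \<nu> k h l j) \<le> C0"
    and "\<eta> > 0"
  shows "\<exists>K>0. \<forall>a0 k t. (\<forall>i\<ge>1. cmod (a0 i) \<le> 1) \<longrightarrow> t \<ge> \<eta> \<longrightarrow>
    cmod (mode \<nu> \<alpha> a0 k t) \<le> K * exp (- (\<nu> * k * t / 2))"
proof -
  obtain C1 where C1: "\<And>k h l j. k \<ge> 1 \<and> k \<le> h \<and> h < k^2 \<and> k \<le> l \<and> l < k^3 \<and>
           Poly_Mapping.keys j \<subseteq> {1..k} \<and> (\<Sum>i=1..k. i * Poly_Mapping.lookup j i) = k
           \<Longrightarrow> cmod (C_coeff \<alpha> \<nu> k h l j) \<le> C1"
    using hyp by blast
  define C0 where "C0 = \<bar>C1\<bar>"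
  have "C0 \<ge> 0" by (simp add: C0_def)
  define x where "x = exp (- (\<nu> * \<eta> / 2))"
  have "0 < x" "x < 1" using assms by (auto simp: x_def)
  from coeff_majorant_times_geometric_bounded[OF this \<open>C0 \<ge> 0\<close>]
  obtain K where K: "K > 0" "\<And>k. coeff_majorant C0 k * x ^ k \<le> K" by metis
  have "cmod (mode \<nu> \<alpha> a0 k t) \<le> K * exp (- (\<nu> * k * t / 2))"
    if a0: "\<forall>i\<ge>1. cmod (a0 i) \<le> 1" and t: "t \<ge> \<eta>" for a0 k t
  proof (cases "k = 0")
    case True
    then show ?thesis using K by (simp add: mode_def)
  next
    case False
    have "cmod (sol_coeff \<nu> \<alpha> a0 k t) \<le> coeff_majorant C0 k * exp (- (\<nu> * k * t))"
    proof (rule norm_sol_coeff_le)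
      fix h l and j :: "nat \<Rightarrow>\<^sub>0 nat"
      assume "k \<le> h" "h < k\<^sup>2" "k \<le> l" "l < k ^ 3" "Poly_Mapping.keys j \<subseteq> {1..k}"
        "(\<Sum>i = 1..k. i * Poly_Mapping.lookup j i) = k"
      then show "cmod (C_coeff \<alpha> \<nu> k h l j) \<le> C0"
        using C1[of k h l j] False by (auto simp: C0_def)
    qed (use assms a0 t False \<open>C0 \<ge> 0\<close> in auto)
    also have "\<dots> = coeff_majorant C0 k * exp (- (\<nu> * k * t / 2)) * exp (- (\<nu> * k * t / 2))"
      by (simp flip: exp_add add: mult.assoc)
    also have "\<dots> \<le> coeff_majorant C0 k * x ^ k * exp (- (\<nu> * k * t / 2))"
    proof (intro mult_right_mono mult_left_mono)
      have "x ^ k = exp (- (\<nu> * k * \<eta> / 2))"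
        by (simp add: x_def flip: exp_of_nat_mult)
      then show "exp (- (\<nu> * k * t / 2)) \<le> x ^ k"
        using t \<open>\<nu> > 0\<close> by (simp add: mult_left_mono)
    qed (use \<open>C0 \<ge> 0\<close> in \<open>auto simp: coeff_majorant_def intro!: add_nonneg_nonneg mult_nonneg_nonneg\<close>)
    also have "\<dots> \<le> K * exp (- (\<nu> * k * t / 2))"
      using K(2)[of k] by (intro mult_right_mono) auto
    finally show ?thesis using False by (simp add: mode_def)
  qed
  then show ?thesis using K(1) by blast
qed

lemma mode_continuous:
  assumes "\<nu> > 0"
  shows "continuous_on {0..} (mode \<nu> \<alpha> a0 k)"
proof (cases "k = 0")
  case False
  have "continuous_on {0..} (\<lambda>t. \<Sum>p\<in>Poly_Mapping.keys (sol_expansion \<nu> \<alpha> k).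
       eval_data a0 (Poly_Mapping.lookup (sol_expansion \<nu> \<alpha> k) p) * exp (- rate \<nu> \<alpha> p * of_real t))"
    by (intro continuous_intros)
  then show ?thesis
    by (rule continuous_on_eq) (use sol_coeff_expansion[OF assms] False in \<open>simp add: mode_def\<close>)
qed (auto simp: mode_def)

lemma mode_0: "k \<ge> 1 \<Longrightarrow> mode \<nu> \<alpha> a0 k 0 = a0 k"
  unfolding mode_def by (subst sol_coeff.simps) simp

lemma mode_duhamel:
  assumes "k \<ge> 1"
  shows "mode \<nu> \<alpha> a0 k t = exp (- rate \<nu> \<alpha> (k^2, k^3) * of_real t) *
       (a0 k + 3 * \<i> * of_nat k * integral {0..t} (\<lambda>\<tau>. exp (rate \<nu> \<alpha> (k^2, k^3) * of_real \<tau>) *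
            (\<Sum>m\<in>{1..<k}. mode \<nu> \<alpha> a0 m \<tau> * mode \<nu> \<alpha> a0 (k - m) \<tau>)))"
proof -
  have "(\<Sum>m\<in>{1..<k}. mode \<nu> \<alpha> a0 m \<tau> * mode \<nu> \<alpha> a0 (k - m) \<tau>) =
     (\<Sum>m\<in>{1..<k}. sol_coeff \<nu> \<alpha> a0 m \<tau> * sol_coeff \<nu> \<alpha> a0 (k - m) \<tau>)" for \<tau>
    by (intro sum.cong) (auto simp: mode_def)
  then show ?thesis
    using assms by (simp add: mode_def sol_coeff.simps[of \<nu> \<alpha> a0 k t])
qed

section \<open>A majorant near the initial time\<close>

text \<open>In terms of generating functions this is the quadratic equation
  \<open>b = a + \<epsilon> b^2\<close>, solved coefficient by coefficient. The bounds below concern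
  indices from 1 on; at 0 the value is just \<open>a 0\<close>.\<close>

function conv_majorant :: "real \<Rightarrow> (nat \<Rightarrow> real) \<Rightarrow> nat \<Rightarrow> real" where
  "conv_majorant \<epsilon> a k = a k + \<epsilon> * (\<Sum>m\<in>{1..<k}. conv_majorant \<epsilon> a m * conv_majorant \<epsilon> a (k - m))"
  by pat_completeness auto
termination
  by (relation "Wellfounded.measure (\<lambda>(\<epsilon>, a, k). k)") auto

declare conv_majorant.simps [simp del]

lemma conv_majorant_nonneg:
  assumes "\<epsilon> \<ge> 0" "\<And>k. a k \<ge> 0"
  shows "conv_majorant \<epsilon> a k \<ge> 0"
proof (induction k rule: less_induct)
  case (less k)
  then show ?case
    using assms by (subst conv_majorant.simps) (auto intro!: add_nonneg_nonneg mult_nonneg_nonneg sum_nonneg)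
qed

text \<open>Pairs with sum at most \<open>K\<close> and both entries at least 1 have entries at most
  \<open>K - 1\<close>. This gain of one index is what lets a bound for partial sums up to
  \<open>K\<close> pass to \<open>K + 1\<close>.\<close>

lemma sum_convolution_le:
  fixes F :: "nat \<Rightarrow> nat \<Rightarrow> real"
  assumes "\<And>m n. F m n \<ge> 0"
  shows "(\<Sum>k=1..K. \<Sum>m\<in>{1..<k}. F m (k - m)) \<le> (\<Sum>m=1..K-1. \<Sum>n=1..K-1. F m n)"
proof -
  let ?S = "SIGMA k:{1..K}. {1..<k}"
  let ?f = "\<lambda>(k, m). (m, k - m)"
  have inj: "inj_on ?f ?S" by (auto simp: inj_on_def)
  have "(\<Sum>k=1..K. \<Sum>m\<in>{1..<k}. F m (k - m)) = (\<Sum>p\<in>?S. case ?f p of (m, n) \<Rightarrow> F m n)"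
    by (subst sum.Sigma) (auto intro!: sum.cong)
  also have "\<dots> = (\<Sum>p\<in>?f ` ?S. case p of (m, n) \<Rightarrow> F m n)"
    by (simp only: sum.reindex[OF inj] o_def)
  also have "\<dots> \<le> (\<Sum>p\<in>{1..K-1} \<times> {1..K-1}. case p of (m, n) \<Rightarrow> F m n)"
    using assms by (intro sum_mono2) auto
  also have "\<dots> = (\<Sum>m=1..K-1. \<Sum>n=1..K-1. F m n)"
    by (subst sum.cartesian_product) auto
  finally show ?thesis .
qed

text \<open>If the partial sum up to \<open>K\<close> is at most \<open>2A\<close>, the next one is
  at most \<open>A + \<epsilon> (2A)^2\<close>, and \<open>4 \<epsilon> A \<le> 1\<close> brings
  this back to \<open>2A\<close>. The condition is the discriminant condition of the scalar equation
  \<open>x = A + \<epsilon> x^2\<close>.\<close>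

lemma conv_majorant_sum_le:
  assumes \<epsilon>: "\<epsilon> \<ge> 0" "4 * \<epsilon> * A \<le> 1" and a: "\<And>k. a k \<ge> 0" and A: "\<And>K. (\<Sum>k=1..K. a k) \<le> A"
  shows "(\<Sum>k=1..K. conv_majorant \<epsilon> a k) \<le> 2 * A"
proof (induction K)
  case 0
  then show ?case using A[of 0] by simp
next
  case (Suc K)
  let ?b = "conv_majorant \<epsilon> a"
  have "A \<ge> 0" using A[of 0] by simp
  have b: "?b k \<ge> 0" for k using conv_majorant_nonneg[OF \<epsilon>(1) a] .
  have "(\<Sum>k=1..Suc K. ?b k) =
      (\<Sum>k=1..Suc K. a k) + \<epsilon> * (\<Sum>k=1..Suc K. \<Sum>m\<in>{1..<k}. ?b m * ?b (k - m))"
    by (subst conv_majorant.simps) (simp only: sum.distrib sum_distrib_left)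
  also have "\<dots> \<le> A + \<epsilon> * (\<Sum>m=1..K. \<Sum>n=1..K. ?b m * ?b n)"
    using sum_convolution_le[of "\<lambda>m n. ?b m * ?b n" "Suc K"] b
    by (intro add_mono A mult_left_mono \<epsilon>) auto
  also have "(\<Sum>m=1..K. \<Sum>n=1..K. ?b m * ?b n) = (\<Sum>k=1..K. ?b k) * (\<Sum>k=1..K. ?b k)"
    by (simp add: sum_product)
  also have "A + \<epsilon> * \<dots> \<le> A + \<epsilon> * ((2 * A) * (2 * A))"
    using Suc b \<open>A \<ge> 0\<close> \<epsilon> by (intro add_left_mono mult_left_mono mult_mono) (auto intro: sum_nonneg)
  also have "\<dots> \<le> 2 * A"
    using mult_right_mono[OF \<epsilon>(2) \<open>A \<ge> 0\<close>] by (simp add: algebra_simps)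
  finally show ?case .
qed

text \<open>The larger of the two indices is at least half of the sum, so the weight of the sum is
  at most a multiple of the larger weight; \<open>4 powr (s/2)\<close> produces the
  constant.\<close>

lemma sobolev_weight_add_le:
  assumes "s \<ge> 0"
  shows "(1 + (real (m + n))\<^sup>2) powr (s / 2) \<le>
     2 powr s * ((1 + (real m)\<^sup>2) powr (s / 2) + (1 + (real n)\<^sup>2) powr (s / 2))"
proof -
  have *: "(1 + (real (m + n))\<^sup>2) powr (s / 2) \<le> 2 powr s * (1 + (real n)\<^sup>2) powr (s / 2)" if "m \<le> n" for m n
  proof -
    have "real (m + n) \<le> 2 * real n" using that by simp
    then have "(real (m + n))\<^sup>2 \<le> (2 * real n)\<^sup>2" by (intro power_mono) auto
    then have "1 + (real (m + n))\<^sup>2 \<le> 4 * (1 + (real n)\<^sup>2)" by (simp add: power_mult_distrib)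
    then have "(1 + (real (m + n))\<^sup>2) powr (s / 2) \<le> (4 * (1 + (real n)\<^sup>2)) powr (s / 2)"
      using assms by (intro powr_mono2) auto
    also have "\<dots> = 4 powr (s / 2) * (1 + (real n)\<^sup>2) powr (s / 2)"
      by (rule powr_mult)
    also have "4 powr (s / 2) = (2 powr 2) powr (s / 2)" by simp
    also have "\<dots> = 2 powr s" by (subst powr_powr) simp
    finally show ?thesis .
  qed
  have p: "2 powr s * (1 + (real n)\<^sup>2) powr (s / 2) \<ge> 0" for n by simp
  show ?thesis
  proof (cases "m \<le> n")
    case True
    then show ?thesis unfolding distrib_left using *[OF True] p[of m] by linarith
  next
    case False
    then show ?thesis
      unfolding distrib_left using *[of n m, unfolded add.commute[of n m]] p[of n] by linarith
  qed
qed

text \<open>The weight is moved onto one factor of the convolution, and Young's inequality for a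
  convolution of \<open>l^2\<close> with \<open>l^1\<close> uses the \<open>l^1\<close> bound
  \<open>2A\<close> of the majorant. The smallness condition makes the nonlinear contribution at
  most half of the left side, and partial sums are finite, so it can be absorbed.\<close>

lemma conv_majorant_sobolev_le:
  fixes s :: real
  defines "w \<equiv> \<lambda>k. (1 + (real k)\<^sup>2) powr (s / 2)"
  assumes "s \<ge> 0"
    and \<epsilon>: "\<epsilon> \<ge> 0" "8 * \<epsilon> * 2 powr s * A \<le> 1" and a: "\<And>k. a k \<ge> 0" and A: "\<And>K. (\<Sum>k=1..K. a k) \<le> A"
    and Q: "\<And>K. (\<Sum>k=1..K. (w k * a k)\<^sup>2) \<le> Q"
  shows "(\<Sum>k=1..K. (w k * conv_majorant \<epsilon> a k)\<^sup>2) \<le> 4 * Q"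
proof -
  define b where "b = conv_majorant \<epsilon> a"
  define c where "c k = w k * b k" for k
  define D where "D = 2 powr s"
  have "D \<ge> 1" using \<open>s \<ge> 0\<close> by (auto simp: D_def ge_one_powr_ge_zero)
  have "A \<ge> 0" using A[of 0] by simp
  have b: "b k \<ge> 0" for k using conv_majorant_nonneg[OF \<epsilon>(1) a] by (simp add: b_def)
  have w: "w k \<ge> 0" for k by (simp add: w_def)
  have c: "c k \<ge> 0" for k using w b by (simp add: c_def)
  have "4 * \<epsilon> * A * 1 \<le> 8 * \<epsilon> * A * D"
    using \<epsilon> \<open>A \<ge> 0\<close> \<open>D \<ge> 1\<close> by (intro mult_mono) auto
  also have "\<dots> \<le> 1" using \<epsilon> by (simp add: D_def mult_ac)
  finally have "4 * \<epsilon> * A \<le> 1" by simp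
  from conv_majorant_sum_le[OF \<epsilon>(1) this a A]
  have bsum: "(\<Sum>k=1..K. b k) \<le> 2 * A" for K unfolding b_def .
  have c_le: "c k \<le> w k * a k + 2 * \<epsilon> * D * (\<Sum>m\<in>{1..<k}. c m * b (k - m))" for k
  proof -
    have "c k = w k * a k + \<epsilon> * (\<Sum>m\<in>{1..<k}. w k * (b m * b (k - m)))"
      unfolding c_def b_def by (subst conv_majorant.simps) (simp add: algebra_simps sum_distrib_left)
    also have "\<dots> \<le> w k * a k + \<epsilon> * (\<Sum>m\<in>{1..<k}. D * (c m * b (k - m) + c (k - m) * b m))"
    proof (intro add_left_mono mult_left_mono \<epsilon> sum_mono)
      fix m assume m: "m \<in> {1..<k}"
      have "w k \<le> D * (w m + w (k - m))"
        using sobolev_weight_add_le[OF \<open>s \<ge> 0\<close>, of m "k - m"] m by (simp add: w_def D_def)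
      then have "w k * (b m * b (k - m)) \<le> D * (w m + w (k - m)) * (b m * b (k - m))"
        using b by (intro mult_right_mono) auto
      then show "w k * (b m * b (k - m)) \<le> D * (c m * b (k - m) + c (k - m) * b m)"
        by (simp add: c_def algebra_simps)
    qed
    also have "(\<Sum>m\<in>{1..<k}. D * (c m * b (k - m) + c (k - m) * b m)) =
        D * ((\<Sum>m\<in>{1..<k}. c m * b (k - m)) + (\<Sum>m\<in>{1..<k}. c (k - m) * b m))"
      by (simp add: sum_distrib_left sum.distrib distrib_left)
    also have "(\<Sum>m\<in>{1..<k}. c (k - m) * b m) = (\<Sum>m\<in>{1..<k}. c m * b (k - m))"
      by (rule sum.reindex_bij_witness[of _ "\<lambda>m. k - m" "\<lambda>m. k - m"]) auto
    finally show ?thesis by (simp add: algebra_simps)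
  qed
  \<comment> \<open>Cauchy-Schwarz with \<open>b (k - m)\<close> distributed as two square roots:
    one sum is at most \<open>2A\<close>, the other is again a convolution, now of
    \<open>c^2\<close> with \<open>b\<close>.\<close>
  have conv_sq: "(\<Sum>m\<in>{1..<k}. c m * b (k - m))\<^sup>2 \<le> 2 * A * (\<Sum>m\<in>{1..<k}. (c m)\<^sup>2 * b (k - m))" for k
  proof -
    have "(\<Sum>m\<in>{1..<k}. c m * b (k - m)) = (\<Sum>m\<in>{1..<k}. (c m * sqrt (b (k - m))) * sqrt (b (k - m)))"
      using b by (simp add: mult.assoc)
    then have "(\<Sum>m\<in>{1..<k}. c m * b (k - m))\<^sup>2 \<le>
       (\<Sum>m\<in>{1..<k}. (c m * sqrt (b (k - m)))\<^sup>2) * (\<Sum>m\<in>{1..<k}. (sqrt (b (k - m)))\<^sup>2)"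
      using Cauchy_Schwarz_ineq_sum[of "\<lambda>m. c m * sqrt (b (k - m))" "\<lambda>m. sqrt (b (k - m))" "{1..<k}"]
      by metis
    also have "\<dots> = (\<Sum>m\<in>{1..<k}. (c m)\<^sup>2 * b (k - m)) * (\<Sum>m\<in>{1..<k}. b (k - m))"
      using b by (simp add: power_mult_distrib)
    finally have CS: "(\<Sum>m\<in>{1..<k}. c m * b (k - m))\<^sup>2 \<le>
      (\<Sum>m\<in>{1..<k}. (c m)\<^sup>2 * b (k - m)) * (\<Sum>m\<in>{1..<k}. b (k - m))" .
    have "(\<Sum>m\<in>{1..<k}. b (k - m)) = (\<Sum>m\<in>{1..<k}. b m)"
      by (rule sum.reindex_bij_witness[of _ "\<lambda>m. k - m" "\<lambda>m. k - m"]) auto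
    also have "(\<Sum>m\<in>{1..<k}. b m) \<le> (\<Sum>m=1..k. b m)"
      using b by (intro sum_mono2) auto
    also have "\<dots> \<le> 2 * A" by (rule bsum)
    finally have "(\<Sum>m\<in>{1..<k}. b (k - m)) \<le> 2 * A" .
    from order_trans[OF CS mult_left_mono[OF this]] show ?thesis
      using b by (simp add: mult.commute sum_nonneg)
  qed
  let ?S = "\<Sum>k=1..K. (c k)\<^sup>2"
  have "?S \<le> (\<Sum>k=1..K. 2 * (w k * a k)\<^sup>2 + 8 * \<epsilon>\<^sup>2 * D\<^sup>2 * (\<Sum>m\<in>{1..<k}. c m * b (k - m))\<^sup>2)"
  proof (rule sum_mono)
    fix k
    define X where "X = w k * a k"
    define Y where "Y = 2 * \<epsilon> * D * (\<Sum>m\<in>{1..<k}. c m * b (k - m))"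
    have "(c k)\<^sup>2 \<le> (X + Y)\<^sup>2"
      using c_le[of k] c[of k] unfolding X_def Y_def by (intro power_mono)
    also have "\<dots> \<le> 2 * X\<^sup>2 + 2 * Y\<^sup>2"
      using zero_le_power2[of "X - Y"] by (simp add: power2_eq_square algebra_simps)
    also have "2 * Y\<^sup>2 = 8 * \<epsilon>\<^sup>2 * D\<^sup>2 * (\<Sum>m\<in>{1..<k}. c m * b (k - m))\<^sup>2"
      by (simp add: Y_def power_mult_distrib)
    finally show "(c k)\<^sup>2 \<le> 2 * (w k * a k)\<^sup>2 + 8 * \<epsilon>\<^sup>2 * D\<^sup>2 * (\<Sum>m\<in>{1..<k}. c m * b (k - m))\<^sup>2"
      by (simp add: X_def)
  qed
  also have "\<dots> = 2 * (\<Sum>k=1..K. (w k * a k)\<^sup>2) +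
      8 * \<epsilon>\<^sup>2 * D\<^sup>2 * (\<Sum>k=1..K. (\<Sum>m\<in>{1..<k}. c m * b (k - m))\<^sup>2)"
    by (simp add: sum.distrib sum_distrib_left)
  also have "\<dots> \<le> 2 * Q + 8 * \<epsilon>\<^sup>2 * D\<^sup>2 * (2 * A * (?S * (2 * A)))"
  proof (intro add_mono mult_left_mono Q)
    have "(\<Sum>k=1..K. (\<Sum>m\<in>{1..<k}. c m * b (k - m))\<^sup>2) \<le>
        (\<Sum>k=1..K. 2 * A * (\<Sum>m\<in>{1..<k}. (c m)\<^sup>2 * b (k - m)))"
      by (intro sum_mono conv_sq)
    also have "\<dots> = 2 * A * (\<Sum>k=1..K. \<Sum>m\<in>{1..<k}. (c m)\<^sup>2 * b (k - m))"
      by (simp add: sum_distrib_left)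
    also have "\<dots> \<le> 2 * A * (\<Sum>m=1..K-1. \<Sum>n=1..K-1. (c m)\<^sup>2 * b n)"
      using b \<open>A \<ge> 0\<close> by (intro mult_left_mono sum_convolution_le) auto
    also have "(\<Sum>m=1..K-1. \<Sum>n=1..K-1. (c m)\<^sup>2 * b n) = (\<Sum>m=1..K-1. (c m)\<^sup>2) * (\<Sum>n=1..K-1. b n)"
      by (simp add: sum_product)
    also have "2 * A * \<dots> \<le> 2 * A * (?S * (2 * A))"
      using \<open>A \<ge> 0\<close> b bsum by (intro mult_left_mono mult_mono sum_mono2 sum_nonneg) auto
    finally show "(\<Sum>k=1..K. (\<Sum>m\<in>{1..<k}. c m * b (k - m))\<^sup>2) \<le> 2 * A * (?S * (2 * A))" .
  qed auto
  also have "\<dots> = 2 * Q + (8 * \<epsilon> * D * A)\<^sup>2 * ?S / 2"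
    by (simp add: power2_eq_square)
  also have "\<dots> \<le> 2 * Q + 1 * ?S / 2"
  proof (intro add_left_mono divide_right_mono mult_right_mono)
    show "(8 * \<epsilon> * D * A)\<^sup>2 \<le> 1"
      using \<epsilon> \<open>A \<ge> 0\<close> \<open>D \<ge> 1\<close> by (intro power_le_one) (auto simp: D_def)
  qed (auto intro: sum_nonneg)
  finally show ?thesis by (simp add: c_def b_def)
qed

text \<open>
  Since \<open>1 - e\<^sup>-\<^sup>y \<le> min 1 y \<le> sqrt y\<close>, the derivative loss \<open>k\<close> in the Duhamel term is
  absorbed by the heat kernel at the price of a factor \<open>sqrt (t/\<nu>)\<close>.
\<close>

lemma mode_le_conv_majorant:
  assumes "\<nu> > 0" "k \<ge> 1" "0 \<le> t" "t \<le> T"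
  shows "cmod (mode \<nu> \<alpha> a0 k t) \<le> conv_majorant (3 * sqrt (T / \<nu>)) (\<lambda>k. cmod (a0 k)) k"
  using assms(2-)
proof (induction k arbitrary: t rule: less_induct)
  case (less k)
  define \<epsilon> where "\<epsilon> = 3 * sqrt (T / \<nu>)"
  define b where "b = conv_majorant \<epsilon> (\<lambda>k. cmod (a0 k))"
  define S where "S = (\<Sum>m\<in>{1..<k}. b m * b (k - m))"
  define \<kappa> where "\<kappa> = \<nu> * (real k)\<^sup>2"
  have "\<kappa> > 0" using assms(1) less.prems by (simp add: \<kappa>_def)
  have "T \<ge> 0" using less.prems by simp
  have b: "b k \<ge> 0" for k
    using \<open>T \<ge> 0\<close> \<open>\<nu> > 0\<close> unfolding b_def \<epsilon>_def by (intro conv_majorant_nonneg) auto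
  have "S \<ge> 0" unfolding S_def by (intro sum_nonneg mult_nonneg_nonneg b)
  have IH: "cmod (\<Sum>m\<in>{1..<k}. mode \<nu> \<alpha> a0 m \<tau> * mode \<nu> \<alpha> a0 (k - m) \<tau>) \<le> S" if "\<tau> \<in> {0..t}" for \<tau>
    unfolding S_def
  proof (rule sum_norm_le)
    fix m assume m: "m \<in> {1..<k}"
    show "cmod (mode \<nu> \<alpha> a0 m \<tau> * mode \<nu> \<alpha> a0 (k - m) \<tau>) \<le> b m * b (k - m)"
      unfolding norm_mult b_def \<epsilon>_def
      using less.IH[of m \<tau>] less.IH[of "k - m" \<tau>] m that less.prems b
      by (intro mult_mono less.IH) (auto simp: b_def \<epsilon>_def)
  qed
  have Re_rate: "Re (rate \<nu> \<alpha> (k^2, k^3)) = \<kappa>"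
    by (simp add: rate_def \<kappa>_def)
  have int: "((\<lambda>\<tau>. exp (\<kappa> * \<tau>) * S) has_integral ((exp (\<kappa> * t) - 1) / \<kappa> * S)) {0..t}"
  proof -
    have "((\<lambda>\<tau>. exp (\<kappa> * \<tau>)) has_integral (exp (\<kappa> * t) / \<kappa> - exp (\<kappa> * 0) / \<kappa>)) {0..t}"
      using less.prems \<open>\<kappa> > 0\<close>
      by (intro fundamental_theorem_of_calculus)
         (auto intro!: derivative_eq_intros simp flip: has_real_derivative_iff_has_vector_derivative)
    from has_integral_mult_left[OF this, of S] show ?thesis
      by (simp add: diff_divide_distrib)
  qed
  let ?f = "\<lambda>\<tau>. exp (rate \<nu> \<alpha> (k^2, k^3) * of_real \<tau>) *
            (\<Sum>m\<in>{1..<k}. mode \<nu> \<alpha> a0 m \<tau> * mode \<nu> \<alpha> a0 (k - m) \<tau>)"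
  have "continuous_on {0..t} ?f"
    by (intro continuous_intros continuous_on_subset[OF mode_continuous[OF \<open>\<nu> > 0\<close>]]) auto
  then have "?f integrable_on {0..t}"
    by (rule integrable_continuous_interval)
  then have "cmod (integral {0..t} ?f) \<le> integral {0..t} (\<lambda>\<tau>. exp (\<kappa> * \<tau>) * S)"
  proof (rule integral_norm_bound_integral)
    show "(\<lambda>\<tau>. exp (\<kappa> * \<tau>) * S) integrable_on {0..t}" using int by blast
    show "cmod (?f \<tau>) \<le> exp (\<kappa> * \<tau>) * S" if "\<tau> \<in> {0..t}" for \<tau>
      using IH[OF that] by (simp add: norm_mult Re_rate mult_left_mono)
  qed
  also have "\<dots> = (exp (\<kappa> * t) - 1) / \<kappa> * S"
    using int by (rule integral_unique)
  finally have I: "cmod (integral {0..t} ?f) \<le> (exp (\<kappa> * t) - 1) / \<kappa> * S" .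
  have "cmod (mode \<nu> \<alpha> a0 k t) = exp (- (\<kappa> * t)) * cmod (a0 k + 3 * \<i> * of_nat k * integral {0..t} ?f)"
    unfolding mode_duhamel[OF less.prems(1), of \<nu> \<alpha> a0 t] norm_mult by (simp add: Re_rate)
  also have "\<dots> \<le> exp (- (\<kappa> * t)) * (cmod (a0 k) + 3 * k * ((exp (\<kappa> * t) - 1) / \<kappa> * S))"
  proof (rule mult_left_mono)
    have "cmod (a0 k + 3 * \<i> * of_nat k * integral {0..t} ?f) \<le>
        cmod (a0 k) + cmod (3 * \<i> * of_nat k * integral {0..t} ?f)"
      by (rule norm_triangle_ineq)
    also have "cmod (3 * \<i> * of_nat k * integral {0..t} ?f) = 3 * k * cmod (integral {0..t} ?f)"
      by (simp add: norm_mult)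
    also have "\<dots> \<le> 3 * k * ((exp (\<kappa> * t) - 1) / \<kappa> * S)"
      by (intro mult_left_mono I) auto
    finally show "cmod (a0 k + 3 * \<i> * of_nat k * integral {0..t} ?f) \<le>
        cmod (a0 k) + 3 * k * ((exp (\<kappa> * t) - 1) / \<kappa> * S)" by simp
  qed simp
  also have "\<dots> = exp (- (\<kappa> * t)) * cmod (a0 k) + 3 * k * ((1 - exp (- (\<kappa> * t))) / \<kappa>) * S"
    by (simp add: algebra_simps exp_minus divide_simps)
  also have "\<dots> \<le> 1 * cmod (a0 k) + \<epsilon> * S"
  proof (intro add_mono mult_right_mono \<open>S \<ge> 0\<close>)
    show "exp (- (\<kappa> * t)) \<le> 1" using \<open>\<kappa> > 0\<close> less.prems by simp
    have y: "1 - exp (- y) \<le> sqrt y" if "y \<ge> 0" for y :: real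
    proof (cases "y \<le> 1")
      case True
      have "1 - exp (- y) \<le> y" using exp_ge_add_one_self[of "- y"] by linarith
      also have "y \<le> sqrt y" using True that by (simp add: real_le_rsqrt power2_eq_square mult_left_le)
      finally show ?thesis .
    next
      case False
      then have "1 \<le> sqrt y" by simp
      then show ?thesis by (smt (verit) exp_gt_zero)
    qed
    have "3 * k * ((1 - exp (- (\<kappa> * t))) / \<kappa>) \<le> 3 * k * (sqrt (\<kappa> * t) / \<kappa>)"
      using y[of "\<kappa> * t"] \<open>\<kappa> > 0\<close> less.prems by (intro mult_left_mono divide_right_mono) auto
    also have "\<dots> = 3 * sqrt (t / \<nu>)"
    proof -
      have "sqrt (\<kappa> * t) = real k * (sqrt \<nu> * sqrt t)" by (simp add: \<kappa>_def real_sqrt_mult)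
      then show ?thesis
        using less.prems \<open>\<nu> > 0\<close>
        by (simp add: \<kappa>_def real_sqrt_divide power2_eq_square field_simps)
    qed
    also have "\<dots> \<le> \<epsilon>"
      using less.prems \<open>\<nu> > 0\<close> by (simp add: \<epsilon>_def divide_right_mono)
    finally show "3 * k * ((1 - exp (- (\<kappa> * t))) / \<kappa>) \<le> \<epsilon>" .
  qed auto
  also have "\<dots> = b k"
    unfolding b_def by (subst conv_majorant.simps) (simp add: S_def b_def)
  finally show ?case by (simp add: b_def \<epsilon>_def)
qed

lemma summable_from_1:
  fixes f :: "nat \<Rightarrow> real"
  assumes "\<And>k. k \<ge> 1 \<Longrightarrow> f k \<ge> 0" "\<And>K. (\<Sum>k=1..K. f k) \<le> B"
  shows "summable f"
proof -
  have "summable (\<lambda>k. f (Suc k))"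
  proof (rule summableI_nonneg_bounded)
    fix n show "0 \<le> f (Suc n)" using assms(1) by simp
    have "(\<Sum>i<n. f (Suc i)) = (\<Sum>k=1..n. f k)"
      by (rule sum.reindex_bij_witness[of _ "\<lambda>k. k - 1" Suc]) auto
    then show "(\<Sum>i<n. f (Suc i)) \<le> B" using assms(2) by simp
  qed
  then show ?thesis by (simp only: summable_Suc_iff)
qed

lemma sum_from_1_le_suminf:
  fixes f :: "nat \<Rightarrow> real"
  assumes "\<And>k. f k \<ge> 0" "summable f"
  shows "(\<Sum>k=1..K. f k) \<le> suminf f"
  using assms by (intro sum_le_suminf) auto

text \<open>A bound for all times down to t = 0. It lets the Weierstrass test carry continuity in
  time and membership in the Sobolev space from the single modes to the series. The bounds for the
  two time ranges are simply added.\<close>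

lemma mode_majorant:
  assumes "\<nu> > 0" "s \<ge> 0"
    and hyp: "\<exists>C0::real. \<forall>(k::nat) (h::nat) (l::nat) (j :: nat \<Rightarrow>\<^sub>0 nat).
           k \<ge> 1 \<and> k \<le> h \<and> h < k^2 \<and> k \<le> l \<and> l < k^3 \<and>
           Poly_Mapping.keys j \<subseteq> {1..k} \<and> (\<Sum>i=1..k. i * Poly_Mapping.lookup j i) = k
           \<longrightarrow> cmod (C_coeff \<alpha> \<nu> k h l j) \<le> C0"
    and a0: "\<forall>i\<ge>1. cmod (a0 i) \<le> 1"
    and A: "summable (\<lambda>k. cmod (a0 k))"
    and Q: "summable (\<lambda>k. (1 + (real k)\<^sup>2) powr s * (cmod (a0 k))\<^sup>2)"
  obtains B where "\<And>k t. t \<ge> 0 \<Longrightarrow> cmod (mode \<nu> \<alpha> a0 k t) \<le> B k" "summable B"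
    "summable (\<lambda>k. (1 + (real k)\<^sup>2) powr s * (B k)\<^sup>2)"
proof -
  define a where "a k = cmod (a0 k)" for k
  define w where "w k = (1 + (real k)\<^sup>2) powr (s / 2)" for k
  have w2: "(w k)\<^sup>2 = (1 + (real k)\<^sup>2) powr s" for k
    by (simp add: w_def power2_eq_square flip: powr_add)
  define A' where "A' = suminf a"
  have a: "a k \<ge> 0" for k by (simp add: a_def)
  have A': "(\<Sum>k=1..K. a k) \<le> A'" for K
    unfolding A'_def by (rule sum_from_1_le_suminf) (use A in \<open>auto simp: a_def\<close>)
  then have "A' \<ge> 0" using A'[of 0] by simp
  have Q': "(\<Sum>k=1..K. (w k * a k)\<^sup>2) \<le> suminf (\<lambda>k. (w k * a k)\<^sup>2)" for K
    by (rule sum_from_1_le_suminf) (use Q in \<open>auto simp: power_mult_distrib w2 a_def\<close>)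
  \<comment> \<open>Chosen so that \<open>\<epsilon> = 1/E\<close> meets both smallness conditions;
    the summand 1 keeps it positive when the data vanish.\<close>
  define E where "E = 1 + 8 * 2 powr s * A'"
  have "E > 0" using \<open>A' \<ge> 0\<close> by (simp add: E_def add_pos_nonneg)
  \<comment> \<open>The time at which the parameter \<open>3 * sqrt (T/\<nu>)\<close> of the
    majorant equals \<open>1/E\<close>; from there on the decay bound takes over.\<close>
  define T where "T = \<nu> / (3 * E)\<^sup>2"
  have "T > 0" using \<open>\<nu> > 0\<close> \<open>E > 0\<close> by (simp add: T_def)
  define \<epsilon> where "\<epsilon> = 3 * sqrt (T / \<nu>)"
  have "T / \<nu> = (1 / (3 * E))\<^sup>2"
    using \<open>\<nu> > 0\<close> by (simp add: T_def power_divide)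
  then have \<epsilon>: "\<epsilon> = 1 / E"
    using \<open>E > 0\<close> by (simp only: \<epsilon>_def real_sqrt_abs) simp
  have "\<epsilon> \<ge> 0" using \<epsilon> \<open>E > 0\<close> by simp
  have \<epsilon>1: "8 * \<epsilon> * 2 powr s * A' \<le> 1"
    unfolding \<epsilon> using \<open>E > 0\<close> by (simp add: field_simps E_def)
  have "4 * \<epsilon> * A' * 1 \<le> 8 * \<epsilon> * A' * 2 powr s"
    using \<open>\<epsilon> \<ge> 0\<close> \<open>A' \<ge> 0\<close> \<open>s \<ge> 0\<close> by (intro mult_mono) (auto simp: ge_one_powr_ge_zero)
  with \<epsilon>1 have \<epsilon>2: "4 * \<epsilon> * A' \<le> 1" by (simp add: mult_ac)
  define b where "b = conv_majorant \<epsilon> a"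
  have b: "b k \<ge> 0" for k unfolding b_def using \<open>\<epsilon> \<ge> 0\<close> a by (rule conv_majorant_nonneg)
  have "summable b"
    using conv_majorant_sum_le[OF \<open>\<epsilon> \<ge> 0\<close> \<epsilon>2 a A'] b by (intro summable_from_1) (auto simp: b_def)
  have "summable (\<lambda>k. (w k * b k)\<^sup>2)"
    using conv_majorant_sobolev_le[OF \<open>s \<ge> 0\<close> \<open>\<epsilon> \<ge> 0\<close> \<epsilon>1 a A', folded w_def, OF Q'] b
    by (intro summable_from_1) (auto simp: b_def)
  obtain K where K: "K > 0" "\<And>k t. t \<ge> T \<Longrightarrow> cmod (mode \<nu> \<alpha> a0 k t) \<le> K * exp (- (\<nu> * k * t / 2))"
    using mode_decay[OF \<open>\<nu> > 0\<close> hyp \<open>T > 0\<close>] a0 by blast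
  define x where "x = exp (- (\<nu> * T / 2))"
  have x: "0 < x" "x < 1" using \<open>\<nu> > 0\<close> \<open>T > 0\<close> by (auto simp: x_def)
  have "x\<^sup>2 < 1" "0 < x\<^sup>2" using x by (auto simp: power_less_one_iff)
  define c where "c k = K * x ^ k" for k
  have c: "c k \<ge> 0" for k using K x by (simp add: c_def)
  have "summable c"
    unfolding c_def using x by (intro summable_mult summable_geometric) auto
  have "summable (\<lambda>k. K\<^sup>2 * ((1 + (real k)\<^sup>2) powr s * (x\<^sup>2) ^ k))"
    using \<open>x\<^sup>2 < 1\<close> \<open>0 < x\<^sup>2\<close> by (intro summable_mult summable_sobolev_weight_geometric)
  then have c2: "summable (\<lambda>k. (w k * c k)\<^sup>2)"
    by (simp add: power_mult_distrib w2 c_def mult_ac flip: power_mult)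
  show thesis
  proof (rule that[of "\<lambda>k. b k + c k"])
    fix k t assume "t \<ge> (0::real)"
    show "cmod (mode \<nu> \<alpha> a0 k t) \<le> b k + c k"
    proof (cases "k = 0")
      case True
      then show ?thesis using b[of k] c[of k] by (simp add: mode_def)
    next
      case k: False
      show ?thesis
      proof (cases "t \<le> T")
        case True
        have "cmod (mode \<nu> \<alpha> a0 k t) \<le> b k"
          unfolding b_def \<epsilon>_def a_def
          by (rule mode_le_conv_majorant) (use True k \<open>t \<ge> 0\<close> \<open>\<nu> > 0\<close> in auto)
        then show ?thesis using c[of k] by simp
      next
        case False
        have "cmod (mode \<nu> \<alpha> a0 k t) \<le> K * exp (- (\<nu> * k * t / 2))"
          using K(2) False by simp
        also have "\<dots> \<le> K * exp (- (\<nu> * k * T / 2))"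
          using K(1) False \<open>\<nu> > 0\<close> by (intro mult_left_mono) (auto intro!: mult_left_mono)
        also have "\<dots> = c k"
          by (simp add: c_def x_def flip: exp_of_nat_mult)
        finally show ?thesis using b[of k] by simp
      qed
    qed
  next
    show "summable (\<lambda>k. b k + c k)"
      using \<open>summable b\<close> \<open>summable c\<close> by (rule summable_add)
    have "summable (\<lambda>k. 2 * (w k * b k)\<^sup>2 + 2 * (w k * c k)\<^sup>2)"
      using \<open>summable (\<lambda>k. (w k * b k)\<^sup>2)\<close> c2 by (intro summable_add summable_mult)
    then show "summable (\<lambda>k. (1 + (real k)\<^sup>2) powr s * (b k + c k)\<^sup>2)"
    proof (rule summable_comparison_test')
      fix k :: nat assume "k \<ge> 0"
      have "norm ((1 + (real k)\<^sup>2) powr s * (b k + c k)\<^sup>2) = (w k * b k + w k * c k)\<^sup>2"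
        unfolding w2[symmetric] by (simp add: power_mult_distrib flip: distrib_left)
      also have "\<dots> \<le> 2 * (w k * b k)\<^sup>2 + 2 * (w k * c k)\<^sup>2"
        using zero_le_power2[of "w k * b k - w k * c k"] by (simp add: power2_eq_square algebra_simps)
      finally show "norm ((1 + (real k)\<^sup>2) powr s * (b k + c k)\<^sup>2) \<le> 2 * (w k * b k)\<^sup>2 + 2 * (w k * c k)\<^sup>2" .
    qed
  qed
qed

section \<open>Fourier series on the torus\<close>

lemma has_integral_cis:
  "((\<lambda>x. cis (of_int n * x)) has_integral (if n = 0 then 2 * pi else 0)) {0..2*pi}"
proof (cases "n = 0")
  case True
  then show ?thesis
    using has_integral_const_real[of "1::complex" 0 "2 * pi"] by (simp add: scaleR_conv_of_real)
next
  case False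
  let ?c = "\<i> * of_int n :: complex"
  have "((\<lambda>x. cis (of_int n * x)) has_integral (exp (?c * of_real (2*pi)) / ?c - exp (?c * of_real 0) / ?c)) {0..2*pi}"
  proof (rule fundamental_theorem_of_calculus)
    fix x :: real
    have "((\<lambda>z. exp (?c * z) / ?c) has_field_derivative exp (?c * of_real x)) (at (of_real x))"
      using False by (auto intro!: derivative_eq_intros)
    then have "((\<lambda>\<tau>. exp (?c * of_real \<tau>) / ?c) has_vector_derivative exp (?c * of_real x)) (at x within {0..2*pi})"
      by (rule has_vector_derivative_real_field)
    then show "((\<lambda>\<tau>. exp (?c * of_real \<tau>) / ?c) has_vector_derivative cis (of_int n * x)) (at x within {0..2*pi})"
      by (simp add: cis_conv_exp mult_ac)
  qed simp
  moreover have "exp (?c * of_real (2*pi)) = 1"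
  proof -
    have "exp (?c * of_real (2*pi)) = cis (2 * pi * of_int n)"
      by (simp add: cis_conv_exp mult_ac)
    then show ?thesis by (simp add: cis_multiple_2pi)
  qed
  ultimately show ?thesis using False by simp
qed

text \<open>Passes from the Lebesgue integral of the definition to the gauge integral, in which
  uniform limits and orthogonality are computed.\<close>

lemma fourier_coeff_continuous:
  assumes "continuous_on UNIV f"
  shows "fourier_coeff f k = integral {0..2*pi} (\<lambda>x. f x * cis (- (of_int k * x))) / (2 * pi)"
proof -
  have "continuous_on {0..2*pi} (\<lambda>x. f x * cis (- (of_int k * x)))"
    by (intro continuous_intros continuous_on_subset[OF assms]) auto
  then have "set_integrable lebesgue {0..2*pi} (\<lambda>x. f x * cis (- (of_int k * x)))"
    by (rule absolutely_integrable_continuous_real)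
  then show ?thesis
    by (simp add: fourier_coeff_def set_lebesgue_integral_eq_integral)
qed

lemma fourier_coeff_diff:
  assumes "continuous_on UNIV f" "continuous_on UNIV g"
  shows "fourier_coeff (\<lambda>x. f x - g x) k = fourier_coeff f k - fourier_coeff g k"
proof -
  have "(\<lambda>x. h x * cis (- (of_int k * x))) integrable_on {0..2*pi}"
    if "continuous_on UNIV h" for h :: "real \<Rightarrow> complex"
    by (intro integrable_continuous_interval continuous_intros continuous_on_subset[OF that]) auto
  then have "integral {0..2*pi} (\<lambda>x. f x * cis (- (of_int k * x)) - g x * cis (- (of_int k * x))) =
    integral {0..2*pi} (\<lambda>x. f x * cis (- (of_int k * x))) - integral {0..2*pi} (\<lambda>x. g x * cis (- (of_int k * x)))"
    using assms by (intro Henstock_Kurzweil_Integration.integral_diff) auto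
  then show ?thesis
    by (simp add: fourier_coeff_continuous assms continuous_on_diff left_diff_distrib diff_divide_distrib)
qed

text \<open>The frequencies form an arbitrary integer sequence \<open>e\<close>: \<open>int\<close>
  gives the series of the solution, \<open>int_decode\<close> a full Fourier series, and
  \<open>e n - k\<close> arises when a coefficient is extracted.\<close>

lemma trig_series_uniform_limit:
  fixes c :: "nat \<Rightarrow> complex"
  assumes "summable (\<lambda>n. cmod (c n))"
  shows "uniform_limit A (\<lambda>N x. \<Sum>n<N. c n * cis (of_int (e n) * x))
    (\<lambda>x. suminf (\<lambda>n. c n * cis (of_int (e n) * x))) sequentially"
  by (rule Weierstrass_m_test[OF _ assms]) (simp add: norm_mult)

lemma trig_series_summable:
  fixes c :: "nat \<Rightarrow> complex"
  assumes "summable (\<lambda>n. cmod (c n))"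
  shows "summable (\<lambda>n. c n * cis (of_int (e n) * x))"
  by (rule summable_norm_cancel) (simp add: norm_mult assms)

lemma trig_series_continuous:
  fixes c :: "nat \<Rightarrow> complex"
  assumes "summable (\<lambda>n. cmod (c n))"
  shows "continuous_on A (\<lambda>x. suminf (\<lambda>n. c n * cis (of_int (e n) * x)))"
  by (rule uniform_limit_theorem[OF _ trig_series_uniform_limit[OF assms]])
     (auto intro!: always_eventually continuous_intros)

lemma cis_int_periodic: "cis (of_int k * (x + 2 * pi)) = cis (of_int k * x)"
proof -
  have "cis (of_int k * (x + 2 * pi)) = cis (of_int k * x) * cis (2 * pi * of_int k)"
    by (simp add: cis_mult algebra_simps)
  then show ?thesis by (simp add: cis_multiple_2pi)
qed

lemma trig_series_periodic: "periodic_2pi (\<lambda>x. suminf (\<lambda>n. c n * cis (of_int (e n) * x)))"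
  by (simp add: periodic_2pi_def cis_int_periodic)

text \<open>Multiplication by \<open>cis (- k x)\<close> shifts all frequencies by \<open>k\<close>;
  uniform convergence permits termwise integration, and injectivity of \<open>e\<close> leaves at
  most one nonzero term.\<close>

lemma trig_series_fourier_coeff:
  fixes c :: "nat \<Rightarrow> complex"
  assumes c: "summable (\<lambda>n. cmod (c n))" and "inj e"
  shows "fourier_coeff (\<lambda>x. suminf (\<lambda>n. c n * cis (of_int (e n) * x))) k =
    (if k \<in> range e then c (inv e k) else 0)"
proof -
  let ?f = "\<lambda>x. suminf (\<lambda>n. c n * cis (of_int (e n) * x))"
  have eq: "suminf (\<lambda>n. c n * cis (of_int (e n - k) * x)) = ?f x * cis (- (of_int k * x))" for x
  proof -
    have "?f x * cis (- (of_int k * x)) = suminf (\<lambda>n. c n * cis (of_int (e n) * x) * cis (- (of_int k * x)))"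
      by (rule suminf_mult2[OF trig_series_summable[OF c]])
    also have "\<dots> = suminf (\<lambda>n. c n * cis (of_int (e n - k) * x))"
      by (intro suminf_cong) (simp add: mult.assoc cis_mult left_diff_distrib)
    finally show ?thesis by simp
  qed
  have ul: "uniform_limit {0..2*pi} (\<lambda>N x. \<Sum>n<N. c n * cis (of_int (e n - k) * x))
      (\<lambda>x. ?f x * cis (- (of_int k * x))) sequentially"
    using trig_series_uniform_limit[OF c, where A = "{0..2*pi}" and e = "\<lambda>n. e n - k"] by (simp only: eq)
  obtain I J where I: "\<And>N. ((\<lambda>x. \<Sum>n<N. c n * cis (of_int (e n - k) * x)) has_integral I N) {0..2*pi}"
    and J: "((\<lambda>x. ?f x * cis (- (of_int k * x))) has_integral J) {0..2*pi}" and lim: "I \<longlonglongrightarrow> J"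
    by (rule uniform_limit_integral[OF ul]) (auto intro!: continuous_intros)
  have "I N = (\<Sum>n<N. c n * (if e n - k = 0 then 2 * pi else 0))" for N
    by (rule has_integral_unique[OF I]) (intro has_integral_sum has_integral_mult_right has_integral_cis finite_lessThan)
  then have "I = (\<lambda>N. \<Sum>n<N. c n * (if e n - k = 0 then 2 * pi else 0))" by blast
  with lim have "(\<lambda>n. c n * (if e n - k = 0 then 2 * pi else 0)) sums J"
    unfolding sums_def by (simp only:)
  moreover have "(\<lambda>n. c n * (if e n - k = 0 then 2 * pi else 0)) sums
      (if k \<in> range e then c (inv e k) * (2 * pi) else 0)"
  proof (cases "k \<in> range e")
    case True
    then have "e (inv e k) = k" by (rule f_inv_into_f)
    then have "(\<lambda>n. c n * (if e n - k = 0 then 2 * pi else 0)) =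
        (\<lambda>n. if n = inv e k then c n * (2 * pi) else 0)"
      using \<open>inj e\<close> by (auto simp: fun_eq_iff inj_eq)
    then show ?thesis
      using True sums_single[of "inv e k" "\<lambda>n. c n * complex_of_real (2 * pi)"] by simp
  next
    case False
    then have "e n - k \<noteq> 0" for n by auto
    then have "(\<lambda>n. c n * complex_of_real (if e n - k = 0 then 2 * pi else 0)) = (\<lambda>n. 0)"
      by (simp only: if_False of_real_0 mult_zero_right)
    then show ?thesis using False by (simp only:) simp
  qed
  ultimately have "J = (if k \<in> range e then c (inv e k) * (2 * pi) else 0)"
    by (rule sums_unique2)
  then show ?thesis
    using integral_unique[OF J] fourier_coeff_continuous[OF trig_series_continuous[OF c], of e k] by simp
qed

section \<open>Uniqueness theorem for Fourier coefficients\<close>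

lemma periodic_2pi_cis_eq:
  assumes "periodic_2pi h" "cis x = cis y"
  shows "h x = h y"
proof -
  interpret periodic_fun_simple h "2 * pi"
    using assms(1) by unfold_locales (simp add: periodic_2pi_def)
  obtain n :: int where "y = x + 2 * pi * n"
    using assms(2) sin_cos_eq_iff[of y x] by (auto simp: complex_eq_iff)
  then show ?thesis using plus_of_int[of x n] by (simp add: mult.commute)
qed

lemma periodic_2pi_eq_0:
  assumes "periodic_2pi h" and "\<And>y. y \<in> {0..2*pi} \<Longrightarrow> h y = 0"
  shows "h x = 0"
proof -
  have "cis x = cis (Arg2pi (cis x))"
    using Arg2pi_eq[of "cis x"] unfolding norm_cis of_real_1 mult_1 cis_conv_exp[of "Arg2pi (cis x)"] .
  then have "h x = h (Arg2pi (cis x))"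
    by (rule periodic_2pi_cis_eq[OF assms(1)])
  then show ?thesis
    using assms(2)[of "Arg2pi (cis x)"] Arg2pi[of "cis x"] by simp
qed

lemma cis_Arg_unit: "cmod z = 1 \<Longrightarrow> cis (Arg z) = z"
  by (metis cis_conv_exp complex_norm_eq_1_exp_eq)

text \<open>
  A periodic function descends to the unit circle. Near the branch cut of the argument it is
  written through the argument of the antipode.
\<close>

lemma continuous_on_circle:
  assumes "continuous_on UNIV h" "periodic_2pi h"
  shows "continuous_on (sphere 0 1) (\<lambda>z. h (Arg z))"
proof -
  have h: "isCont h x" for x
    using assms(1) by (simp add: continuous_on_eq_continuous_at)
  have "continuous (at z within sphere 0 1) (\<lambda>z. h (Arg z))" if z: "z \<in> sphere 0 1" for z
  proof (cases "z \<in> \<real>\<^sub>\<le>\<^sub>0")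
    case False
    then have "isCont (\<lambda>z. h (Arg z)) z"
      by (intro isCont_o2[OF continuous_at_Arg h])
    then show ?thesis by (rule continuous_at_imp_continuous_within)
  next
    case True
    with z have "- z \<notin> \<real>\<^sub>\<le>\<^sub>0"
      by (auto simp: complex_nonpos_Reals_iff complex_eq_iff norm_complex_def)
    then have "isCont (\<lambda>w. Arg (- w) + pi) z"
      by (intro continuous_intros isCont_o2[of _ uminus Arg] continuous_at_Arg) auto
    then have "isCont (\<lambda>w. h (Arg (- w) + pi)) z"
      by (rule isCont_o2[OF _ h])
    then have "continuous (at z within sphere 0 1) (\<lambda>w. h (Arg (- w) + pi))"
      by (rule continuous_at_imp_continuous_within)
    then show ?thesis
    proof (rule continuous_transform_within[OF _ zero_less_one])
      fix w :: complex assume "w \<in> sphere 0 1"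
      then have "cis (Arg (- w) + pi) = cis (Arg w)"
        by (simp add: cis_Arg_unit flip: cis_mult)
      then show "h (Arg (- w) + pi) = h (Arg w)"
        by (rule periodic_2pi_cis_eq[OF assms(2)])
    qed (use z in auto)
  qed
  then show ?thesis by (simp add: continuous_on_eq_continuous_within)
qed

lemma real_polynomial_cis_continuous:
  assumes "real_polynomial_function p"
  shows "continuous_on S (\<lambda>x. p (cis x))"
proof (rule continuous_on_compose2[of UNIV p S cis])
  show "continuous_on UNIV p"
    using assms by (simp add: real_polynomial_function_eq continuous_on_polymonial_function)
qed (auto intro: continuous_intros)

text \<open>Orthogonality to all frequencies is stable under multiplication by a polynomial in
  \<open>cis x\<close>, which is proved by induction on the polynomial. Generalising over
  \<open>f\<close> handles products, where \<open>f * g1\<close> takes the role of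
  \<open>f\<close>.\<close>

lemma orthogonal_trig_polynomial:
  fixes f :: "real \<Rightarrow> complex" and g :: "complex \<Rightarrow> real"
  assumes "real_polynomial_function g" "continuous_on UNIV f"
    and "\<And>k::int. integral {0..2*pi} (\<lambda>x. f x * cis (of_int k * x)) = 0"
  shows "integral {0..2*pi} (\<lambda>x. f x * of_real (g (cis x)) * cis (of_int k * x)) = 0"
  using assms
proof (induction g arbitrary: f k rule: real_polynomial_function.induct)
  case (linear g)
  \<comment> \<open>On the circle a real-linear functional is a combination of \<open>cis x\<close>
    and \<open>cis (- x)\<close>; it shifts the frequency by one in either direction.\<close>
  define p q where "p = (of_real (g 1) - \<i> * of_real (g \<i>)) / 2"
    and "q = (of_real (g 1) + \<i> * of_real (g \<i>)) / 2"
  have g: "complex_of_real (g (cis x)) = p * cis x + q * cis (- x)" for x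
  proof -
    have "cis x = cos x *\<^sub>R 1 + sin x *\<^sub>R \<i>" by (simp add: complex_eq_iff)
    then have "g (cis x) = g (cos x *\<^sub>R 1 + sin x *\<^sub>R \<i>)" by (rule arg_cong)
    also have "\<dots> = cos x * g 1 + sin x * g \<i>"
      using bounded_linear.linear[OF linear.hyps] by (simp only: linear_add linear_scale real_scaleR_def)
    finally have "g (cis x) = cos x * g 1 + sin x * g \<i>" .
    then show ?thesis
      by (simp add: complex_eq_iff p_def q_def algebra_simps add_divide_distrib diff_divide_distrib)
  qed
  have "f x * of_real (g (cis x)) * cis (of_int k * x) =
      p * (f x * cis (of_int (k + 1) * x)) + q * (f x * cis (of_int (k - 1) * x))" for x
  proof -
    have "cis (of_int (k + 1) * x) = cis x * cis (of_int k * x)"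
      "cis (of_int (k - 1) * x) = cis (- x) * cis (of_int k * x)"
      by (simp_all add: cis_mult algebra_simps)
    then show ?thesis by (simp add: g algebra_simps)
  qed
  moreover have "((\<lambda>x. f x * cis (of_int j * x)) has_integral 0) {0..2*pi}" for j
    unfolding linear.prems(2)[of j, symmetric]
    by (intro integrable_integral integrable_continuous_interval continuous_intros
        continuous_on_subset[OF linear.prems(1)]) auto
  then have "((\<lambda>x. p * (f x * cis (of_int (k + 1) * x)) + q * (f x * cis (of_int (k - 1) * x)))
      has_integral (p * 0 + q * 0)) {0..2*pi}"
    by (intro has_integral_add has_integral_mult_right)
  ultimately show ?case
    by (simp only:) (simp add: integral_unique)
next
  case (const c)
  have "f x * of_real c * cis (of_int k * x) = of_real c * (f x * cis (of_int k * x))" for x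
    by (simp add: mult_ac)
  then show ?case
    by (simp only: integral_mult_right const.prems(2) mult_zero_right)
next
  case (add g1 g2)
  have int: "(\<lambda>x. f x * of_real (g (cis x)) * cis (of_int k * x)) integrable_on {0..2*pi}"
    if "real_polynomial_function g" for g
    by (intro integrable_continuous_interval continuous_intros real_polynomial_cis_continuous that continuous_on_subset[OF add.prems(1)]) auto
  have "integral {0..2*pi} (\<lambda>x. f x * of_real (g1 (cis x)) * cis (of_int k * x) +
      f x * of_real (g2 (cis x)) * cis (of_int k * x)) = 0"
    by (simp add: Henstock_Kurzweil_Integration.integral_add int add)
  then show ?case by (simp add: algebra_simps)
next
  case (mult g1 g2)
  have "continuous_on UNIV (\<lambda>x. f x * of_real (g1 (cis x)))"
    by (intro continuous_intros real_polynomial_cis_continuous mult.prems mult.hyps)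
  then have "integral {0..2*pi} (\<lambda>x. (f x * of_real (g1 (cis x))) * of_real (g2 (cis x)) * cis (of_int k * x)) = 0"
    by (rule mult.IH(2)) (rule mult.IH(1)[OF mult.prems])
  then show ?case by (simp add: mult.assoc)
qed

text \<open>Real and imaginary part of \<open>h\<close>, viewed on the circle, are approximated by
  real polynomials. Their combination \<open>q\<close> satisfies that the integral of
  \<open>h q\<close> vanishes, so the integral of \<open>|h|^2\<close> equals that of
  \<open>h (cnj h - q)\<close> and is arbitrarily small.\<close>

theorem fourier_uniqueness:
  assumes h: "continuous_on UNIV h" and per: "periodic_2pi h"
    and zero: "\<And>k. fourier_coeff h k = 0"
  shows "h x = 0"
proof -
  have orth: "integral {0..2*pi} (\<lambda>x. h x * cis (of_int k * x)) = 0" for k :: int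
    using zero[of "- k"] by (simp add: fourier_coeff_continuous[OF h])
  have circ: "continuous_on (sphere 0 1) (\<lambda>z. Re (h (Arg z)))" "continuous_on (sphere 0 1) (\<lambda>z. Im (h (Arg z)))"
    using continuous_on_circle[OF h per] by (auto intro: continuous_intros)
  have h_Arg: "h (Arg (cis x)) = h x" for x
    by (rule periodic_2pi_cis_eq[OF per]) (simp add: cis_Arg_unit)
  have h': "continuous_on S h" for S
    using h continuous_on_subset by blast
  have int_h: "(\<lambda>x. cmod (h x)) integrable_on {0..2*pi}"
    by (intro integrable_continuous_interval continuous_intros h')
  define L where "L = integral {0..2*pi} (\<lambda>x. cmod (h x))"
  have bound: "cmod (integral {0..2*pi} (\<lambda>x. h x * cnj (h x))) \<le> 2 * e * L" if "e > 0" for e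
  proof -
    obtain p1 where p1: "real_polynomial_function p1" "\<And>z. z \<in> sphere 0 1 \<Longrightarrow> \<bar>Re (h (Arg z)) - p1 z\<bar> < e"
      using Stone_Weierstrass_real_polynomial_function[OF compact_sphere circ(1) \<open>e > 0\<close>] by metis
    obtain p2 where p2: "real_polynomial_function p2" "\<And>z. z \<in> sphere 0 1 \<Longrightarrow> \<bar>Im (h (Arg z)) - p2 z\<bar> < e"
      using Stone_Weierstrass_real_polynomial_function[OF compact_sphere circ(2) \<open>e > 0\<close>] by metis
    \<comment> \<open>The minus sign makes \<open>q\<close> an approximation of \<open>cnj h\<close>
      rather than of \<open>h\<close>.\<close>
    define q where "q x = complex_of_real (p1 (cis x)) - \<i> * of_real (p2 (cis x))" for x
    have cont_q: "continuous_on {0..2*pi} q"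
      unfolding q_def by (intro continuous_intros real_polynomial_cis_continuous p1 p2)
    have p: "integral {0..2*pi} (\<lambda>x. h x * of_real (p1 (cis x))) = 0"
      "integral {0..2*pi} (\<lambda>x. h x * of_real (p2 (cis x))) = 0"
      using orthogonal_trig_polynomial[OF p1(1) h orth, of 0] orthogonal_trig_polynomial[OF p2(1) h orth, of 0]
      by simp_all
    have int: "(\<lambda>x. h x * of_real (p1 (cis x))) integrable_on {0..2*pi}"
      "(\<lambda>x. h x * of_real (p2 (cis x))) integrable_on {0..2*pi}"
      by (intro integrable_continuous_interval continuous_intros real_polynomial_cis_continuous p1 p2 h')+
    have "integral {0..2*pi} (\<lambda>x. h x * of_real (p1 (cis x)) - \<i> * (h x * of_real (p2 (cis x)))) = 0"
      using p by (subst Henstock_Kurzweil_Integration.integral_diff)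
        (auto simp: int integrable_on_mult_right_iff)
    then have hq: "integral {0..2*pi} (\<lambda>x. h x * q x) = 0"
      by (simp add: q_def algebra_simps)
    have "integral {0..2*pi} (\<lambda>x. h x * cnj (h x)) = integral {0..2*pi} (\<lambda>x. h x * (cnj (h x) - q x) + h x * q x)"
      by (simp add: algebra_simps)
    also have "\<dots> = integral {0..2*pi} (\<lambda>x. h x * (cnj (h x) - q x)) + integral {0..2*pi} (\<lambda>x. h x * q x)"
      by (intro Henstock_Kurzweil_Integration.integral_add integrable_continuous_interval continuous_intros h' cont_q)
    finally have "integral {0..2*pi} (\<lambda>x. h x * cnj (h x)) = integral {0..2*pi} (\<lambda>x. h x * (cnj (h x) - q x))"
      using hq by simp
    also have "cmod \<dots> \<le> integral {0..2*pi} (\<lambda>x. 2 * e * cmod (h x))"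
    proof (rule integral_norm_bound_integral)
      fix x
      have s: "cis x \<in> sphere 0 1" by simp
      have "cnj (h x) - q x = Complex (Re (h x) - p1 (cis x)) (- (Im (h x) - p2 (cis x)))"
        by (simp add: q_def complex_eq_iff)
      then have "cmod (cnj (h x) - q x) \<le> \<bar>Re (h x) - p1 (cis x)\<bar> + \<bar>Im (h x) - p2 (cis x)\<bar>"
        using cmod_le[of "cnj (h x) - q x"] by (simp add: abs_minus_commute)
      then have "cmod (cnj (h x) - q x) \<le> 2 * e"
        using p1(2)[OF s] p2(2)[OF s] by (simp add: h_Arg)
      from mult_left_mono[OF this norm_ge_zero[of "h x"]]
      show "cmod (h x * (cnj (h x) - q x)) \<le> 2 * e * cmod (h x)"
        by (simp add: norm_mult mult_ac)
    qed (intro integrable_continuous_interval continuous_intros h' cont_q)+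
    also have "\<dots> = 2 * e * L" by (simp add: L_def)
    finally show ?thesis .
  qed
  have "cmod (integral {0..2*pi} (\<lambda>x. h x * cnj (h x))) \<le> 0"
  proof (rule field_le_epsilon)
    fix e :: real assume "e > 0"
    have "L \<ge> 0" unfolding L_def by (intro integral_nonneg int_h) auto
    show "cmod (integral {0..2*pi} (\<lambda>x. h x * cnj (h x))) \<le> 0 + e"
    proof (cases "L = 0")
      case True
      then show ?thesis using bound[of 1] \<open>e > 0\<close> by simp
    next
      case False
      then show ?thesis using bound[of "e / (2 * L)"] \<open>e > 0\<close> \<open>L \<ge> 0\<close> by simp
    qed
  qed
  then have "integral {0..2*pi} (\<lambda>x. complex_of_real ((cmod (h x))\<^sup>2)) = 0"
    by (simp add: complex_norm_square del: of_real_power)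
  moreover have "integral {0..2*pi} (\<lambda>x. complex_of_real ((cmod (h x))\<^sup>2)) =
      of_real (integral {0..2*pi} (\<lambda>x. (cmod (h x))\<^sup>2))"
    by (rule integral_unique, rule has_integral_of_real, rule integrable_integral)
       (intro integrable_continuous_interval continuous_intros h')
  ultimately have "integral {0..2*pi} (\<lambda>x. (cmod (h x))\<^sup>2) = 0"
    by (simp only: of_real_eq_0_iff)
  moreover have "continuous_on {0..2*pi} (\<lambda>x. (cmod (h x))\<^sup>2)"
    by (intro continuous_intros h')
  ultimately have 0: "h x = 0" if "x \<in> {0..2*pi}" for x
    using integral_eq_0_iff[of 0 "2*pi" "\<lambda>x. (cmod (h x))\<^sup>2"] that by simp
  with per show ?thesis by (rule periodic_2pi_eq_0)
qed

section \<open>Sobolev embedding\<close>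

lemma int_decode_abs_ge: "real n \<le> 2 * \<bar>real_of_int (int_decode n)\<bar> + 1"
proof -
  have "int n \<le> 2 * \<bar>int_decode n\<bar> + 1"
    by (auto simp: int_decode_def sum_decode_def split: sum.splits)
  then show ?thesis by linarith
qed

text \<open>The enumeration \<open>int_decode\<close> of the integers grows like \<open>n/2\<close>
  in absolute value, so the family compares with the series of \<open>n powr (- 2 s)\<close>, which
  converges because \<open>s > 1/2\<close>.\<close>

lemma summable_inverse_sobolev_weight:
  fixes s :: real
  assumes "s > 1/2"
  shows "(\<lambda>k::int. (1 + (of_int k)\<^sup>2) powr (- s)) summable_on UNIV"
proof -
  have "summable (\<lambda>n. 16 powr s * real n powr (- (2 * s)))"
    using assms by (intro summable_mult) (simp add: summable_real_powr_iff)
  then have "summable (\<lambda>n. (1 + (real_of_int (int_decode n))\<^sup>2) powr (- s))"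
  \<comment> \<open>The comparison starts at 1: at 0 the right side is 0, because
    \<open>0 powr x = 0\<close>, while the weight there is 1.\<close>
  proof (rule summable_comparison_test'[where N = 1])
    fix n :: nat assume "n \<ge> 1"
    let ?k = "\<bar>real_of_int (int_decode n)\<bar>"
    have "(real n)\<^sup>2 \<le> (2 * ?k + 1)\<^sup>2"
      using int_decode_abs_ge by (intro power_mono) auto
    also have "\<dots> \<le> 16 * (1 + ?k\<^sup>2)"
      using zero_le_power2[of "?k - 1"] by (simp add: power2_eq_square algebra_simps)
    finally have "(real n)\<^sup>2 / 16 \<le> 1 + (real_of_int (int_decode n))\<^sup>2" by simp
    then have "(1 + (real_of_int (int_decode n))\<^sup>2) powr (- s) \<le> ((real n)\<^sup>2 / 16) powr (- s)"
      using \<open>n \<ge> 1\<close> assms by (intro powr_mono2') auto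
    also have "\<dots> = (real n)\<^sup>2 powr (- s) / 16 powr (- s)"
      by (rule powr_divide)
    also have "(real n)\<^sup>2 = real n powr 2"
      using \<open>n \<ge> 1\<close> by (simp add: powr_numeral)
    also have "(real n powr 2) powr (- s) / 16 powr (- s) = 16 powr s * real n powr (- (2 * s))"
      unfolding powr_powr by (simp add: powr_minus_divide)
    finally show "norm ((1 + (real_of_int (int_decode n))\<^sup>2) powr (- s)) \<le> 16 powr s * real n powr (- (2 * s))"
      by simp
  qed
  then have "(\<lambda>n. (1 + (real_of_int (int_decode n))\<^sup>2) powr (- s)) summable_on UNIV"
    by (subst summable_on_UNIV_nonneg_real_iff) auto
  then show ?thesis
    using summable_on_reindex_bij_betw[OF bij_int_decode, of "\<lambda>k. (1 + (of_int k)\<^sup>2) powr (- s)"] by simp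
qed

text \<open>Cauchy-Schwarz against the summable weights \<open>V\<close> bounds the sum of the
  absolute Fourier coefficients. The Fourier series then has a continuous sum \<open>g\<close> with
  the same coefficients as \<open>h\<close>, and the uniqueness theorem identifies the two, so that
  the bound passes to the values of \<open>h\<close>.\<close>

lemma sobolev_embedding:
  assumes "s > 1/2"
  obtains K where "K > 0"
    "\<And>h x. continuous_on UNIV h \<Longrightarrow> periodic_2pi h \<Longrightarrow>
       (\<lambda>k::int. (1 + (of_int k)\<^sup>2) powr s * (cmod (fourier_coeff h k))\<^sup>2) summable_on UNIV \<Longrightarrow>
       cmod (h x) \<le> K * sobolev_norm s h"
proof -
  define W where "W k = (1 + (real_of_int k)\<^sup>2) powr s" for k
  define V where "V k = (1 + (real_of_int k)\<^sup>2) powr (- s)" for k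
  have W: "W k > 0" and V: "V k > 0" and VW: "V k * W k = 1" for k
    using add_pos_nonneg[of 1 "(real_of_int k)\<^sup>2"] by (auto simp: W_def V_def simp flip: powr_add)
  have sumV: "V summable_on UNIV"
    using summable_inverse_sobolev_weight[OF assms] unfolding V_def .
  \<comment> \<open>The added 1 makes positivity evident; the constant is divided by later.\<close>
  define K where "K = sqrt (infsum V UNIV) + 1"
  have K0: "infsum V UNIV \<ge> 0" using V by (intro infsum_nonneg) (auto intro: less_imp_le)
  show thesis
  proof (rule that)
    show "K > 0" using K0 by (simp add: K_def add_nonneg_pos)
    fix h x
    assume h: "continuous_on UNIV h" and per: "periodic_2pi h"
      and "(\<lambda>k::int. (1 + (of_int k)\<^sup>2) powr s * (cmod (fourier_coeff h k))\<^sup>2) summable_on UNIV"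
    then have sumW: "(\<lambda>k. W k * (cmod (fourier_coeff h k))\<^sup>2) summable_on UNIV" by (simp add: W_def)
    define S where "S = infsum (\<lambda>k. W k * (cmod (fourier_coeff h k))\<^sup>2) UNIV"
    have norm_h: "sobolev_norm s h = sqrt S" by (simp add: sobolev_norm_def S_def W_def)
    have "S \<ge> 0"
      unfolding S_def using W by (intro infsum_nonneg mult_nonneg_nonneg) (auto intro: less_imp_le)
    have fin: "(\<Sum>k\<in>F. cmod (fourier_coeff h k)) \<le> K * sqrt S" if "finite F" for F
    proof -
      have VW': "sqrt (V k) * sqrt (W k) = 1" for k
        using VW[of k] by (simp flip: real_sqrt_mult)
      have "(\<Sum>k\<in>F. cmod (fourier_coeff h k)) = (\<Sum>k\<in>F. sqrt (V k) * (sqrt (W k) * cmod (fourier_coeff h k)))"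
        using VW' by (simp flip: mult.assoc)
      then have "(\<Sum>k\<in>F. cmod (fourier_coeff h k))\<^sup>2 \<le>
          (\<Sum>k\<in>F. (sqrt (V k))\<^sup>2) * (\<Sum>k\<in>F. (sqrt (W k) * cmod (fourier_coeff h k))\<^sup>2)"
        using Cauchy_Schwarz_ineq_sum[of "\<lambda>k. sqrt (V k)" "\<lambda>k. sqrt (W k) * cmod (fourier_coeff h k)" F] by metis
      also have "\<dots> = (\<Sum>k\<in>F. V k) * (\<Sum>k\<in>F. W k * (cmod (fourier_coeff h k))\<^sup>2)"
        using V W by (simp add: power_mult_distrib less_imp_le)
      also have "\<dots> \<le> infsum V UNIV * S"
        unfolding S_def using that sumV sumW V W K0
        by (intro mult_mono finite_sum_le_infsum sum_nonneg mult_nonneg_nonneg) (auto intro: less_imp_le)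
      finally have "(\<Sum>k\<in>F. cmod (fourier_coeff h k)) \<le> sqrt (infsum V UNIV * S)"
        by (rule real_le_rsqrt)
      also have "\<dots> \<le> K * sqrt S"
        using \<open>S \<ge> 0\<close> by (simp add: K_def real_sqrt_mult mult_right_mono)
      finally show ?thesis .
    qed
    define c where "c n = fourier_coeff h (int_decode n)" for n
    have c_le: "(\<Sum>n<N. cmod (c n)) \<le> K * sqrt S" for N
    proof -
      have "(\<Sum>n<N. cmod (c n)) = (\<Sum>k\<in>int_decode ` {..<N}. cmod (fourier_coeff h k))"
        by (subst sum.reindex) (auto simp: c_def inj_int_decode)
      then show ?thesis using fin[of "int_decode ` {..<N}"] by simp
    qed
    then have c: "summable (\<lambda>n. cmod (c n))"
      by (intro summableI_nonneg_bounded) auto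
    define g where "g x = suminf (\<lambda>n. c n * cis (of_int (int_decode n) * x))" for x
    have g: "continuous_on UNIV g" "periodic_2pi g"
      unfolding g_def by (rule trig_series_continuous[OF c] trig_series_periodic)+
    have "fourier_coeff g k = fourier_coeff h k" for k
    proof -
      have "k \<in> range int_decode" "int_decode (inv int_decode k) = k"
        using surj_int_decode by (auto simp: surj_f_inv_f)
      then show ?thesis
        unfolding g_def by (subst trig_series_fourier_coeff[OF c inj_int_decode]) (simp add: c_def)
    qed
    then have "h x - g x = 0"
      using g per by (intro fourier_uniqueness[of "\<lambda>x. h x - g x"] continuous_intros h)
        (auto simp: fourier_coeff_diff h periodic_2pi_def)
    then have "cmod (h x) = cmod (g x)" by simp
    also have "\<dots> \<le> suminf (\<lambda>n. cmod (c n * cis (of_int (int_decode n) * x)))"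
      unfolding g_def by (rule summable_norm) (simp add: norm_mult c)
    also have "\<dots> = suminf (\<lambda>n. cmod (c n))" by (simp add: norm_mult)
    also have "\<dots> \<le> K * sqrt S"
      using c c_le by (rule suminf_le_const)
    finally show "cmod (h x) \<le> K * sobolev_norm s h" by (simp add: norm_h)
  qed
qed

text \<open>Coefficients at negative frequencies vanish, so the sum over all integers in the norm
  collapses to a series over \<open>nat\<close>. Continuity of the sum supplies measurability and
  square integrability.\<close>

lemma trig_series_sobolev:
  fixes c :: "nat \<Rightarrow> complex"
  assumes c: "summable (\<lambda>n. cmod (c n))"
    and s: "summable (\<lambda>n. (1 + (real n)\<^sup>2) powr s * (cmod (c n))\<^sup>2)"
  defines "f \<equiv> \<lambda>x. suminf (\<lambda>n. c n * cis (real n * x))"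
  shows "f \<in> sobolev s"
    and "sobolev_norm s f = sqrt (suminf (\<lambda>n. (1 + (real n)\<^sup>2) powr s * (cmod (c n))\<^sup>2))"
proof -
  have f: "f = (\<lambda>x. suminf (\<lambda>n. c n * cis (of_int (int n) * x)))"
    by (simp add: f_def)
  have cont: "continuous_on A f" for A unfolding f by (rule trig_series_continuous[OF c])
  have coeff: "fourier_coeff f k = (if k \<in> range int then c (nat k) else 0)" for k
    unfolding f by (subst trig_series_fourier_coeff[OF c]) (auto simp: inv_f_f)
  define F where "F k = (1 + (real_of_int k)\<^sup>2) powr s * (cmod (fourier_coeff f k))\<^sup>2" for k
  have "(\<lambda>n. (1 + (real n)\<^sup>2) powr s * (cmod (c n))\<^sup>2) = F \<circ> int"
    by (auto simp: F_def coeff fun_eq_iff)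
  moreover have "((\<lambda>n. (1 + (real n)\<^sup>2) powr s * (cmod (c n))\<^sup>2) has_sum
      suminf (\<lambda>n. (1 + (real n)\<^sup>2) powr s * (cmod (c n))\<^sup>2)) UNIV"
    using summable_sums[OF s] by (rule sums_nonneg_imp_has_sum) auto
  ultimately have "(F has_sum suminf (\<lambda>n. (1 + (real n)\<^sup>2) powr s * (cmod (c n))\<^sup>2)) (range int)"
    by (simp add: has_sum_reindex)
  then have F: "(F has_sum suminf (\<lambda>n. (1 + (real n)\<^sup>2) powr s * (cmod (c n))\<^sup>2)) UNIV"
    by (rule has_sum_cong_neutral[THEN iffD1, rotated -1]) (auto simp: F_def coeff)
  then show "sobolev_norm s f = sqrt (suminf (\<lambda>n. (1 + (real n)\<^sup>2) powr s * (cmod (c n))\<^sup>2))"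
    unfolding sobolev_norm_def F_def[symmetric] by (simp add: infsumI)
  show "f \<in> sobolev s"
    unfolding sobolev_def
  proof (intro CollectI conjI)
    show "periodic_2pi f" unfolding f by (rule trig_series_periodic)
    show "f \<in> borel_measurable lebesgue"
      using borel_measurable_continuous_onI[OF cont[of UNIV]]
      by (intro measurable_completion) simp
    show "set_integrable lebesgue {0..2*pi} (\<lambda>x. (cmod (f x))\<^sup>2)"
      by (intro absolutely_integrable_continuous_real continuous_intros cont)
    show "(\<lambda>k::int. (1 + (of_int k)\<^sup>2) powr s * (cmod (fourier_coeff f k))\<^sup>2) summable_on UNIV"
      using F unfolding F_def summable_on_def by blast
  qed
qed

section \<open>The series is a solution\<close>

text \<open>The M-test gives the uniform convergence of the differentiated series that termwise
  differentiation asks for. The general theorem yields some sum function \<open>g\<close>; it agrees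
  with \<open>suminf\<close> on the open set \<open>S\<close>, so the derivative transfers.\<close>

lemma has_vector_derivative_series:
  fixes f :: "nat \<Rightarrow> real \<Rightarrow> 'b::banach"
  assumes S: "open S" "convex S"
    and f: "\<And>n x. x \<in> S \<Longrightarrow> (f n has_vector_derivative f' n x) (at x)"
    and M: "\<And>n x. x \<in> S \<Longrightarrow> norm (f' n x) \<le> M n" "summable M"
    and sum: "\<And>x. x \<in> S \<Longrightarrow> summable (\<lambda>n. f n x)" and x: "x \<in> S"
  shows "((\<lambda>x. suminf (\<lambda>n. f n x)) has_vector_derivative suminf (\<lambda>n. f' n x)) (at x)"
proof -
  have ul: "uniform_limit S (\<lambda>N x. \<Sum>n<N. f' n x) (\<lambda>x. suminf (\<lambda>n. f' n x)) sequentially"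
    by (rule Weierstrass_m_test[OF M])
  have "\<exists>g. \<forall>x\<in>S. (\<lambda>n. f n x) sums (g x) \<and>
      (g has_derivative (\<lambda>h. h *\<^sub>R suminf (\<lambda>n. f' n x))) (at x within S)"
  proof (rule has_derivative_series[where f' = "\<lambda>n x h. h *\<^sub>R f' n x"])
    show "(f n has_derivative (\<lambda>h. h *\<^sub>R f' n x)) (at x within S)" if "x \<in> S" for n x
      using has_vector_derivative_at_within[OF f[OF that]] by (simp add: has_vector_derivative_def)
    show "\<forall>\<^sub>F N in sequentially. \<forall>x\<in>S. \<forall>h. norm ((\<Sum>n<N. h *\<^sub>R f' n x) - h *\<^sub>R suminf (\<lambda>n. f' n x)) \<le> e * norm h"
      if "e > 0" for e
      using uniform_limitD[OF ul that]
    proof eventually_elim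
      case (elim N)
      show ?case
      proof (intro ballI allI)
        fix x :: real and h :: real assume "x \<in> S"
        then have "norm ((\<Sum>n<N. f' n x) - suminf (\<lambda>n. f' n x)) \<le> e"
          using elim by (auto simp: dist_norm intro: less_imp_le)
        from mult_left_mono[OF this abs_ge_zero[of h]]
        show "norm ((\<Sum>n<N. h *\<^sub>R f' n x) - h *\<^sub>R suminf (\<lambda>n. f' n x)) \<le> e * norm h"
          unfolding scaleR_sum_right[symmetric] scaleR_diff_right[symmetric] norm_scaleR
          by (simp add: mult.commute)
      qed
    qed
    show "(\<lambda>n. f n x) sums suminf (\<lambda>n. f n x)" using sum[OF x] by (rule summable_sums)
  qed (use S x in auto)
  then obtain g where g: "\<And>x. x \<in> S \<Longrightarrow> (\<lambda>n. f n x) sums g x"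
    "\<And>x. x \<in> S \<Longrightarrow> (g has_derivative (\<lambda>h. h *\<^sub>R suminf (\<lambda>n. f' n x))) (at x within S)"
    by blast
  have "(g has_vector_derivative suminf (\<lambda>n. f' n x)) (at x)"
    using g(2)[OF x] unfolding has_vector_derivative_def at_within_open[OF x S(1)] .
  then show ?thesis
  proof (rule has_vector_derivative_transform_within_open[OF _ \<open>open S\<close> x])
    show "g y = suminf (\<lambda>n. f n y)" if "y \<in> S" for y
      using g(1)[OF that] by (simp add: sums_iff)
  qed
qed

lemma has_vector_derivative_cis_linear:
  "((\<lambda>x. cis (c * x)) has_vector_derivative \<i> * of_real c * cis (c * x)) (at x)"
proof -
  have "((\<lambda>z. exp (\<i> * of_real c * z)) has_field_derivative \<i> * of_real c * exp (\<i> * of_real c * of_real x)) (at (of_real x))"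
    by (auto intro!: derivative_eq_intros)
  then have "((\<lambda>x. exp (\<i> * of_real c * of_real x)) has_vector_derivative \<i> * of_real c * exp (\<i> * of_real c * of_real x)) (at x)"
    by (rule has_vector_derivative_real_field)
  then show ?thesis by (simp add: cis_conv_exp mult_ac)
qed

lemma trig_series_has_vector_derivative:
  fixes c :: "nat \<Rightarrow> complex"
  assumes "summable (\<lambda>n. cmod (c n))" "summable (\<lambda>n. cmod (\<i> * of_nat n * c n))"
  shows "((\<lambda>x. suminf (\<lambda>n. c n * cis (real n * x))) has_vector_derivative
     suminf (\<lambda>n. \<i> * of_nat n * c n * cis (real n * x))) (at x)"
proof (rule has_vector_derivative_series[where S = UNIV])
  show "((\<lambda>x. c n * cis (real n * x)) has_vector_derivative \<i> * of_nat n * c n * cis (real n * x)) (at x)" for n x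
    using has_vector_derivative_mult_right[OF has_vector_derivative_cis_linear, of "c n" "real n" x] by (simp add: mult_ac)
  show "summable (\<lambda>n. c n * cis (real n * x))" for x
    by (rule summable_norm_cancel) (simp add: norm_mult assms)
  show "norm (\<i> * of_nat n * c n * cis (real n * x)) \<le> cmod (\<i> * of_nat n * c n)" for n x
    by (simp add: norm_mult)
qed (use assms in auto)

text \<open>The majorants live away from t = 0 and may blow up there. Continuity is local, so around
  time \<open>t\<close> the region of times above \<open>t/2\<close> suffices.\<close>

lemma trig_series_jointly_continuous:
  fixes c :: "nat \<Rightarrow> real \<Rightarrow> complex"
  assumes c: "\<And>n. continuous_on {0<..} (c n)"
    and M: "\<And>\<eta>. \<eta> > 0 \<Longrightarrow> \<exists>M. summable M \<and> (\<forall>n. \<forall>t\<ge>\<eta>. cmod (c n t) \<le> M n)"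
  shows "continuous_on (UNIV \<times> {0<..}) (\<lambda>(x, t). suminf (\<lambda>n. c n t * cis (real n * x)))"
proof -
  have op: "open (UNIV \<times> {0<..} :: (real \<times> real) set)" by (intro open_Times) auto
  have "isCont (\<lambda>(x, t). suminf (\<lambda>n. c n t * cis (real n * x))) p" if p: "p \<in> UNIV \<times> {0<..}" for p :: "real \<times> real"
  proof -
    obtain x t where xt: "p = (x, t)" "t > 0" using p by auto
    define S where "S = (UNIV :: real set) \<times> {t/2<..}"
    have "open S" unfolding S_def by (intro open_Times) auto
    obtain M where M: "summable M" "\<And>n \<tau>. \<tau> \<ge> t/2 \<Longrightarrow> cmod (c n \<tau>) \<le> M n"
      using M[of "t/2"] xt by auto
    have c': "continuous_on S (\<lambda>p. c n (snd p))" for n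
      by (rule continuous_on_compose2[OF c]) (use xt in \<open>auto simp: S_def intro!: continuous_intros\<close>)
    have "uniform_limit S (\<lambda>N p. \<Sum>n<N. c n (snd p) * cis (real n * fst p))
        (\<lambda>p. suminf (\<lambda>n. c n (snd p) * cis (real n * fst p))) sequentially"
      by (rule Weierstrass_m_test[OF _ M(1)]) (use M(2) in \<open>auto simp: S_def norm_mult\<close>)
    then have "continuous_on S (\<lambda>p. suminf (\<lambda>n. c n (snd p) * cis (real n * fst p)))"
      by (rule uniform_limit_theorem[rotated]) (auto intro!: always_eventually continuous_intros c')
    moreover have "p \<in> S" using xt by (simp add: S_def)
    ultimately have "isCont (\<lambda>p. suminf (\<lambda>n. c n (snd p) * cis (real n * fst p))) p"
      using \<open>open S\<close> by (simp add: continuous_on_eq_continuous_at)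
    then show ?thesis by (simp only: case_prod_beta')
  qed
  then show ?thesis using op by (simp add: continuous_on_eq_continuous_at)
qed

text \<open>Right side of the ordinary differential equation for the \<open>n\<close>-th mode, of
  which \<open>mode_duhamel\<close> is the integrated form.\<close>

definition mode_deriv :: "real \<Rightarrow> real \<Rightarrow> (nat \<Rightarrow> complex) \<Rightarrow> nat \<Rightarrow> real \<Rightarrow> complex" where
  "mode_deriv \<nu> \<alpha> a0 n t = - rate \<nu> \<alpha> (n^2, n^3) * mode \<nu> \<alpha> a0 n t +
     3 * \<i> * of_nat n * (\<Sum>m\<in>{1..<n}. mode \<nu> \<alpha> a0 m t * mode \<nu> \<alpha> a0 (n - m) t)"

lemma mode_has_vector_derivative:
  assumes "\<nu> > 0" "t > 0"
  shows "(mode \<nu> \<alpha> a0 n has_vector_derivative mode_deriv \<nu> \<alpha> a0 n t) (at t)"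
proof (cases "n = 0")
  case True
  then have "mode \<nu> \<alpha> a0 n = (\<lambda>t. 0)" by (simp add: mode_def fun_eq_iff)
  then show ?thesis using True by (simp add: mode_deriv_def)
next
  case False
  define r where "r = rate \<nu> \<alpha> (n^2, n^3)"
  define g where "g \<tau> = (\<Sum>m\<in>{1..<n}. mode \<nu> \<alpha> a0 m \<tau> * mode \<nu> \<alpha> a0 (n - m) \<tau>)" for \<tau>
  define I where "I t = integral {0..t} (\<lambda>\<tau>. exp (r * of_real \<tau>) * g \<tau>)" for t
  have m: "mode \<nu> \<alpha> a0 n = (\<lambda>t. exp (- r * of_real t) * (a0 n + 3 * \<i> * of_nat n * I t))"
    using False by (simp add: fun_eq_iff mode_duhamel r_def g_def I_def)
  have "continuous_on {0..t + 1} (\<lambda>\<tau>. exp (r * of_real \<tau>) * g \<tau>)"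
    unfolding g_def by (intro continuous_intros continuous_on_subset[OF mode_continuous[OF \<open>\<nu> > 0\<close>]]) auto
  then have "(I has_vector_derivative exp (r * of_real t) * g t) (at t within {0..t + 1})"
    unfolding I_def by (rule integral_has_vector_derivative) (use \<open>t > 0\<close> in auto)
  then have I: "(I has_vector_derivative exp (r * of_real t) * g t) (at t)"
    using \<open>t > 0\<close> by (subst (asm) at_within_interior) auto
  have "((\<lambda>z. exp (- r * z)) has_field_derivative - r * exp (- r * of_real t)) (at (of_real t))"
    by (auto intro!: derivative_eq_intros)
  then have E: "((\<lambda>t. exp (- r * of_real t)) has_vector_derivative - r * exp (- r * of_real t)) (at t)"
    by (rule has_vector_derivative_real_field)
  have "((\<lambda>t. a0 n + 3 * \<i> * of_nat n * I t) has_vector_derivative 3 * \<i> * of_nat n * (exp (r * of_real t) * g t)) (at t)"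
    using has_vector_derivative_add[OF has_vector_derivative_const has_vector_derivative_mult_right[OF I], of "a0 n" "3 * \<i> * of_nat n"]
    by simp
  from has_vector_derivative_mult[OF E this]
  have "(mode \<nu> \<alpha> a0 n has_vector_derivative
      exp (- r * of_real t) * (3 * \<i> * of_nat n * (exp (r * of_real t) * g t)) +
      - r * exp (- r * of_real t) * (a0 n + 3 * \<i> * of_nat n * I t)) (at t)"
    unfolding m .
  moreover have "exp (- r * of_real t) * (3 * \<i> * of_nat n * (exp (r * of_real t) * g t)) = 3 * \<i> * of_nat n * g t"
  proof -
    have "exp (- r * of_real t) * exp (r * of_real t) = 1" by (simp flip: exp_add)
    then show ?thesis by (simp add: mult_ac)
  qed
  moreover have "- r * exp (- r * of_real t) * (a0 n + 3 * \<i> * of_nat n * I t) = - r * mode \<nu> \<alpha> a0 n t"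
    by (simp add: m)
  ultimately have "(mode \<nu> \<alpha> a0 n has_vector_derivative 3 * \<i> * of_nat n * g t + - r * mode \<nu> \<alpha> a0 n t) (at t)"
    by (simp only:)
  then show ?thesis
    by (simp add: mode_deriv_def r_def g_def add.commute)
qed

text \<open>Coefficient form of \<open>2 u u_x = (u^2)_x\<close>: exchanging \<open>m\<close> and
  \<open>n - m\<close> replaces the weight \<open>n - m\<close> by its average \<open>n/2\<close>.
  This accounts for the 3 in the recursion against the 6 in the equation; \<open>a 0 = 0\<close>
  removes the two end terms.\<close>

lemma symmetric_convolution:
  fixes a :: "nat \<Rightarrow> complex"
  assumes "a 0 = 0"
  shows "2 * (\<Sum>m\<le>n. a m * (of_nat (n - m) * a (n - m))) = of_nat n * (\<Sum>m\<in>{1..<n}. a m * a (n - m))"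
proof -
  have "(\<Sum>m\<le>n. a m * (of_nat (n - m) * a (n - m))) = (\<Sum>m\<le>n. a (n - m) * (of_nat m * a m))"
    by (rule sum.reindex_bij_witness[of _ "\<lambda>m. n - m" "\<lambda>m. n - m"]) auto
  then have "2 * (\<Sum>m\<le>n. a m * (of_nat (n - m) * a (n - m))) =
      (\<Sum>m\<le>n. a m * (of_nat (n - m) * a (n - m)) + a (n - m) * (of_nat m * a m))"
    by (simp add: sum.distrib)
  also have "\<dots> = (\<Sum>m\<le>n. of_nat n * (a m * a (n - m)))"
    by (intro sum.cong) (auto simp: of_nat_diff algebra_simps)
  also have "\<dots> = of_nat n * (\<Sum>m\<le>n. a m * a (n - m))"
    by (simp add: sum_distrib_left)
  also have "(\<Sum>m\<le>n. a m * a (n - m)) = (\<Sum>m\<in>{1..<n}. a m * a (n - m))"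
    by (rule sum.mono_neutral_right) (use assms in \<open>auto simp: not_less not_le Suc_le_eq\<close>)
  finally show ?thesis .
qed

text \<open>For fixed data, the assumed exponential bound supplies all majorants at positive times.
  The behaviour at t = 0 enters separately, through the majorant \<open>B\<close> of the last
  lemma.\<close>

context
  fixes \<nu> \<alpha> :: real and a0 :: "nat \<Rightarrow> complex"
  assumes nu: "\<nu> > 0"
    and decay: "\<And>\<eta>. \<eta> > 0 \<Longrightarrow> \<exists>K>0. \<forall>n. \<forall>t\<ge>\<eta>. cmod (mode \<nu> \<alpha> a0 n t) \<le> K * exp (- (\<nu> * n * t / 2))"
begin

text \<open>The factor \<open>(\<i> n)^j\<close> stands for \<open>j\<close> derivatives in
  \<open>x\<close>; exponential decay in \<open>n\<close> dominates every power of
  \<open>n\<close>.\<close>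

lemma mode_times_power_majorant:
  assumes "\<eta> > 0"
  shows "\<exists>M. summable M \<and> (\<forall>n. \<forall>t\<ge>\<eta>. cmod ((\<i> * of_nat n) ^ j * mode \<nu> \<alpha> a0 n t) \<le> M n)"
proof -
  define x where "x = exp (- (\<nu> * \<eta> / 2))"
  have x: "0 < x" "x < 1" using nu assms by (auto simp: x_def)
  obtain K where K: "K > 0" "\<And>n t. t \<ge> \<eta> \<Longrightarrow> cmod (mode \<nu> \<alpha> a0 n t) \<le> K * exp (- (\<nu> * n * t / 2))"
    using decay[OF assms] by blast
  show ?thesis
  proof (intro exI[of _ "\<lambda>n. K * (real (Suc n) ^ j * x ^ n)"] conjI allI impI)
    show "summable (\<lambda>n. K * (real (Suc n) ^ j * x ^ n))"
      by (intro summable_mult summable_power_times_geometric x)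
    fix n :: nat and t :: real assume t: "t \<ge> \<eta>"
    have xn: "exp (- (\<nu> * n * t / 2)) \<le> x ^ n"
    proof -
      have "x ^ n = exp (- (\<nu> * n * \<eta> / 2))"
        by (simp add: x_def flip: exp_of_nat_mult)
      then show ?thesis using t nu by (simp add: mult_left_mono)
    qed
    have "cmod ((\<i> * of_nat n) ^ j * mode \<nu> \<alpha> a0 n t) = real n ^ j * cmod (mode \<nu> \<alpha> a0 n t)"
      by (simp add: norm_mult norm_power)
    also have "\<dots> \<le> real (Suc n) ^ j * (K * x ^ n)"
    proof (intro mult_mono power_mono)
      show "cmod (mode \<nu> \<alpha> a0 n t) \<le> K * x ^ n"
        using K(2)[OF t, of n] mult_left_mono[OF xn, of K] K(1) by linarith
    qed auto
    finally show "cmod ((\<i> * of_nat n) ^ j * mode \<nu> \<alpha> a0 n t) \<le> K * (real (Suc n) ^ j * x ^ n)"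
      by (simp add: mult_ac)
  qed
qed

lemma mode_deriv_majorant:
  assumes "\<eta> > 0"
  shows "\<exists>M. summable M \<and> (\<forall>n. \<forall>t\<ge>\<eta>. cmod (mode_deriv \<nu> \<alpha> a0 n t) \<le> M n)"
proof -
  define x where "x = exp (- (\<nu> * \<eta> / 2))"
  have x: "0 < x" "x < 1" using nu assms by (auto simp: x_def)
  obtain K where K: "K > 0" "\<And>n t. t \<ge> \<eta> \<Longrightarrow> cmod (mode \<nu> \<alpha> a0 n t) \<le> K * exp (- (\<nu> * n * t / 2))"
    using decay[OF assms] by blast
  \<comment> \<open>The first summand comes from the rate, of order \<open>n^3\<close>; the second
    from the convolution, with at most \<open>n\<close> terms and the prefactor
    \<open>3 n\<close>.\<close>
  define C where "C = (\<nu> + \<bar>\<alpha>\<bar>) * K + 3 * K\<^sup>2"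
  show ?thesis
  proof (intro exI[of _ "\<lambda>n. C * (real (Suc n) ^ 3 * x ^ n)"] conjI allI impI)
    show "summable (\<lambda>n. C * (real (Suc n) ^ 3 * x ^ n))"
      by (intro summable_mult summable_power_times_geometric x)
    fix n :: nat and t :: real assume t: "t \<ge> \<eta>"
    define E where "E = exp (- (\<nu> * n * t / 2))"
    have xn: "E \<le> x ^ n"
    proof -
      have "x ^ n = exp (- (\<nu> * n * \<eta> / 2))"
        by (simp add: x_def flip: exp_of_nat_mult)
      then show ?thesis using t nu by (simp add: E_def mult_left_mono)
    qed
    let ?N = "real (Suc n) ^ 3"
    have N: "real n ^ 2 \<le> ?N" "real n ^ 3 \<le> ?N"
    proof -
      have "real n ^ 2 \<le> real (Suc n) ^ 2" by (intro power_mono) auto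
      also have "\<dots> \<le> ?N" by (intro power_increasing) auto
      finally show "real n ^ 2 \<le> ?N" .
      show "real n ^ 3 \<le> ?N" by (intro power_mono) auto
    qed
    have "cmod (rate \<nu> \<alpha> (n^2, n^3)) \<le> cmod (of_real \<nu> * of_nat (n^2)) + cmod (\<i> * of_real \<alpha> * of_nat (n^3))"
      unfolding rate_def fst_conv snd_conv by (rule norm_triangle_ineq4)
    also have "\<dots> = \<nu> * real n ^ 2 + \<bar>\<alpha>\<bar> * real n ^ 3"
      using nu by (simp add: norm_mult norm_power)
    also have "\<dots> \<le> (\<nu> + \<bar>\<alpha>\<bar>) * ?N"
      using N nu by (simp only: distrib_right) (intro add_mono mult_left_mono; simp)
    finally have rate: "cmod (rate \<nu> \<alpha> (n^2, n^3)) \<le> (\<nu> + \<bar>\<alpha>\<bar>) * ?N" .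
    have "cmod (\<Sum>m\<in>{1..<n}. mode \<nu> \<alpha> a0 m t * mode \<nu> \<alpha> a0 (n - m) t) \<le> (\<Sum>m\<in>{1..<n}. K\<^sup>2 * E)"
    proof (rule sum_norm_le)
      fix m assume m: "m \<in> {1..<n}"
      have "cmod (mode \<nu> \<alpha> a0 m t * mode \<nu> \<alpha> a0 (n - m) t) \<le>
          (K * exp (- (\<nu> * m * t / 2))) * (K * exp (- (\<nu> * (n - m) * t / 2)))"
        unfolding norm_mult using K(1) by (intro mult_mono K(2) t) auto
      also have "\<dots> = K\<^sup>2 * (exp (- (\<nu> * m * t / 2)) * exp (- (\<nu> * real (n - m) * t / 2)))"
        by (simp add: power2_eq_square)
      \<comment> \<open>The exponents of the two factors add up to that of mode \<open>n\<close>, so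
        the convolution decays like a single mode.\<close>
      also have "exp (- (\<nu> * m * t / 2)) * exp (- (\<nu> * real (n - m) * t / 2)) = E"
        unfolding E_def exp_add[symmetric] using m by (simp add: of_nat_diff algebra_simps)
      finally show "cmod (mode \<nu> \<alpha> a0 m t * mode \<nu> \<alpha> a0 (n - m) t) \<le> K\<^sup>2 * E" .
    qed
    also have "\<dots> \<le> real n * (K\<^sup>2 * E)" by (simp add: E_def mult_right_mono)
    finally have conv: "cmod (\<Sum>m\<in>{1..<n}. mode \<nu> \<alpha> a0 m t * mode \<nu> \<alpha> a0 (n - m) t) \<le> real n * (K\<^sup>2 * E)" .
    have "cmod (mode_deriv \<nu> \<alpha> a0 n t) \<le> cmod (rate \<nu> \<alpha> (n^2, n^3)) * cmod (mode \<nu> \<alpha> a0 n t) +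
        3 * real n * cmod (\<Sum>m\<in>{1..<n}. mode \<nu> \<alpha> a0 m t * mode \<nu> \<alpha> a0 (n - m) t)"
      unfolding mode_deriv_def by (rule order_trans[OF norm_triangle_ineq]) (simp add: norm_mult)
    also have "\<dots> \<le> (\<nu> + \<bar>\<alpha>\<bar>) * ?N * (K * E) + 3 * real n * (real n * (K\<^sup>2 * E))"
      using K(2)[OF t, of n] nu by (intro add_mono mult_mono rate conv) (auto simp: E_def)
    also have "\<dots> = (\<nu> + \<bar>\<alpha>\<bar>) * K * ?N * E + 3 * K\<^sup>2 * (real n)\<^sup>2 * E"
      by (simp add: power2_eq_square mult_ac)
    also have "\<dots> \<le> (\<nu> + \<bar>\<alpha>\<bar>) * K * ?N * E + 3 * K\<^sup>2 * ?N * E"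
      using N by (intro add_left_mono mult_right_mono mult_left_mono) (auto simp: E_def)
    also have "\<dots> = C * ?N * E" by (simp add: C_def algebra_simps)
    also have "\<dots> \<le> C * ?N * x ^ n"
      using xn nu K(1) by (intro mult_left_mono) (auto simp: C_def)
    finally show "cmod (mode_deriv \<nu> \<alpha> a0 n t) \<le> C * (?N * x ^ n)" by (simp add: mult_ac)
  qed
qed

lemma mode_power_summable:
  assumes "t > 0"
  shows "summable (\<lambda>n. cmod ((\<i> * of_nat n) ^ j * mode \<nu> \<alpha> a0 n t))"
proof -
  obtain M where "summable M" "\<And>n. cmod ((\<i> * of_nat n) ^ j * mode \<nu> \<alpha> a0 n t) \<le> M n"
    using mode_times_power_majorant[OF assms, of j] by blast
  then show ?thesis by (auto intro: summable_comparison_test')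
qed

lemma mode_deriv_summable:
  assumes "t > 0"
  shows "summable (\<lambda>n. cmod (mode_deriv \<nu> \<alpha> a0 n t))"
proof -
  obtain M where "summable M" "\<And>n. cmod (mode_deriv \<nu> \<alpha> a0 n t) \<le> M n"
    using mode_deriv_majorant[OF assms] by blast
  then show ?thesis by (auto intro: summable_comparison_test')
qed

text \<open>All frequencies are nonnegative, so \<open>u u_x\<close> is a Cauchy product and each
  coefficient of the equation is a finite sum. It vanishes by the definition of
  \<open>mode_deriv\<close> together with \<open>symmetric_convolution\<close>.\<close>

lemma mode_series_equation:
  assumes "t > 0"
  defines "D \<equiv> \<lambda>j x. suminf (\<lambda>n. (\<i> * of_nat n) ^ j * mode \<nu> \<alpha> a0 n t * cis (real n * x))"
  shows "suminf (\<lambda>n. mode_deriv \<nu> \<alpha> a0 n t * cis (real n * x)) - 6 * D 0 x * D 1 x + of_real \<alpha> * D 3 x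
    - of_real \<nu> * D 2 x = 0"
proof -
  define a where "a n = mode \<nu> \<alpha> a0 n t" for n
  define e where "e n = cis (real n * x)" for n
  have e: "e m * e (n - m) = e n" if "m \<le> n" for m n
    using that by (simp add: e_def cis_mult of_nat_diff algebra_simps)
  have sum: "summable (\<lambda>n. norm ((\<i> * of_nat n) ^ j * a n * e n))" for j
    using mode_power_summable[OF assms(1), of j] by (simp add: norm_mult a_def e_def)
  have D: "(\<lambda>n. (\<i> * of_nat n) ^ j * a n * e n) sums D j x" for j
    unfolding D_def a_def[symmetric] e_def[symmetric]
    using summable_norm_cancel[OF sum] by (rule summable_sums)
  have "summable (\<lambda>n. norm (mode_deriv \<nu> \<alpha> a0 n t * e n))"
    using mode_deriv_summable[OF assms(1)] by (simp add: norm_mult e_def)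
  from summable_sums[OF summable_norm_cancel[OF this]]
  have T: "(\<lambda>n. mode_deriv \<nu> \<alpha> a0 n t * e n) sums suminf (\<lambda>n. mode_deriv \<nu> \<alpha> a0 n t * e n)" .
  have D_eq: "suminf (\<lambda>n. (\<i> * of_nat n) ^ j * a n * e n) = D j x" for j
    using D[of j] by (simp add: sums_iff)
  have "(\<lambda>n. \<Sum>m\<le>n. (\<i> * of_nat m) ^ 0 * a m * e m * ((\<i> * of_nat (n - m)) ^ 1 * a (n - m) * e (n - m)))
      sums (suminf (\<lambda>n. (\<i> * of_nat n) ^ 0 * a n * e n) * suminf (\<lambda>n. (\<i> * of_nat n) ^ 1 * a n * e n))"
    by (rule Cauchy_product_sums[OF sum sum])
  moreover have "(\<Sum>m\<le>n. (\<i> * of_nat m) ^ 0 * a m * e m * ((\<i> * of_nat (n - m)) ^ 1 * a (n - m) * e (n - m))) =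
      \<i> * (\<Sum>m\<le>n. a m * (of_nat (n - m) * a (n - m))) * e n" for n
    unfolding sum_distrib_left sum_distrib_right
    by (intro sum.cong refl) (simp add: e[symmetric] mult_ac)
  ultimately have P: "(\<lambda>n. \<i> * (\<Sum>m\<le>n. a m * (of_nat (n - m) * a (n - m))) * e n) sums (D 0 x * D 1 x)"
    unfolding D_eq by simp
  have "(\<lambda>n. mode_deriv \<nu> \<alpha> a0 n t * e n - 6 * (\<i> * (\<Sum>m\<le>n. a m * (of_nat (n - m) * a (n - m))) * e n)
      + of_real \<alpha> * ((\<i> * of_nat n) ^ 3 * a n * e n) - of_real \<nu> * ((\<i> * of_nat n) ^ 2 * a n * e n)) sums
     (suminf (\<lambda>n. mode_deriv \<nu> \<alpha> a0 n t * e n) - 6 * (D 0 x * D 1 x) + of_real \<alpha> * D 3 x - of_real \<nu> * D 2 x)"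
    by (intro sums_add sums_diff sums_mult T P D)
  moreover have "mode_deriv \<nu> \<alpha> a0 n t * e n - 6 * (\<i> * (\<Sum>m\<le>n. a m * (of_nat (n - m) * a (n - m))) * e n)
      + of_real \<alpha> * ((\<i> * of_nat n) ^ 3 * a n * e n) - of_real \<nu> * ((\<i> * of_nat n) ^ 2 * a n * e n) = 0" for n
  proof -
    have "a 0 = 0" by (simp add: a_def mode_def)
    define S where "S = (\<Sum>m\<in>{1..<n}. a m * a (n - m))"
    have "6 * (\<i> * (\<Sum>m\<le>n. a m * (of_nat (n - m) * a (n - m))) * e n) =
        3 * \<i> * (2 * (\<Sum>m\<le>n. a m * (of_nat (n - m) * a (n - m)))) * e n"
      by (simp add: mult_ac)
    also have "\<dots> = 3 * \<i> * (of_nat n * S) * e n"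
      unfolding symmetric_convolution[of a n, OF \<open>a 0 = 0\<close>] S_def ..
    finally have c: "6 * (\<i> * (\<Sum>m\<le>n. a m * (of_nat (n - m) * a (n - m))) * e n) = 3 * \<i> * of_nat n * S * e n"
      by (simp add: mult_ac)
    have d: "mode_deriv \<nu> \<alpha> a0 n t = - (of_real \<nu> * of_nat n ^ 2 - \<i> * of_real \<alpha> * of_nat n ^ 3) * a n
        + 3 * \<i> * of_nat n * S"
      by (simp add: mode_deriv_def rate_def a_def S_def)
    have i: "\<i> ^ 3 = - \<i>" by (simp add: power3_eq_cube)
    show ?thesis unfolding c d by (simp add: power_mult_distrib i algebra_simps)
  qed
  ultimately have "(\<lambda>n. 0) sums
     (suminf (\<lambda>n. mode_deriv \<nu> \<alpha> a0 n t * e n) - 6 * (D 0 x * D 1 x) + of_real \<alpha> * D 3 x - of_real \<nu> * D 2 x)"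
    by simp
  then show ?thesis by (simp add: sums_iff e_def mult.assoc)
qed

lemma mode_series_classical:
  "kdvb_classical \<nu> \<alpha> (\<lambda>x t. suminf (\<lambda>n. mode \<nu> \<alpha> a0 n t * cis (real n * x)))"
proof -
  let ?D = "\<lambda>j x t. suminf (\<lambda>n. (\<i> * of_nat n) ^ j * mode \<nu> \<alpha> a0 n t * cis (real n * x))"
  let ?ut = "\<lambda>x t. suminf (\<lambda>n. mode_deriv \<nu> \<alpha> a0 n t * cis (real n * x))"
  have u: "(\<lambda>x t. suminf (\<lambda>n. mode \<nu> \<alpha> a0 n t * cis (real n * x))) = ?D 0" by simp
  have dx: "((\<lambda>y. ?D j y t) has_vector_derivative ?D (Suc j) x t) (at x)" if "t > 0" for j x t
    using trig_series_has_vector_derivative[of "\<lambda>n. (\<i> * of_nat n) ^ j * mode \<nu> \<alpha> a0 n t" x]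
      mode_power_summable[OF that, of j] mode_power_summable[OF that, of "Suc j"]
    by (simp add: mult.assoc)
  have dt: "((\<lambda>\<tau>. ?D 0 x \<tau>) has_vector_derivative ?ut x t) (at t)" if "t > 0" for x t
  proof -
    obtain M where M: "summable M" "\<And>n \<tau>. \<tau> \<ge> t/2 \<Longrightarrow> cmod (mode_deriv \<nu> \<alpha> a0 n \<tau>) \<le> M n"
      using mode_deriv_majorant[of "t/2"] \<open>t > 0\<close> by auto
    have "((\<lambda>\<tau>. suminf (\<lambda>n. mode \<nu> \<alpha> a0 n \<tau> * cis (real n * x))) has_vector_derivative ?ut x t) (at t)"
    proof (rule has_vector_derivative_series[where S = "{t/2<..}", OF _ _ _ _ M(1)])
      fix n \<tau> assume \<tau>: "\<tau> \<in> {t/2<..}"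
      show "((\<lambda>\<tau>. mode \<nu> \<alpha> a0 n \<tau> * cis (real n * x)) has_vector_derivative mode_deriv \<nu> \<alpha> a0 n \<tau> * cis (real n * x)) (at \<tau>)"
        using \<tau> \<open>t > 0\<close> by (intro has_vector_derivative_mult_left mode_has_vector_derivative nu) auto
      show "norm (mode_deriv \<nu> \<alpha> a0 n \<tau> * cis (real n * x)) \<le> M n"
        using M(2)[of \<tau> n] \<tau> by (simp add: norm_mult)
    next
      fix \<tau> assume "\<tau> \<in> {t/2<..}"
      then have "summable (\<lambda>n. cmod ((\<i> * of_nat n) ^ 0 * mode \<nu> \<alpha> a0 n \<tau>))"
        using \<open>t > 0\<close> by (intro mode_power_summable) auto
      then show "summable (\<lambda>n. mode \<nu> \<alpha> a0 n \<tau> * cis (real n * x))"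
        by (intro summable_norm_cancel[of "\<lambda>n. mode \<nu> \<alpha> a0 n \<tau> * cis (real n * x)"]) (simp add: norm_mult)
    qed (use that in auto)
    then show ?thesis by simp
  qed
  have cont: "continuous_on {0<..} (mode \<nu> \<alpha> a0 n)" for n
    by (rule continuous_on_subset[OF mode_continuous[OF nu]]) auto
  have cD: "continuous_on (UNIV \<times> {0<..}) (\<lambda>(x, t). ?D j x t)" for j
    by (rule trig_series_jointly_continuous)
       (intro continuous_intros cont, rule mode_times_power_majorant)
  have ct: "continuous_on (UNIV \<times> {0<..}) (\<lambda>(x, t). ?ut x t)"
    by (rule trig_series_jointly_continuous)
       (unfold mode_deriv_def, intro continuous_intros cont,
        fold mode_deriv_def, rule mode_deriv_majorant)
  have j: "Suc 0 = 1" "Suc 1 = 2" "Suc 2 = (3::nat)" by simp_all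
  show ?thesis
    unfolding u kdvb_classical_def
  proof (rule exI[of _ ?ut], rule exI[of _ "?D 1"], rule exI[of _ "?D 2"], rule exI[of _ "?D 3"],
      intro conjI allI impI)
    fix x t :: real assume t: "t > 0"
    show "((\<lambda>\<tau>. ?D 0 x \<tau>) has_vector_derivative ?ut x t) (at t)" by (rule dt[OF t])
    show "((\<lambda>y. ?D 0 y t) has_vector_derivative ?D 1 x t) (at x)"
      using dx[OF t, of 0 x] unfolding j(1) .
    show "((\<lambda>y. ?D 1 y t) has_vector_derivative ?D 2 x t) (at x)"
      using dx[OF t, of 1 x] unfolding j(2) .
    show "((\<lambda>y. ?D 2 y t) has_vector_derivative ?D 3 x t) (at x)"
      using dx[OF t, of 2 x] unfolding j(3) .
    show "?ut x t - 6 * ?D 0 x t * ?D 1 x t + of_real \<alpha> * ?D 3 x t - of_real \<nu> * ?D 2 x t = 0"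
      by (rule mode_series_equation[OF t])
  next
    show "\<forall>w\<in>{?ut, ?D 1, ?D 2, ?D 3}. continuous_on (UNIV \<times> {0<..}) (\<lambda>(x, t). w x t)"
      using ct cD by blast
  qed
qed

text \<open>Continuity into the Sobolev space is dominated convergence for series: the squared
  distance to the state at time \<open>t\<close> is a series with terms continuous in
  \<open>\<tau>\<close> and at most \<open>4 W B^2\<close>.\<close>

lemma mode_series_global_solution:
  assumes B: "\<And>k t. t \<ge> 0 \<Longrightarrow> cmod (mode \<nu> \<alpha> a0 k t) \<le> B k" "summable B"
    "summable (\<lambda>k. (1 + (real k)\<^sup>2) powr s * (B k)\<^sup>2)"
    and u0: "\<And>x. u0 x = suminf (\<lambda>n. mode \<nu> \<alpha> a0 n 0 * cis (real n * x))"
  shows "kdvb_global_solution \<nu> \<alpha> s u0 (\<lambda>x t. suminf (\<lambda>n. mode \<nu> \<alpha> a0 n t * cis (real n * x)))"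
  unfolding kdvb_global_solution_def
proof (intro conjI allI impI)
  define W where "W k = (1 + (real k)\<^sup>2) powr s" for k
  have W: "W k \<ge> 0" for k by (simp add: W_def)
  have sum: "summable (\<lambda>k. cmod (mode \<nu> \<alpha> a0 k t))" if "t \<ge> 0" for t
    by (rule summable_comparison_test'[OF B(2)]) (use B(1)[OF that] in auto)
  show "(\<lambda>x. suminf (\<lambda>n. mode \<nu> \<alpha> a0 n t * cis (real n * x))) \<in> sobolev s" if t: "t \<ge> 0" for t
  proof (rule trig_series_sobolev(1)[OF sum[OF t]])
    show "summable (\<lambda>k. (1 + (real k)\<^sup>2) powr s * (cmod (mode \<nu> \<alpha> a0 k t))\<^sup>2)"
      by (rule summable_comparison_test'[OF B(3)])
         (use B(1)[OF t] in \<open>auto intro!: mult_left_mono power_mono\<close>)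
  qed
  show "((\<lambda>\<tau>. sobolev_norm s (\<lambda>x. suminf (\<lambda>n. mode \<nu> \<alpha> a0 n \<tau> * cis (real n * x)) -
      suminf (\<lambda>n. mode \<nu> \<alpha> a0 n t * cis (real n * x)))) \<longlongrightarrow> 0) (at t within {0..})" if t: "t \<ge> 0" for t
  proof -
    define d where "d n \<tau> = mode \<nu> \<alpha> a0 n \<tau> - mode \<nu> \<alpha> a0 n t" for n \<tau>
    have d: "cmod (d n \<tau>) \<le> 2 * B n" if "\<tau> \<ge> 0" for n \<tau>
      using norm_triangle_ineq4[of "mode \<nu> \<alpha> a0 n \<tau>" "mode \<nu> \<alpha> a0 n t"] B(1)[OF t, of n] B(1)[OF that, of n]
      by (simp add: d_def)
    have bd: "W n * (cmod (d n \<tau>))\<^sup>2 \<le> 4 * (W n * (B n)\<^sup>2)" if "\<tau> \<ge> 0" for n \<tau>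
    proof -
      have "(cmod (d n \<tau>))\<^sup>2 \<le> (2 * B n)\<^sup>2" using d[OF that] by (intro power_mono) auto
      from mult_left_mono[OF this W[of n]] show ?thesis by (simp add: power_mult_distrib mult_ac)
    qed
    have sB: "summable (\<lambda>n. 4 * (W n * (B n)\<^sup>2))" using B(3) by (intro summable_mult) (simp add: W_def)
    have norm_eq: "sobolev_norm s (\<lambda>x. suminf (\<lambda>n. mode \<nu> \<alpha> a0 n \<tau> * cis (real n * x)) -
      suminf (\<lambda>n. mode \<nu> \<alpha> a0 n t * cis (real n * x))) = sqrt (suminf (\<lambda>n. W n * (cmod (d n \<tau>))\<^sup>2))"
      if \<tau>: "\<tau> \<ge> 0" for \<tau>
    proof -
      have s': "summable (\<lambda>n. mode \<nu> \<alpha> a0 n r * cis (real n * x))" if "r \<ge> 0" for r x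
        by (rule summable_norm_cancel) (use sum[OF that] in \<open>simp add: norm_mult\<close>)
      have "(\<lambda>x. suminf (\<lambda>n. mode \<nu> \<alpha> a0 n \<tau> * cis (real n * x)) - suminf (\<lambda>n. mode \<nu> \<alpha> a0 n t * cis (real n * x)))
          = (\<lambda>x. suminf (\<lambda>n. d n \<tau> * cis (real n * x)))"
        by (simp add: fun_eq_iff d_def suminf_diff s' \<tau> t left_diff_distrib)
      moreover have "summable (\<lambda>n. cmod (d n \<tau>))"
        by (rule summable_comparison_test'[OF summable_mult[OF B(2), of 2]]) (use d[OF \<tau>] in auto)
      moreover have "summable (\<lambda>n. W n * (cmod (d n \<tau>))\<^sup>2)"
        by (rule summable_comparison_test'[OF sB]) (use bd[OF \<tau>] W in auto)
      ultimately show ?thesis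
        using trig_series_sobolev(2)[of "\<lambda>n. d n \<tau>" s] by (simp add: W_def)
    qed
    have "uniform_limit {0..} (\<lambda>N \<tau>. \<Sum>n<N. W n * (cmod (d n \<tau>))\<^sup>2)
        (\<lambda>\<tau>. suminf (\<lambda>n. W n * (cmod (d n \<tau>))\<^sup>2)) sequentially"
      by (rule Weierstrass_m_test[OF _ sB]) (use bd W in auto)
    then have "continuous_on {0..} (\<lambda>\<tau>. suminf (\<lambda>n. W n * (cmod (d n \<tau>))\<^sup>2))"
      by (rule uniform_limit_theorem[rotated])
         (auto simp: d_def intro!: always_eventually continuous_intros mode_continuous[OF nu])
    then have "continuous_on {0..} (\<lambda>\<tau>. sqrt (suminf (\<lambda>n. W n * (cmod (d n \<tau>))\<^sup>2)))"
      by (intro continuous_intros)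
    then have "((\<lambda>\<tau>. sqrt (suminf (\<lambda>n. W n * (cmod (d n \<tau>))\<^sup>2))) \<longlongrightarrow>
        sqrt (suminf (\<lambda>n. W n * (cmod (d n t))\<^sup>2))) (at t within {0..})"
      using t by (simp add: continuous_on_def)
    then have "((\<lambda>\<tau>. sqrt (suminf (\<lambda>n. W n * (cmod (d n \<tau>))\<^sup>2))) \<longlongrightarrow> 0) (at t within {0..})"
      by (simp add: d_def)
    then show ?thesis
      \<comment> \<open>\<open>norm_eq\<close> holds for \<open>\<tau> \<ge> 0\<close>, which is
        enough for a limit within \<open>{0..}\<close>.\<close>
      by (rule Lim_transform_eventually) (auto simp: eventually_at_filter norm_eq)
  qed
  show "suminf (\<lambda>n. mode \<nu> \<alpha> a0 n 0 * cis (real n * x)) = u0 x" for x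
    by (simp add: u0)
  show "kdvb_classical \<nu> \<alpha> (\<lambda>x t. suminf (\<lambda>n. mode \<nu> \<alpha> a0 n t * cis (real n * x)))"
    by (rule mode_series_classical)
qed

end

section \<open>Uniqueness by the energy method\<close>

lemma has_vector_derivative_periodic:
  fixes f :: "real \<Rightarrow> 'a::real_normed_vector"
  assumes f: "\<And>x. (f has_vector_derivative f' x) (at x)" and per: "\<And>x. f (x + p) = f x"
  shows "f' (x + p) = f' x"
proof -
  have "((\<lambda>y. y + p) has_vector_derivative 1) (at x)"
    by (auto intro!: derivative_eq_intros)
  from vector_diff_chain_at[OF this f] have "((f \<circ> (\<lambda>y. y + p)) has_vector_derivative f' (x + p)) (at x)"
    by simp
  moreover have "f \<circ> (\<lambda>y. y + p) = f" by (simp add: fun_eq_iff per)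
  ultimately show ?thesis
    using vector_derivative_unique_at f by metis
qed

text \<open>\<open>\<bullet>\<close> is the real inner product of the plane, which accommodates
  complex \<open>w\<close>. Subtracting the derivative of the periodic flux \<open>F\<close>, whose
  integral is 0, removes the dispersive term and leaves
  \<open>- 2 \<nu> |w1|^2 - 6 w1 \<bullet> (z w)\<close>. The derivative of \<open>z w\<close> has
  moved onto \<open>w\<close>, so \<open>z1\<close> does not appear in the bound.\<close>

lemma integral_energy_le:
  fixes w w1 w2 w3 z z1 :: "real \<Rightarrow> complex"
  assumes "\<nu> > 0"
    and d: "\<And>x. (w has_vector_derivative w1 x) (at x)" "\<And>x. (w1 has_vector_derivative w2 x) (at x)"
      "\<And>x. (w2 has_vector_derivative w3 x) (at x)" "\<And>x. (z has_vector_derivative z1 x) (at x)"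
    and cont: "continuous_on UNIV w3" "continuous_on UNIV z1"
    and per: "\<And>x. w (x + 2 * pi) = w x" "\<And>x. z (x + 2 * pi) = z x"
    and wt: "\<And>x. wt x = - of_real \<alpha> * w3 x + of_real \<nu> * w2 x + 3 * (z1 x * w x + z x * w1 x)"
    and M: "\<And>x. x \<in> {0..2*pi} \<Longrightarrow> cmod (z x) \<le> M"
  shows "integral {0..2*pi} (\<lambda>x. 2 * (w x \<bullet> wt x)) \<le> 9 * M\<^sup>2 / (2 * \<nu>) * integral {0..2*pi} (\<lambda>x. w x \<bullet> w x)"
proof -
  note ider = bounded_bilinear.has_vector_derivative[OF bounded_bilinear_inner]
  \<comment> \<open>\<open>w \<bullet> w3\<close> is the derivative of
    \<open>w \<bullet> w2 - |w1|^2 / 2\<close>, and \<open>w \<bullet> w2\<close> that of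
    \<open>w \<bullet> w1\<close> up to \<open>|w1|^2\<close>; the last term performs the
    integration by parts in the nonlinearity.\<close>
  define F where "F x = - 2 * \<alpha> * (w x \<bullet> w2 x - (1/2) * (w1 x \<bullet> w1 x)) + 2 * \<nu> * (w x \<bullet> w1 x) + 6 * (w x \<bullet> (z x * w x))" for x
  define F' where "F' x = - 2 * \<alpha> * (w x \<bullet> w3 x) + 2 * \<nu> * (w x \<bullet> w2 x + w1 x \<bullet> w1 x) +
      6 * (w x \<bullet> (z x * w1 x + z1 x * w x) + w1 x \<bullet> (z x * w x))" for x
  have w_cont: "continuous_on S w" "continuous_on S w1" "continuous_on S w2" "continuous_on S z" for S
    using has_vector_derivative_continuous d by (blast intro: continuous_at_imp_continuous_on)+
  have w3_cont: "continuous_on S w3" "continuous_on S z1" for S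
    using cont continuous_on_subset by blast+
  have FF': "(F has_vector_derivative F' x) (at x)" for x
  proof -
    have "(F has_vector_derivative (- 2 * \<alpha>) * ((w x \<bullet> w3 x + w1 x \<bullet> w2 x) - (1/2) * (w1 x \<bullet> w2 x + w2 x \<bullet> w1 x))
        + 2 * \<nu> * (w x \<bullet> w2 x + w1 x \<bullet> w1 x) +
        6 * (w x \<bullet> (z x * w1 x + z1 x * w x) + w1 x \<bullet> (z x * w x))) (at x)"
      unfolding F_def
      by (intro has_vector_derivative_add has_vector_derivative_diff has_vector_derivative_mult_right ider
          has_vector_derivative_mult d)
    then show ?thesis by (simp add: F'_def inner_commute)
  qed
  have per1: "w1 (x + 2 * pi) = w1 x" for x by (rule has_vector_derivative_periodic[OF d(1) per(1)])
  have per2: "w2 (x + 2 * pi) = w2 x" for x by (rule has_vector_derivative_periodic[OF d(2) per1])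
  have "F (2 * pi) = F 0"
    using per[of 0] per1[of 0] per2[of 0] by (simp add: F_def)
  moreover have "(F' has_integral (F (2 * pi) - F 0)) {0..2*pi}"
    by (rule fundamental_theorem_of_calculus) (auto intro: has_vector_derivative_at_within FF')
  ultimately have F'0: "(F' has_integral 0) {0..2*pi}" by simp
  have wt_cont: "continuous_on S wt" for S
  proof -
    have "continuous_on S (\<lambda>x. - of_real \<alpha> * w3 x + of_real \<nu> * w2 x + 3 * (z1 x * w x + z x * w1 x))"
      by (intro continuous_intros w_cont w3_cont)
    then show ?thesis by (simp add: wt[abs_def])
  qed
  have int: "(\<lambda>x. 2 * (w x \<bullet> wt x)) integrable_on {0..2*pi}" "(\<lambda>x. w x \<bullet> w x) integrable_on {0..2*pi}"
    by (intro integrable_continuous_interval continuous_intros w_cont wt_cont)+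
  have "((\<lambda>x. 2 * (w x \<bullet> wt x) - F' x) has_integral (integral {0..2*pi} (\<lambda>x. 2 * (w x \<bullet> wt x)) - 0)) {0..2*pi}"
    by (intro has_integral_diff integrable_integral int F'0)
  moreover have "((\<lambda>x. 9 * M\<^sup>2 / (2 * \<nu>) * (w x \<bullet> w x)) has_integral
      (9 * M\<^sup>2 / (2 * \<nu>) * integral {0..2*pi} (\<lambda>x. w x \<bullet> w x))) {0..2*pi}"
    by (intro has_integral_mult_right integrable_integral int)
  ultimately have "integral {0..2*pi} (\<lambda>x. 2 * (w x \<bullet> wt x)) - 0 \<le>
      9 * M\<^sup>2 / (2 * \<nu>) * integral {0..2*pi} (\<lambda>x. w x \<bullet> w x)"
  proof (rule has_integral_le)
    fix x assume x: "x \<in> {0..2*pi}"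
    have wt': "wt x = (- \<alpha>) *\<^sub>R w3 x + \<nu> *\<^sub>R w2 x + 3 *\<^sub>R (z1 x * w x + z x * w1 x)"
      by (simp add: wt scaleR_conv_of_real)
    have eq: "2 * (w x \<bullet> wt x) - F' x = - 2 * \<nu> * (w1 x \<bullet> w1 x) - 6 * (w1 x \<bullet> (z x * w x))"
      unfolding wt' F'_def inner_add_right inner_scaleR_right by (simp add: algebra_simps)
    define p q where "p = cmod (w1 x)" and "q = cmod (w x)"
    have "- (w1 x \<bullet> (z x * w x)) \<le> cmod (w1 x) * cmod (z x * w x)"
      using Cauchy_Schwarz_ineq2[of "w1 x" "z x * w x"] by linarith
    also have "\<dots> \<le> p * (M * q)"
      unfolding p_def q_def norm_mult by (intro mult_left_mono mult_right_mono M x) auto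
    finally have "2 * (w x \<bullet> wt x) - F' x \<le> - 2 * \<nu> * p\<^sup>2 + 6 * (p * (M * q))"
      unfolding eq p_def power2_norm_eq_inner by linarith
    also have "\<dots> \<le> 9 * M\<^sup>2 / (2 * \<nu>) * q\<^sup>2"
    proof -
      \<comment> \<open>Young's inequality, with the weight chosen to use up exactly the dissipation
        \<open>2 \<nu> p^2\<close>.\<close>
      have "0 \<le> (2 * \<nu> * p - 3 * M * q)\<^sup>2 / (2 * \<nu>)" using \<open>\<nu> > 0\<close> by simp
      also have "\<dots> = 2 * \<nu> * p\<^sup>2 - 6 * (p * (M * q)) + 9 * M\<^sup>2 / (2 * \<nu>) * q\<^sup>2"
        using \<open>\<nu> > 0\<close> by (simp add: field_simps power2_eq_square)
      finally show ?thesis by linarith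
    qed
    finally show "2 * (w x \<bullet> wt x) - F' x \<le> 9 * M\<^sup>2 / (2 * \<nu>) * (w x \<bullet> w x)"
      by (simp add: q_def power2_norm_eq_inner)
  qed
  then show ?thesis by simp
qed

text \<open>The notion of classical solution asks for joint continuity of the derivatives; that of
  \<open>u\<close> is recovered here. On a compact rectangle \<open>ut\<close> is bounded, so
  \<open>u\<close> is Lipschitz in time uniformly in \<open>x\<close>, and this combines with
  continuity in \<open>x\<close> at the single time \<open>t0\<close>.\<close>

lemma jointly_continuous_of_partials:
  fixes u :: "real \<Rightarrow> real \<Rightarrow> complex"
  assumes dt: "\<And>x t. t > 0 \<Longrightarrow> ((\<lambda>\<tau>. u x \<tau>) has_vector_derivative ut x t) (at t)"
    and dx: "\<And>x t. t > 0 \<Longrightarrow> ((\<lambda>y. u y t) has_vector_derivative ux x t) (at x)"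
    and ut: "continuous_on (UNIV \<times> {0<..}) (\<lambda>(x, t). ut x t)"
  shows "continuous_on (UNIV \<times> {0<..}) (\<lambda>(x, t). u x t)"
proof -
  have op: "open (UNIV \<times> {0<..} :: (real \<times> real) set)" by (intro open_Times) auto
  have "isCont (\<lambda>p. u (fst p) (snd p)) (x0, t0)" if t0: "t0 > 0" for x0 t0 :: real
  proof -
    define K where "K = {x0 - 1..x0 + 1} \<times> {t0/2..2 * t0}"
    have "compact K" unfolding K_def by (intro compact_Times compact_Icc)
    moreover have "continuous_on K (\<lambda>(x, t). ut x t)"
      by (rule continuous_on_subset[OF ut]) (use t0 in \<open>auto simp: K_def\<close>)
    ultimately have "bounded ((\<lambda>(x, t). ut x t) ` K)"
      by (intro compact_imp_bounded compact_continuous_image)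
    then obtain B where B: "\<And>x t. (x, t) \<in> K \<Longrightarrow> cmod (ut x t) \<le> B"
      unfolding bounded_iff by fastforce
    have le: "cmod (u x t - u x t0) \<le> B * \<bar>t - t0\<bar>" if "(x, t) \<in> K" for x t
    proof -
      have "norm (u x t - u x t0) \<le> B * norm (t - t0)"
      proof (rule differentiable_bound[where S = "{t0/2..2 * t0}" and f' = "\<lambda>s h. h *\<^sub>R ut x s"])
        fix s assume s: "s \<in> {t0/2..2 * t0}"
        have "((\<lambda>\<tau>. u x \<tau>) has_vector_derivative ut x s) (at s within {t0/2..2 * t0})"
          by (rule has_vector_derivative_at_within[OF dt]) (use s t0 in auto)
        then show "((\<lambda>\<tau>. u x \<tau>) has_derivative (\<lambda>h. h *\<^sub>R ut x s)) (at s within {t0/2..2 * t0})"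
          by (simp add: has_vector_derivative_def)
        show "onorm (\<lambda>h. h *\<^sub>R ut x s) \<le> B"
        proof (rule onorm_le)
          have "cmod (ut x s) \<le> B" using B[of x s] s that by (auto simp: K_def)
          from mult_left_mono[OF this abs_ge_zero]
          show "norm (h *\<^sub>R ut x s) \<le> B * norm h" for h :: real
            by (simp add: mult.commute)
        qed
      qed (use that t0 in \<open>auto simp: K_def\<close>)
      then show ?thesis by simp
    qed
    have nb: "eventually (\<lambda>p. p \<in> K) (at (x0, t0))"
    proof -
      have "eventually (\<lambda>p. p \<in> {x0 - 1<..<x0 + 1} \<times> {t0/2<..<2 * t0}) (at (x0, t0))"
        by (rule eventually_at_in_open'[OF open_Times]) (use t0 in auto)
      then show ?thesis by eventually_elim (auto simp: K_def)
    qed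
    have c: "isCont (\<lambda>y. u y t0) x0"
      using has_vector_derivative_continuous[OF dx[OF t0]] .
    have tf: "(fst \<longlongrightarrow> x0) (at (x0, t0))" "(snd \<longlongrightarrow> t0) (at (x0, t0))"
      using tendsto_fst[OF tendsto_ident_at[of "(x0, t0)" UNIV]] tendsto_snd[OF tendsto_ident_at[of "(x0, t0)" UNIV]]
      by simp_all
    have "((\<lambda>p. u (fst p) (snd p) - u x0 t0) \<longlongrightarrow> 0) (at (x0, t0))"
    proof (rule Lim_null_comparison)
      show "eventually (\<lambda>p. norm (u (fst p) (snd p) - u x0 t0) \<le> B * \<bar>snd p - t0\<bar> + cmod (u (fst p) t0 - u x0 t0)) (at (x0, t0))"
        using nb
      proof eventually_elim
        case (elim p)
        have "u (fst p) (snd p) - u x0 t0 = (u (fst p) (snd p) - u (fst p) t0) + (u (fst p) t0 - u x0 t0)" by simp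
        then show ?case
          using norm_triangle_ineq[of "u (fst p) (snd p) - u (fst p) t0" "u (fst p) t0 - u x0 t0"] le[of "fst p" "snd p"] elim
          by simp
      qed
      have "((\<lambda>p. B * \<bar>snd p - t0\<bar> + cmod (u (fst p) t0 - u x0 t0)) \<longlongrightarrow> B * \<bar>t0 - t0\<bar> + cmod (u x0 t0 - u x0 t0)) (at (x0, t0))"
        by (intro tendsto_intros tf isCont_tendsto_compose[OF c])
      then show "((\<lambda>p. B * \<bar>snd p - t0\<bar> + cmod (u (fst p) t0 - u x0 t0)) \<longlongrightarrow> 0) (at (x0, t0))" by simp
    qed
    then show ?thesis by (simp add: isCont_def LIM_zero_iff)
  qed
  then show ?thesis
    unfolding case_prod_beta' using op by (auto simp: continuous_on_eq_continuous_at)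
qed

lemma kdvb_global_solutionE:
  assumes "kdvb_global_solution \<nu> \<alpha> s u0 u"
  obtains ut ux uxx uxxx where
    "\<And>x t. t > 0 \<Longrightarrow> ((\<lambda>\<tau>. u x \<tau>) has_vector_derivative ut x t) (at t)"
    "\<And>x t. t > 0 \<Longrightarrow> ((\<lambda>y. u y t) has_vector_derivative ux x t) (at x)"
    "\<And>x t. t > 0 \<Longrightarrow> ((\<lambda>y. ux y t) has_vector_derivative uxx x t) (at x)"
    "\<And>x t. t > 0 \<Longrightarrow> ((\<lambda>y. uxx y t) has_vector_derivative uxxx x t) (at x)"
    "\<And>x t. t > 0 \<Longrightarrow> ut x t - 6 * u x t * ux x t + complex_of_real \<alpha> * uxxx x t
       - complex_of_real \<nu> * uxx x t = 0"
    "\<forall>w\<in>{ut, ux, uxx, uxxx}. continuous_on (UNIV \<times> {0<..}) (\<lambda>(x, t). w x t)"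
proof -
  from assms have "kdvb_classical \<nu> \<alpha> u"
    by (simp add: kdvb_global_solution_def)
  then show thesis
    unfolding kdvb_classical_def by (elim exE conjE) (rule that; blast)
qed

text \<open>The differential equation gives no information at t = 0. The embedding turns convergence
  to the data in the Sobolev norm into uniform convergence, and in this form the initial condition
  enters the energy estimate.\<close>

lemma solution_uniformly_near_data:
  assumes "s > 1/2" and u0: "continuous_on UNIV u0" and u: "kdvb_global_solution \<nu> \<alpha> s u0 u" and "\<epsilon> > 0"
  obtains \<eta> where "\<eta> > 0" "\<And>t x. 0 < t \<Longrightarrow> t < \<eta> \<Longrightarrow> cmod (u x t - u0 x) \<le> \<epsilon>"
proof -
  obtain K where K: "K > 0"
    "\<And>h x. continuous_on UNIV h \<Longrightarrow> periodic_2pi h \<Longrightarrow>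
       (\<lambda>k::int. (1 + (of_int k)\<^sup>2) powr s * (cmod (fourier_coeff h k))\<^sup>2) summable_on UNIV \<Longrightarrow>
       cmod (h x) \<le> K * sobolev_norm s h"
    by (rule sobolev_embedding[OF \<open>s > 1/2\<close>]) (rule that)
  have sob: "(\<lambda>x. u x t) \<in> sobolev s" if "t \<ge> 0" for t
    using u that by (simp add: kdvb_global_solution_def)
  have init: "u x 0 = u0 x" for x using u by (simp add: kdvb_global_solution_def)
  have sob0: "u0 \<in> sobolev s" using sob[of 0] init by simp
  have lim: "((\<lambda>\<tau>. sobolev_norm s (\<lambda>x. u x \<tau> - u0 x)) \<longlongrightarrow> 0) (at 0 within {0..})"
    using u init unfolding kdvb_global_solution_def by auto
  have "eventually (\<lambda>\<tau>. sobolev_norm s (\<lambda>x. u x \<tau> - u0 x) < \<epsilon> / K) (at 0 within {0..})"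
    using order_tendstoD(2)[OF lim, of "\<epsilon> / K"] \<open>\<epsilon> > 0\<close> K by simp
  then obtain \<eta> where \<eta>: "\<eta> > 0"
    "\<And>\<tau>. \<tau> \<in> {0..} \<Longrightarrow> \<tau> \<noteq> 0 \<Longrightarrow> dist \<tau> 0 < \<eta> \<Longrightarrow> sobolev_norm s (\<lambda>x. u x \<tau> - u0 x) < \<epsilon> / K"
    unfolding eventually_at by blast
  show thesis
  proof (rule that[OF \<eta>(1)])
    fix t x :: real assume t: "0 < t" "t < \<eta>"
    obtain ux :: "real \<Rightarrow> real \<Rightarrow> complex" where "\<And>x t. t > 0 \<Longrightarrow> ((\<lambda>y. u y t) has_vector_derivative ux x t) (at x)"
      by (rule kdvb_global_solutionE[OF u]) (rule that)
    then have cu: "continuous_on UNIV (\<lambda>x. u x t)"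
      using has_vector_derivative_continuous t by (blast intro: continuous_at_imp_continuous_on)
    have "cmod (u x t - u0 x) \<le> K * sobolev_norm s (\<lambda>x. u x t - u0 x)"
    proof (rule K(2)[where h = "\<lambda>x. u x t - u0 x"])
      show "continuous_on UNIV (\<lambda>x. u x t - u0 x)" by (intro continuous_intros cu u0)
      show "periodic_2pi (\<lambda>x. u x t - u0 x)"
        using sob[of t] sob0 t by (simp add: sobolev_def periodic_2pi_def)
      define W where "W k = (1 + (real_of_int k)\<^sup>2) powr s" for k
      have W: "W k \<ge> 0" for k by (simp add: W_def)
      have "(\<lambda>k. W k * (cmod (fourier_coeff (\<lambda>x. u x t) k))\<^sup>2) summable_on UNIV"
        "(\<lambda>k. W k * (cmod (fourier_coeff u0 k))\<^sup>2) summable_on UNIV"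
        using sob[of t] sob0 t by (simp_all add: sobolev_def W_def)
      \<comment> \<open>Summability for the difference must be shown, as \<open>infsum\<close> of a
        family that is not summable is a default value; it follows from
        \<open>(a + b)^2 \<le> 2 a^2 + 2 b^2\<close>.\<close>
      then have "(\<lambda>k. 2 * (W k * (cmod (fourier_coeff (\<lambda>x. u x t) k))\<^sup>2) + 2 * (W k * (cmod (fourier_coeff u0 k))\<^sup>2)) summable_on UNIV"
        by (intro summable_on_add summable_on_cmult_right)
      then have "(\<lambda>k. W k * (cmod (fourier_coeff (\<lambda>x. u x t - u0 x) k))\<^sup>2) summable_on UNIV"
      proof (rule summable_on_comparison_test)
        fix k
        define a b where "a = fourier_coeff (\<lambda>x. u x t) k" and "b = fourier_coeff u0 k"
        have "(cmod (a - b))\<^sup>2 \<le> (cmod a + cmod b)\<^sup>2"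
          by (intro power_mono norm_triangle_ineq4) auto
        also have "\<dots> \<le> 2 * (cmod a)\<^sup>2 + 2 * (cmod b)\<^sup>2"
          using zero_le_power2[of "cmod a - cmod b"] by (simp add: power2_eq_square algebra_simps)
        finally have "W k * (cmod (a - b))\<^sup>2 \<le> W k * (2 * (cmod a)\<^sup>2 + 2 * (cmod b)\<^sup>2)"
          using W by (intro mult_left_mono)
        then show "W k * (cmod (fourier_coeff (\<lambda>x. u x t - u0 x) k))\<^sup>2 \<le>
          2 * (W k * (cmod (fourier_coeff (\<lambda>x. u x t) k))\<^sup>2) + 2 * (W k * (cmod (fourier_coeff u0 k))\<^sup>2)"
          unfolding fourier_coeff_diff[OF cu u0] by (simp add: a_def b_def algebra_simps)
      qed (use W in auto)
      then show "(\<lambda>k::int. (1 + (of_int k)\<^sup>2) powr s * (cmod (fourier_coeff (\<lambda>x. u x t - u0 x) k))\<^sup>2) summable_on UNIV"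
        by (simp add: W_def)
    qed
    also have "\<dots> \<le> K * (\<epsilon> / K)"
      using \<eta>(2)[of t] t K(1) by (intro mult_left_mono) auto
    finally show "cmod (u x t - u0 x) \<le> \<epsilon>" using K(1) by simp
  qed
qed

text \<open>Near t = 0 the solution stays within distance 1 of the data, which are bounded on a
  period; on the remaining compact time interval joint continuity suffices. The ranges overlap, as
  the second begins at \<open>\<eta>/2\<close>.\<close>

lemma solution_bounded:
  assumes "s > 1/2" and u0: "continuous_on UNIV u0" and u: "kdvb_global_solution \<nu> \<alpha> s u0 u"
    and cont: "continuous_on (UNIV \<times> {0<..}) (\<lambda>(x, t). u x t)"
  obtains M where "\<And>x t. x \<in> {0..2*pi} \<Longrightarrow> 0 < t \<Longrightarrow> t \<le> T \<Longrightarrow> cmod (u x t) \<le> M"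
proof -
  obtain \<eta> where \<eta>: "\<eta> > 0" "\<And>t x. 0 < t \<Longrightarrow> t < \<eta> \<Longrightarrow> cmod (u x t - u0 x) \<le> 1"
    using solution_uniformly_near_data[OF assms(1-3) zero_less_one] by metis
  have "compact (u0 ` {0..2*pi})"
    by (intro compact_continuous_image continuous_on_subset[OF u0]) auto
  from compact_imp_bounded[OF this] obtain A where A: "\<And>x. x \<in> {0..2*pi} \<Longrightarrow> cmod (u0 x) \<le> A"
    unfolding bounded_iff by blast
  have "compact ((\<lambda>(x, t). u x t) ` ({0..2*pi} \<times> {\<eta>/2..T}))"
    by (intro compact_continuous_image continuous_on_subset[OF cont] compact_Times compact_Icc) (use \<eta> in auto)
  from compact_imp_bounded[OF this] obtain B
    where B: "\<And>x t. x \<in> {0..2*pi} \<Longrightarrow> t \<in> {\<eta>/2..T} \<Longrightarrow> cmod (u x t) \<le> B"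
    unfolding bounded_iff by fastforce
  show thesis
  proof (rule that[of "max (A + 1) B"])
    fix x t assume x: "x \<in> {0..2*pi}" and t: "0 < t" "t \<le> T"
    show "cmod (u x t) \<le> max (A + 1) B"
    proof (cases "t < \<eta>")
      case True
      have "cmod (u x t) \<le> cmod (u x t - u0 x) + cmod (u0 x)"
        using norm_triangle_ineq[of "u x t - u0 x" "u0 x"] by simp
      then show ?thesis using \<eta>(2)[OF t(1) True, of x] A[OF x] by linarith
    next
      case False
      then show ?thesis using B[OF x, of t] t \<eta>(1) by fastforce
    qed
  qed
qed

text \<open>Gronwall's argument for the energy of \<open>w = u - v\<close>, using
  \<open>6 (u u_x - v v_x) = 3 ((u + v) w)_x\<close>. The derivative of the energy is at hand for t
  > 0, so the comparison is made with a small positive time, at which both solutions are uniformly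
  close to the data.\<close>

theorem kdvb_global_solution_unique:
  assumes "\<nu> > 0" "s > 1/2" and u0: "continuous_on UNIV u0"
    and u: "kdvb_global_solution \<nu> \<alpha> s u0 u" and v: "kdvb_global_solution \<nu> \<alpha> s u0 v" and "T \<ge> 0"
  shows "v x T = u x T"
proof (cases "T = 0")
  case True
  then show ?thesis using u v by (simp add: kdvb_global_solution_def)
next
  case False
  with \<open>T \<ge> 0\<close> have "T > 0" by simp
  obtain ut ux uxx uxxx where
    ut: "\<And>x t. t > 0 \<Longrightarrow> ((\<lambda>\<tau>. u x \<tau>) has_vector_derivative ut x t) (at t)" and
    ux: "\<And>x t. t > 0 \<Longrightarrow> ((\<lambda>y. u y t) has_vector_derivative ux x t) (at x)" and
    uxx: "\<And>x t. t > 0 \<Longrightarrow> ((\<lambda>y. ux y t) has_vector_derivative uxx x t) (at x)" and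
    uxxx: "\<And>x t. t > 0 \<Longrightarrow> ((\<lambda>y. uxx y t) has_vector_derivative uxxx x t) (at x)" and
    ueq: "\<And>x t. t > 0 \<Longrightarrow> ut x t - 6 * u x t * ux x t + complex_of_real \<alpha> * uxxx x t
              - complex_of_real \<nu> * uxx x t = 0" and
    uc: "\<forall>w\<in>{ut, ux, uxx, uxxx}. continuous_on (UNIV \<times> {0<..}) (\<lambda>(x, t). w x t)"
    by (rule kdvb_global_solutionE[OF u]) (rule that)
  obtain vt vx vxx vxxx where
    vt: "\<And>x t. t > 0 \<Longrightarrow> ((\<lambda>\<tau>. v x \<tau>) has_vector_derivative vt x t) (at t)" and
    vx: "\<And>x t. t > 0 \<Longrightarrow> ((\<lambda>y. v y t) has_vector_derivative vx x t) (at x)" and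
    vxx: "\<And>x t. t > 0 \<Longrightarrow> ((\<lambda>y. vx y t) has_vector_derivative vxx x t) (at x)" and
    vxxx: "\<And>x t. t > 0 \<Longrightarrow> ((\<lambda>y. vxx y t) has_vector_derivative vxxx x t) (at x)" and
    veq: "\<And>x t. t > 0 \<Longrightarrow> vt x t - 6 * v x t * vx x t + complex_of_real \<alpha> * vxxx x t
              - complex_of_real \<nu> * vxx x t = 0" and
    vc: "\<forall>w\<in>{vt, vx, vxx, vxxx}. continuous_on (UNIV \<times> {0<..}) (\<lambda>(x, t). w x t)"
    by (rule kdvb_global_solutionE[OF v]) (rule that)
  have per: "u (x + 2 * pi) t = u x t" "v (x + 2 * pi) t = v x t" if "t \<ge> 0" for x t
    using u v that unfolding kdvb_global_solution_def sobolev_def periodic_2pi_def by blast+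
  have ucont: "continuous_on (UNIV \<times> {0<..}) (\<lambda>(x, t). u x t)"
    by (rule jointly_continuous_of_partials[OF ut ux]) (use uc in auto)
  have vcont: "continuous_on (UNIV \<times> {0<..}) (\<lambda>(x, t). v x t)"
    by (rule jointly_continuous_of_partials[OF vt vx]) (use vc in auto)
  have slice: "continuous_on UNIV (\<lambda>x. g x t)" if "continuous_on (UNIV \<times> {0<..}) (\<lambda>(x, t). g x t)" "t > 0"
    for g :: "real \<Rightarrow> real \<Rightarrow> complex" and t
  proof -
    have "continuous_on UNIV (\<lambda>x. case (x, t) of (x, t) \<Rightarrow> g x t)"
      by (rule continuous_on_compose2[OF that(1)]) (use that(2) in \<open>auto intro!: continuous_intros\<close>)
    then show ?thesis by simp
  qed
  define w where "w x t = u x t - v x t" for x t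
  define wt where "wt x t = ut x t - vt x t" for x t
  obtain Mu where Mu: "\<And>x t. x \<in> {0..2*pi} \<Longrightarrow> 0 < t \<Longrightarrow> t \<le> T \<Longrightarrow> cmod (u x t) \<le> Mu"
    using solution_bounded[OF assms(2) u0 u ucont] by metis
  obtain Mv where Mv: "\<And>x t. x \<in> {0..2*pi} \<Longrightarrow> 0 < t \<Longrightarrow> t \<le> T \<Longrightarrow> cmod (v x t) \<le> Mv"
    using solution_bounded[OF assms(2) u0 v vcont] by metis
  \<comment> \<open>The constant of \<open>integral_energy_le\<close>, with \<open>Mu + Mv\<close>
    as the bound for \<open>u + v\<close>.\<close>
  define c where "c = 9 * (Mu + Mv)\<^sup>2 / (2 * \<nu>)"
  define E where "E t = integral {0..2*pi} (\<lambda>x. w x t \<bullet> w x t)" for t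
  have wc: "continuous_on (UNIV \<times> {0<..}) (\<lambda>(x, t). w x t)" "continuous_on (UNIV \<times> {0<..}) (\<lambda>(x, t). wt x t)"
    using continuous_on_diff[OF ucont vcont] continuous_on_diff[of _ "\<lambda>(x, t). ut x t" "\<lambda>(x, t). vt x t"] uc vc
    by (simp_all add: w_def wt_def case_prod_beta')
  have wi: "(\<lambda>x. w x t \<bullet> w x t) integrable_on {0..2*pi}" if "t > 0" for t
    by (intro integrable_continuous_interval continuous_intros continuous_on_subset[OF slice[OF wc(1) that]]) auto
  have E_nonneg: "E t \<ge> 0" if "t > 0" for t
    unfolding E_def by (rule integral_nonneg[OF wi[OF that]]) auto
  have dE: "(E has_vector_derivative integral {0..2*pi} (\<lambda>x. 2 * (w x t \<bullet> wt x t))) (at t)" if t: "t > 0" for t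
  proof -
    have "((\<lambda>t. integral (cbox 0 (2*pi)) (\<lambda>x. w x t \<bullet> w x t)) has_vector_derivative
        integral (cbox 0 (2*pi)) (\<lambda>x. 2 * (w x t \<bullet> wt x t))) (at t within {0<..})"
    proof (rule leibniz_rule_vector_derivative)
      fix t x :: real assume t: "t \<in> {0<..}"
      have "((\<lambda>t. w x t) has_vector_derivative wt x t) (at t within {0<..})"
        unfolding w_def wt_def
        by (rule has_vector_derivative_at_within[OF has_vector_derivative_diff[OF ut vt]]) (use t in auto)
      from bounded_bilinear.has_vector_derivative[OF bounded_bilinear_inner this this]
      show "((\<lambda>t. w x t \<bullet> w x t) has_vector_derivative 2 * (w x t \<bullet> wt x t)) (at t within {0<..})"
        by (simp add: inner_commute)
    next
      have sw: "continuous_on ({0<..} \<times> cbox 0 (2*pi)) (\<lambda>(t, x). g x t)"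
        if "continuous_on (UNIV \<times> {0<..}) (\<lambda>(x, t). g x t)" for g :: "real \<Rightarrow> real \<Rightarrow> complex"
      proof -
        have "continuous_on ({0<..} \<times> cbox 0 (2*pi)) (\<lambda>p. case prod.swap p of (x, t) \<Rightarrow> g x t)"
          by (rule continuous_on_compose2[OF that]) (auto intro!: continuous_on_swap)
        then show ?thesis by (simp add: case_prod_beta')
      qed
      show "continuous_on ({0<..} \<times> cbox 0 (2*pi)) (\<lambda>(t, x). 2 * (w x t \<bullet> wt x t))"
        using sw[OF wc(1)] sw[OF wc(2)] unfolding case_prod_beta' by (intro continuous_intros)
    qed (use t wi in auto)
    moreover have "at t within {0<..} = at t"
      by (rule at_within_open) (use t in auto)
    moreover have "E = (\<lambda>t. integral {0..2*pi} (\<lambda>x. w x t \<bullet> w x t))"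
      by (simp add: fun_eq_iff E_def)
    ultimately show ?thesis
      by (simp only: cbox_interval)
  qed
  have dE_le: "integral {0..2*pi} (\<lambda>x. 2 * (w x t \<bullet> wt x t)) \<le> c * E t" if t: "t > 0" "t \<le> T" for t
    unfolding c_def E_def
  proof (rule integral_energy_le[OF \<open>\<nu> > 0\<close>, where ?w1.0 = "\<lambda>x. ux x t - vx x t" and ?w2.0 = "\<lambda>x. uxx x t - vxx x t"
        and ?w3.0 = "\<lambda>x. uxxx x t - vxxx x t" and z = "\<lambda>x. u x t + v x t" and ?z1.0 = "\<lambda>x. ux x t + vx x t" and \<alpha> = \<alpha>])
    fix x
    show "((\<lambda>x. w x t) has_vector_derivative ux x t - vx x t) (at x)"
      unfolding w_def by (rule has_vector_derivative_diff[OF ux[OF t(1)] vx[OF t(1)]])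
    show "((\<lambda>x. ux x t - vx x t) has_vector_derivative uxx x t - vxx x t) (at x)"
      by (rule has_vector_derivative_diff[OF uxx[OF t(1)] vxx[OF t(1)]])
    show "((\<lambda>x. uxx x t - vxx x t) has_vector_derivative uxxx x t - vxxx x t) (at x)"
      by (rule has_vector_derivative_diff[OF uxxx[OF t(1)] vxxx[OF t(1)]])
    show "((\<lambda>x. u x t + v x t) has_vector_derivative ux x t + vx x t) (at x)"
      by (rule has_vector_derivative_add[OF ux[OF t(1)] vx[OF t(1)]])
    show "w (x + 2 * pi) t = w x t" "u (x + 2 * pi) t + v (x + 2 * pi) t = u x t + v x t"
      using per t by (simp_all add: w_def)
    have eq: "ut x t = 6 * u x t * ux x t - of_real \<alpha> * uxxx x t + of_real \<nu> * uxx x t"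
      using ueq[OF t(1), of x] by (simp add: algebra_simps add_eq_0_iff2)
    have eq': "vt x t = 6 * v x t * vx x t - of_real \<alpha> * vxxx x t + of_real \<nu> * vxx x t"
      using veq[OF t(1), of x] by (simp add: algebra_simps add_eq_0_iff2)
    show "wt x t = - of_real \<alpha> * (uxxx x t - vxxx x t) + of_real \<nu> * (uxx x t - vxx x t) +
        3 * ((ux x t + vx x t) * w x t + (u x t + v x t) * (ux x t - vx x t))"
      unfolding wt_def w_def eq eq' by (simp add: algebra_simps)
  next
    show "continuous_on UNIV (\<lambda>x. uxxx x t - vxxx x t)"
      by (intro continuous_intros slice t) (use uc vc in auto)
    show "continuous_on UNIV (\<lambda>x. ux x t + vx x t)"
      by (intro continuous_intros slice t) (use uc vc in auto)
    show "cmod (u x t + v x t) \<le> Mu + Mv" if "x \<in> {0..2*pi}" for x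
      using norm_triangle_ineq[of "u x t" "v x t"] Mu[OF that t] Mv[OF that t] by linarith
  qed
  \<comment> \<open>Integrating factor: \<open>E' \<le> c E\<close> says that \<open>G\<close> is
    nonincreasing.\<close>
  define G where "G t = exp (- c * t) * E t" for t
  have G_mono: "G T \<le> G t" if t: "0 < t" "t \<le> T" for t
  proof (rule DERIV_nonpos_imp_nonincreasing[OF t(2)])
    fix r assume r: "t \<le> r" "r \<le> T"
    let ?I = "integral {0..2*pi} (\<lambda>x. 2 * (w x r \<bullet> wt x r))"
    have "(E has_real_derivative ?I) (at r)"
      using dE[of r] r t by (simp add: has_real_derivative_iff_has_vector_derivative)
    then have "(G has_real_derivative exp (- c * r) * (?I - c * E r)) (at r)"
      unfolding G_def by (auto intro!: derivative_eq_intros simp: algebra_simps)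
    moreover have "exp (- c * r) * (?I - c * E r) \<le> 0"
      using dE_le[of r] r t by (simp add: mult_nonneg_nonpos)
    ultimately show "\<exists>y. (G has_real_derivative y) (at r) \<and> y \<le> 0" by blast
  qed
  have "c \<ge> 0" using \<open>\<nu> > 0\<close> by (simp add: c_def)
  have small: "G T \<le> 8 * pi * e\<^sup>2" if e: "e > 0" for e
  proof -
    obtain \<eta>1 where \<eta>1: "\<eta>1 > 0" "\<And>t x. 0 < t \<Longrightarrow> t < \<eta>1 \<Longrightarrow> cmod (u x t - u0 x) \<le> e"
      using solution_uniformly_near_data[OF assms(2) u0 u e] by metis
    obtain \<eta>2 where \<eta>2: "\<eta>2 > 0" "\<And>t x. 0 < t \<Longrightarrow> t < \<eta>2 \<Longrightarrow> cmod (v x t - u0 x) \<le> e"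
      using solution_uniformly_near_data[OF assms(2) u0 v e] by metis
    define t where "t = min T (min \<eta>1 \<eta>2) / 2"
    have t: "0 < t" "t \<le> T" "t < \<eta>1" "t < \<eta>2"
      using \<open>T > 0\<close> \<eta>1(1) \<eta>2(1) by (auto simp: t_def)
    have w2: "w x t \<bullet> w x t \<le> (2 * e)\<^sup>2" for x
    proof -
      have "w x t = (u x t - u0 x) - (v x t - u0 x)" by (simp add: w_def)
      then have "cmod (w x t) \<le> cmod (u x t - u0 x) + cmod (v x t - u0 x)"
        by (metis norm_triangle_ineq4)
      then have "cmod (w x t) \<le> 2 * e"
        using \<eta>1(2)[OF t(1,3), of x] \<eta>2(2)[OF t(1,4), of x] by linarith
      from power_mono[OF this, of 2] show ?thesis
        by (simp add: power2_norm_eq_inner)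
    qed
    have "E t \<le> integral {0..2*pi} (\<lambda>x. (2 * e)\<^sup>2)"
      unfolding E_def by (intro integral_le wi t w2) auto
    also have "\<dots> = 8 * pi * e\<^sup>2" by (simp add: power2_eq_square)
    finally have E: "E t \<le> 8 * pi * e\<^sup>2" .
    have "G t \<le> 1 * E t"
      unfolding G_def using \<open>c \<ge> 0\<close> t E_nonneg[OF t(1)] by (intro mult_right_mono) auto
    then show ?thesis using G_mono[OF t(1,2)] E by linarith
  qed
  have "G T \<le> 0"
  proof (rule ccontr)
    assume "\<not> G T \<le> 0"
    then have "G T > 0" by simp
    \<comment> \<open>For this value of \<open>e\<close> the bound reads
      \<open>G T \<le> G T / 2\<close>.\<close>
    then have "sqrt (G T / (16 * pi)) > 0" by simp
    from small[OF this] \<open>G T > 0\<close> show False by simp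
  qed
  then have "E T \<le> 0" by (simp add: G_def mult_le_0_iff)
  with E_nonneg[OF \<open>T > 0\<close>] have "integral {0..2*pi} (\<lambda>x. w x T \<bullet> w x T) = 0" by (simp add: E_def)
  moreover have "continuous_on {0..2*pi} (\<lambda>x. w x T \<bullet> w x T)"
    by (intro continuous_intros continuous_on_subset[OF slice[OF wc(1) \<open>T > 0\<close>]]) auto
  ultimately have zero: "w y T = 0" if "y \<in> {0..2*pi}" for y
    using integral_eq_0_iff[of 0 "2*pi" "\<lambda>x. w x T \<bullet> w x T"] that by simp
  have "periodic_2pi (\<lambda>x. w x T)"
    using per \<open>T \<ge> 0\<close> by (simp add: periodic_2pi_def w_def)
  from this zero have "w x T = 0" by (rule periodic_2pi_eq_0)
  then show ?thesis by (simp add: w_def)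
qed

section \<open>Decay of the Sobolev norms and conclusion\<close>

lemma sobolev_norm_mode_series_le:
  assumes "\<nu> > 0" "t \<ge> 1" and K: "\<And>n. cmod (mode \<nu> \<alpha> a0 n t) \<le> K * exp (- (\<nu> * n * t / 2))"
  defines "u \<equiv> \<lambda>x. suminf (\<lambda>n. mode \<nu> \<alpha> a0 n t * cis (real n * x))"
  shows "u \<in> sobolev s"
    and "sobolev_norm s u \<le> sqrt (suminf (\<lambda>n. (1 + (real n)\<^sup>2) powr s * (K\<^sup>2 * exp (- (\<nu> / 2)) ^ n))) * exp (- (\<nu> * t / 4))"
proof -
  define x where "x = exp (- (\<nu> / 2))"
  have x: "0 < x" "x < 1" using \<open>\<nu> > 0\<close> by (auto simp: x_def)
  define W where "W n = (1 + (real n)\<^sup>2) powr s" for n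
  define a where "a n = mode \<nu> \<alpha> a0 n t" for n
  have sumW: "summable (\<lambda>n. W n * (K\<^sup>2 * x ^ n))"
    using summable_mult[OF summable_sobolev_weight_geometric[OF x, of s], of "K\<^sup>2"] by (simp add: W_def mult_ac)
  have "K \<ge> 0" using order_trans[OF norm_ge_zero K[of 0]] by simp
  have a2: "(cmod (a n))\<^sup>2 \<le> K\<^sup>2 * x ^ n * exp (- (\<nu> * t / 2))" for n
  proof (cases "n = 0")
    case True
    then show ?thesis by (simp add: a_def mode_def)
  next
    case False
    have "(cmod (a n))\<^sup>2 \<le> (K * exp (- (\<nu> * n * t / 2)))\<^sup>2"
      unfolding a_def by (intro power_mono K) auto
    also have "\<dots> = K\<^sup>2 * exp (- (\<nu> * n * t))"
      by (simp add: power_mult_distrib flip: exp_of_nat_mult)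
    also have "\<dots> \<le> K\<^sup>2 * exp (- (\<nu> / 2 * n) - \<nu> * t / 2)"
    proof (intro mult_left_mono)
      have "real n * 1 \<le> real n * t" "1 * t \<le> real n * t"
        using False \<open>t \<ge> 1\<close> by (auto intro!: mult_left_mono mult_right_mono simp del: mult_1_left mult_1_right)
      \<comment> \<open>Half of \<open>n\<close> keeps the weighted series convergent with a
        constant free of \<open>t\<close>, and half of \<open>t\<close> gives the decay, at rate
        \<open>\<nu>/4\<close> after the square root. The inequality fails for n = 0, where the mode
        vanishes.\<close>
      then have "n / 2 + t / 2 \<le> n * t" by simp
      from mult_left_mono[OF this, of \<nu>] \<open>\<nu> > 0\<close>
      show "exp (- (\<nu> * n * t)) \<le> exp (- (\<nu> / 2 * n) - \<nu> * t / 2)" by (simp add: algebra_simps)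
    qed auto
    also have "\<dots> = K\<^sup>2 * (exp (- (\<nu> / 2 * n)) * exp (- (\<nu> * t / 2)))"
      by (simp flip: exp_add)
    also have "exp (- (\<nu> / 2 * n)) = x ^ n"
      by (simp add: x_def flip: exp_of_nat_mult)
    finally show ?thesis by (simp add: mult.assoc)
  qed
  have Wa: "W n * (cmod (a n))\<^sup>2 \<le> W n * (K\<^sup>2 * x ^ n) * exp (- (\<nu> * t / 2))" for n
    using mult_left_mono[OF a2, of "W n" n] by (simp add: W_def mult_ac)
  have sumWa: "summable (\<lambda>n. W n * (cmod (a n))\<^sup>2)"
    by (rule summable_comparison_test'[OF summable_mult2[OF sumW, of "exp (- (\<nu> * t / 2))"]])
       (use Wa in \<open>auto simp: W_def\<close>)
  have suma: "summable (\<lambda>n. cmod (a n))"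
  proof (rule summable_comparison_test')
    define y where "y = exp (- (\<nu> * t / 2))"
    have "0 < y" "y < 1" using \<open>\<nu> > 0\<close> \<open>t \<ge> 1\<close> by (auto simp: y_def)
    then show "summable (\<lambda>n. K * y ^ n)" by (intro summable_mult summable_geometric) auto
    show "norm (cmod (a n)) \<le> K * y ^ n" if "n \<ge> 0" for n
      using K[of n] by (simp add: a_def y_def mult_ac flip: exp_of_nat_mult)
  qed
  show "u \<in> sobolev s"
    unfolding u_def a_def[symmetric] using suma sumWa[unfolded W_def] by (rule trig_series_sobolev(1))
  have "suminf (\<lambda>n. W n * (cmod (a n))\<^sup>2) \<le> suminf (\<lambda>n. W n * (K\<^sup>2 * x ^ n) * exp (- (\<nu> * t / 2)))"
    by (intro suminf_le Wa sumWa summable_mult2[OF sumW])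
  also have "\<dots> = suminf (\<lambda>n. W n * (K\<^sup>2 * x ^ n)) * exp (- (\<nu> * t / 2))"
    by (rule suminf_mult2[OF sumW, symmetric])
  also have "exp (- (\<nu> * t / 2)) = (exp (- (\<nu> * t / 4)))\<^sup>2"
    by (simp flip: exp_of_nat_mult)
  finally have "sqrt (suminf (\<lambda>n. W n * (cmod (a n))\<^sup>2)) \<le> sqrt (suminf (\<lambda>n. W n * (K\<^sup>2 * x ^ n)) * (exp (- (\<nu> * t / 4)))\<^sup>2)"
    by simp
  then show "sobolev_norm s u \<le> sqrt (suminf (\<lambda>n. (1 + (real n)\<^sup>2) powr s * (K\<^sup>2 * exp (- (\<nu> / 2)) ^ n))) * exp (- (\<nu> * t / 4))"
    unfolding u_def a_def[symmetric] trig_series_sobolev(2)[OF suma sumWa[unfolded W_def]]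
    by (simp add: W_def x_def real_sqrt_mult)
qed

lemma has_sum_from_1_imp_series:
  fixes f :: "nat \<Rightarrow> 'a::banach"
  assumes "(f has_sum S) {1..}" and "f 0 = 0"
  shows "f sums S"
proof -
  have "(f has_sum S) UNIV"
    by (rule has_sum_cong_neutral[THEN iffD1, OF _ _ _ assms(1)]) (use assms(2) in \<open>auto simp: not_le\<close>)
  then show ?thesis by (rule has_sum_imp_sums)
qed

theorem theorem3p3:
  fixes \<nu> \<alpha> :: real
  assumes "\<nu> > 0" and "\<alpha> \<ge> 0"
    and "\<exists>C0::real. \<forall>(k::nat) (h::nat) (l::nat) (j :: nat \<Rightarrow>\<^sub>0 nat).
           k \<ge> 1 \<and> k \<le> h \<and> h < k^2 \<and> k \<le> l \<and> l < k^3 \<and>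
           Poly_Mapping.keys j \<subseteq> {1..k} \<and> (\<Sum>i=1..k. i * Poly_Mapping.lookup j i) = k
           \<longrightarrow> cmod (C_coeff \<alpha> \<nu> k h l j) \<le> C0"
  shows "\<exists>C :: real \<Rightarrow> real. \<forall>(s0::real) (u0 :: real \<Rightarrow> complex) (a0 :: nat \<Rightarrow> complex).
           s0 > 1/2 \<longrightarrow> u0 \<in> sobolev s0 \<longrightarrow>
           (\<forall>x. ((\<lambda>k. a0 k * cis (real k * x)) has_sum u0 x) {1..}) \<longrightarrow>
           (\<forall>k\<ge>1. cmod (a0 k) \<le> 1) \<longrightarrow>
           (\<exists>u :: real \<Rightarrow> real \<Rightarrow> complex.
              kdvb_global_solution \<nu> \<alpha> s0 u0 u
            \<and> (\<forall>v. kdvb_global_solution \<nu> \<alpha> s0 u0 v \<longrightarrow> (\<forall>x. \<forall>t\<ge>0. v x t = u x t))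
            \<and> (\<forall>x. \<forall>t\<ge>0. ((\<lambda>k. sol_coeff \<nu> \<alpha> a0 k t * cis (real k * x)) has_sum u x t) {1..})
            \<and> (\<forall>s\<ge>0. \<exists>T0>0. \<exists>\<delta>>0. \<forall>t\<ge>T0.
                 (\<lambda>x. u x t) \<in> sobolev s \<and>
                 sobolev_norm s (\<lambda>x. u x t)
                   < C s / (1 - exp (- \<nu> * t)) * exp (- \<delta> * \<nu> * t)))"
proof -
  note hyp = assms(3)
  obtain K where K: "\<And>a0 k t. (\<forall>i\<ge>1. cmod (a0 i) \<le> 1) \<Longrightarrow> t \<ge> 1 \<Longrightarrow>
      cmod (mode \<nu> \<alpha> a0 k t) \<le> K * exp (- (\<nu> * k * t / 2))"
    using mode_decay[OF \<open>\<nu> > 0\<close> hyp zero_less_one] by blast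
  \<comment> \<open>Free of the data, since \<open>K\<close> was obtained before any data
    appear.\<close>
  define L where "L s = suminf (\<lambda>n. (1 + (real n)\<^sup>2) powr s * (K\<^sup>2 * exp (- (\<nu> / 2)) ^ n))" for s
  show ?thesis
  \<comment> \<open>The added 1 yields the strict inequality, even for the zero solution.\<close>
  proof (intro exI[of _ "\<lambda>s. sqrt (L s) + 1"] allI impI)
    fix s0 :: real and u0 :: "real \<Rightarrow> complex" and a0 :: "nat \<Rightarrow> complex"
    assume s0: "s0 > 1/2" and u0: "u0 \<in> sobolev s0"
      and series: "\<forall>x. ((\<lambda>k. a0 k * cis (real k * x)) has_sum u0 x) {1..}"
      and a0: "\<forall>k\<ge>1. cmod (a0 k) \<le> 1"
    \<comment> \<open>Agrees with the data from 1 on and is 0 at 0, where \<open>a0\<close> is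
      arbitrary.\<close>
    define c where "c k = mode \<nu> \<alpha> a0 k 0" for k
    have c: "c k = (if k = 0 then 0 else a0 k)" for k
      by (simp add: c_def mode_0[unfolded One_nat_def, OF Suc_leI] mode_def[of _ _ _ 0])
    have c_series: "((\<lambda>k. c k * cis (real k * x)) has_sum u0 x) {1..}" for x
      using series by (subst has_sum_cong[where g = "\<lambda>k. a0 k * cis (real k * x)"]) (auto simp: c)
    have sums_c: "(\<lambda>k. c k * cis (real k * x)) sums u0 x" for x
      by (rule has_sum_from_1_imp_series[OF c_series]) (simp add: c)
    have abs_c: "summable (\<lambda>k. cmod (c k))"
    proof -
      \<comment> \<open>At x = 0 the exponential factors are 1. Summation over a set is
        unconditional, hence absolute for complex families, so the representation of
        \<open>u0\<close> already makes the coefficients summable.\<close>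
      have "(\<lambda>k. c k * cis (real k * 0)) summable_on {1..}"
        using c_series[of 0] unfolding summable_on_def by blast
      then have "(\<lambda>k. cmod (c k)) summable_on {1..}"
        by (simp add: summable_on_iff_abs_summable_on_complex)
      then obtain S where "((\<lambda>k. cmod (c k)) has_sum S) {1..}" by (auto simp: summable_on_def)
      from has_sum_from_1_imp_series[OF this] show ?thesis by (simp add: c sums_iff)
    qed
    have u0_eq: "u0 = (\<lambda>x. suminf (\<lambda>n. c n * cis (of_int (int n) * x)))"
      using sums_c by (auto simp: sums_iff)
    have u0_cont: "continuous_on UNIV u0"
      unfolding u0_eq by (rule trig_series_continuous[OF abs_c])
    \<comment> \<open>Identifies the given coefficients with the Fourier coefficients of
      \<open>u0\<close>, so that membership of \<open>u0\<close> in the Sobolev space becomes a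
      condition on \<open>c\<close>.\<close>
    have coeff: "fourier_coeff u0 (int n) = c n" for n
      unfolding u0_eq by (subst trig_series_fourier_coeff[OF abs_c]) auto
    have sob_c: "summable (\<lambda>k. (1 + (real k)\<^sup>2) powr s0 * (cmod (c k))\<^sup>2)"
    proof -
      let ?g = "\<lambda>k::int. (1 + (of_int k)\<^sup>2) powr s0 * (cmod (fourier_coeff u0 k))\<^sup>2"
      have "?g summable_on UNIV"
        using u0 unfolding sobolev_def by blast
      then have "?g summable_on range int"
        by (rule summable_on_subset_banach) simp
      then have "(?g \<circ> int) summable_on UNIV"
        by (simp add: summable_on_reindex)
      then have "summable (?g \<circ> int)"
        by (subst (asm) summable_on_UNIV_nonneg_real_iff) auto
      then show ?thesis by (simp add: o_def coeff)
    qed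
    have decay: "\<exists>K>0. \<forall>n. \<forall>t\<ge>\<eta>. cmod (mode \<nu> \<alpha> a0 n t) \<le> K * exp (- (\<nu> * n * t / 2))" if "\<eta> > 0" for \<eta>
      using mode_decay[OF \<open>\<nu> > 0\<close> hyp that] a0 by blast
    have sum_a0: "summable (\<lambda>k. cmod (a0 k))" "summable (\<lambda>k. (1 + (real k)\<^sup>2) powr s0 * (cmod (a0 k))\<^sup>2)"
    proof -
      have ev: "eventually (\<lambda>k. c k = a0 k) sequentially"
        using eventually_gt_at_top[of 0] by eventually_elim (simp add: c)
      show "summable (\<lambda>k. cmod (a0 k))"
        using abs_c by (rule summable_cong[THEN iffD1, rotated]) (use ev in eventually_elim, simp)
      show "summable (\<lambda>k. (1 + (real k)\<^sup>2) powr s0 * (cmod (a0 k))\<^sup>2)"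
        using sob_c by (rule summable_cong[THEN iffD1, rotated]) (use ev in eventually_elim, simp)
    qed
    obtain B where B: "\<And>k t. t \<ge> 0 \<Longrightarrow> cmod (mode \<nu> \<alpha> a0 k t) \<le> B k" "summable B"
      "summable (\<lambda>k. (1 + (real k)\<^sup>2) powr s0 * (B k)\<^sup>2)"
      by (rule mode_majorant[OF \<open>\<nu> > 0\<close> _ hyp a0 sum_a0]) (use s0 in \<open>auto intro: that\<close>)
    define u where "u x t = suminf (\<lambda>n. mode \<nu> \<alpha> a0 n t * cis (real n * x))" for x t
    have sol: "kdvb_global_solution \<nu> \<alpha> s0 u0 u"
      unfolding u_def
      by (rule mode_series_global_solution[OF \<open>\<nu> > 0\<close> decay B])
         (use sums_c in \<open>simp_all add: sums_iff c_def\<close>)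
    show "\<exists>u. kdvb_global_solution \<nu> \<alpha> s0 u0 u
            \<and> (\<forall>v. kdvb_global_solution \<nu> \<alpha> s0 u0 v \<longrightarrow> (\<forall>x. \<forall>t\<ge>0. v x t = u x t))
            \<and> (\<forall>x. \<forall>t\<ge>0. ((\<lambda>k. sol_coeff \<nu> \<alpha> a0 k t * cis (real k * x)) has_sum u x t) {1..})
            \<and> (\<forall>s\<ge>0. \<exists>T0>0. \<exists>\<delta>>0. \<forall>t\<ge>T0. (\<lambda>x. u x t) \<in> sobolev s \<and>
                 sobolev_norm s (\<lambda>x. u x t) < (sqrt (L s) + 1) / (1 - exp (- \<nu> * t)) * exp (- \<delta> * \<nu> * t))"
    proof (rule exI[of _ u], intro conjI allI impI)
      show "kdvb_global_solution \<nu> \<alpha> s0 u0 u" by (rule sol)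
      show "v x t = u x t" if "kdvb_global_solution \<nu> \<alpha> s0 u0 v" "t \<ge> 0" for v x t
        by (rule kdvb_global_solution_unique[OF \<open>\<nu> > 0\<close> s0 u0_cont sol that])
    next
      fix x t :: real assume t: "t \<ge> 0"
      let ?f = "\<lambda>k. mode \<nu> \<alpha> a0 k t * cis (real k * x)"
      have n: "summable (\<lambda>k. norm (?f k))"
        by (rule summable_comparison_test'[OF B(2)]) (use B(1)[OF t] in \<open>simp add: norm_mult\<close>)
      have "(?f has_sum u x t) UNIV"
        unfolding u_def using n summable_sums[OF summable_norm_cancel[OF n]] by (rule norm_summable_imp_has_sum)
      then show "((\<lambda>k. sol_coeff \<nu> \<alpha> a0 k t * cis (real k * x)) has_sum u x t) {1..}"
        by (rule has_sum_cong_neutral[THEN iffD1, rotated -1]) (auto simp: mode_def not_le)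
    next
      fix s :: real assume "s \<ge> 0"
      show "\<exists>T0>0. \<exists>\<delta>>0. \<forall>t\<ge>T0. (\<lambda>x. u x t) \<in> sobolev s \<and>
          sobolev_norm s (\<lambda>x. u x t) < (sqrt (L s) + 1) / (1 - exp (- \<nu> * t)) * exp (- \<delta> * \<nu> * t)"
      \<comment> \<open>\<open>T0 = 1\<close> is the time from which \<open>K\<close> is valid, and
        \<open>1/4\<close> is the rate from \<open>sobolev_norm_mode_series_le\<close>.\<close>
      proof (rule exI[of _ 1], intro conjI, simp, rule exI[of _ "1/4"], intro conjI allI impI)
        fix t :: real assume t: "t \<ge> 1"
        note bound = sobolev_norm_mode_series_le[OF \<open>\<nu> > 0\<close> t K[OF a0 t]]
        show "(\<lambda>x. u x t) \<in> sobolev s" unfolding u_def by (rule bound(1))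
        have "L s \<ge> 0"
          unfolding L_def
          using summable_mult[OF summable_sobolev_weight_geometric[of "exp (- (\<nu> / 2))" s], of "K\<^sup>2"] \<open>\<nu> > 0\<close>
          by (intro suminf_nonneg) (auto simp: mult_ac)
        have e: "0 < 1 - exp (- \<nu> * t)" "1 - exp (- \<nu> * t) \<le> 1"
          using \<open>\<nu> > 0\<close> t by auto
        have "sobolev_norm s (\<lambda>x. u x t) \<le> sqrt (L s) * exp (- (\<nu> * t / 4))"
          unfolding u_def L_def by (rule bound(2))
        also have "\<dots> < (sqrt (L s) + 1) * exp (- (\<nu> * t / 4))"
          by (intro mult_strict_right_mono) auto
        \<comment> \<open>Division by \<open>1 - exp (- \<nu> t)\<close>, a number in (0, 1], can
          only enlarge the bound.\<close>
        also have "\<dots> \<le> (sqrt (L s) + 1) / (1 - exp (- \<nu> * t)) * exp (- (\<nu> * t / 4))"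
        proof (intro mult_right_mono)
          have "(sqrt (L s) + 1) * (1 - exp (- \<nu> * t)) \<le> (sqrt (L s) + 1) * 1"
            using e(2) \<open>L s \<ge> 0\<close> by (intro mult_left_mono) auto
          then show "sqrt (L s) + 1 \<le> (sqrt (L s) + 1) / (1 - exp (- \<nu> * t))"
            using e(1) by (simp add: pos_le_divide_eq)
        qed auto
        finally show "sobolev_norm s (\<lambda>x. u x t) < (sqrt (L s) + 1) / (1 - exp (- \<nu> * t)) * exp (- (1/4) * \<nu> * t)"
          by simp
      qed auto
    qed
  qed
qed

end
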